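(* Let $\mathfrak g$ be a finite-dimensional simple Lie algebra over $\mathbb C$, let $V$ be a finite-dimensional faithful highest weight $\mathfrak g$-module with highest weight $\lambda$ and highest weight vector $v_\lambda$ such that the lattice generated by the weights of $V$ is the weight lattice $P$, let $V_{\mathbb Z}=\mathcal U_{\mathbb Z}\cdot v_\lambda$, let $G(\mathbb Q)$ be the corresponding simply connected Chevalley group, and let $\Gamma(\mathbb Z)=\{g\in G(\mathbb Q)\mid g\cdot V_{\mathbb Z}=V_{\mathbb Z}\}$. Then in $G(\mathbb Q)$ we have $$G(\mathbb Z)\cap U(\mathbb Q)=\Gamma(\mathbb Z)\cap U(\mathbb Q).$$ Thus any element of $U(\mathbb Q)$ that stabilizes $V_{\mathbb Z}$ lies in $G(\mathbb Z)$.
   Context: Fix a Cartan subalgebra $\mathfrak h$ of $\mathfrak g$, the root system $\Delta\subset\mathfrak h^*$, positive roots $\Delta^+$, simple roots $\alpha_i$ ($i\in I$), coroots $h_\alpha=\alpha^\vee$ with $h_i=h_{\alpha_i}$, and a Chevalley basis $\{x_\alpha,h_i\mid\alpha\in\Delta,\ i\in I\}$ of $\mathfrak g$. The weight lattice is $P=\{\mu\in\mathfrak h^*\mid\langle\mu,h_i\rangle\in\mathbb Z\ \forall i\}$. A faithful finite-dimensional highest weight module here is the nontrivial irreducible $\mathfrak g$-module $V=V^\lambda$ with highest weight $\lambda$. $\mathcal U_{\mathbb Z}$ is the Cartier–Kostant $\mathbb Z$-form of the universal enveloping algebra: the $\mathbb Z$-subalgebra generated by $x_\alpha^m/m!$ ($\alpha\in\Delta$,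 $m\ge0$) and $\binom{h_i}{m}$ ($i\in I$, $m\ge0$). The lattice $V_{\mathbb Z}$ is a $\mathbb Z$-form of $V$. For $\alpha\in\Delta$, $u\in\mathbb Q$, let $\chi_\alpha(u)=\exp(u x_\alpha)$ acting on $V$ (a finite sum). For $i\in I$, $t\in\mathbb Q^\times$, let $h_i(t)$ act on each weight space $V_\mu$ as the scalar $t^{\langle\mu,\alpha_i^\vee\rangle}$. Then $G(\mathbb Q)=\langle\chi_\alpha(u),h_i(t)\mid\alpha\in\Delta,\ u\in\mathbb Q,\ i\in I,\ t\in\mathbb Q^\times\rangle$; $G(\mathbb Z)$ is its subgroup generated by $\chi_\alpha(u)$ and $h_i(-1)$ for $\alpha\in\Delta$, $u\in\mathbb Z$, $i\in I$; and $U(\mathbb Q)=\langle\chi_\alpha(t)\mid\alpha\in\Delta^+,\ t\in\mathbb Q\rangle$. *)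

theory Defs
  imports
    Complex_Main
    "HOL-Library.Function_Algebras"
    "HOL-Library.Poly_Mapping"
    "HOL-Computational_Algebra.Group_Closure"
    "HOL-Algebra.Bij"
    "HOL-Algebra.Generated_Groups"
    "HOL-Algebra.Generated_Rings"
    "HOL-Algebra.QuotRing"
    "HOL-Algebra.Algebraic_Closure_Type"
begin

section \<open>Complex Lie algebras and their modules\<close>

text \<open>
  A complex vector space is a type with an explicit scalar multiplication, as in
  \<^locale>\<open>vector_space\<close>; the Lie algebra and the module are the whole types.
\<close>

locale lie_algebra = vector_space scale
  for scale :: "complex \<Rightarrow> 'g::ab_group_add \<Rightarrow> 'g" +
  fixes bracket :: "'g \<Rightarrow> 'g \<Rightarrow> 'g"
  assumes bracket_linear_left: "Vector_Spaces.linear scale scale (\<lambda>x. bracket x y)"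
    and bracket_linear_right: "Vector_Spaces.linear scale scale (bracket x)"
    and bracket_self: "bracket x x = 0"
    and jacobi: "bracket x (bracket y z) + bracket y (bracket z x) + bracket z (bracket x y) = 0"

locale lie_module = lie_algebra scale bracket + V: vector_space vscale
  for scale :: "complex \<Rightarrow> 'g::ab_group_add \<Rightarrow> 'g"
    and bracket :: "'g \<Rightarrow> 'g \<Rightarrow> 'g"
    and vscale :: "complex \<Rightarrow> 'v::ab_group_add \<Rightarrow> 'v" +
  fixes act :: "'g \<Rightarrow> 'v \<Rightarrow> 'v"
  assumes act_linear_left: "Vector_Spaces.linear scale vscale (\<lambda>x. act x v)"
    and act_linear_right: "Vector_Spaces.linear vscale vscale (act x)"
    and act_bracket: "act (bracket x y) v = act x (act y v) - act y (act x v)"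

definition finite_dim :: "(complex \<Rightarrow> 'a::ab_group_add \<Rightarrow> 'a) \<Rightarrow> bool" where
  "finite_dim scale \<longleftrightarrow> (\<exists>B. finite B \<and> module.span scale B = UNIV)"

definition lie_ideal ::
  "(complex \<Rightarrow> 'g::ab_group_add \<Rightarrow> 'g) \<Rightarrow> ('g \<Rightarrow> 'g \<Rightarrow> 'g) \<Rightarrow> 'g set \<Rightarrow> bool" where
  "lie_ideal scale bracket J \<longleftrightarrow>
     module.subspace scale J \<and> (\<forall>x. \<forall>y\<in>J. bracket x y \<in> J)"

definition simple_lie_algebra ::
  "(complex \<Rightarrow> 'g::ab_group_add \<Rightarrow> 'g) \<Rightarrow> ('g \<Rightarrow> 'g \<Rightarrow> 'g) \<Rightarrow> bool" where
  "simple_lie_algebra scale bracket \<longleftrightarrow>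
     lie_algebra scale bracket \<and> (\<exists>x y. bracket x y \<noteq> 0) \<and>
     (\<forall>J. lie_ideal scale bracket J \<longrightarrow> J = {0} \<or> J = UNIV)"

definition faithful_action :: "('g::zero \<Rightarrow> 'v::zero \<Rightarrow> 'v) \<Rightarrow> bool" where
  "faithful_action act \<longleftrightarrow> (\<forall>x. (\<forall>v. act x v = 0) \<longrightarrow> x = 0)"

definition irreducible_action ::
  "(complex \<Rightarrow> 'v::ab_group_add \<Rightarrow> 'v) \<Rightarrow> ('g \<Rightarrow> 'v \<Rightarrow> 'v) \<Rightarrow> bool" where
  "irreducible_action vscale act \<longleftrightarrow>
     (\<exists>v::'v. v \<noteq> 0) \<and>
     (\<forall>W. module.subspace vscale W \<and> (\<forall>x. \<forall>w\<in>W. act x w \<in> W) \<longrightarrow> W = {0} \<or> W = UNIV)"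


section \<open>Cartan subalgebras, weights and roots\<close>

primrec lower_central ::
  "(complex \<Rightarrow> 'g::ab_group_add \<Rightarrow> 'g) \<Rightarrow> ('g \<Rightarrow> 'g \<Rightarrow> 'g) \<Rightarrow> 'g set \<Rightarrow> nat \<Rightarrow> 'g set" where
  "lower_central scale bracket H 0 = H"
| "lower_central scale bracket H (Suc n) =
     module.span scale {bracket x y | x y. x \<in> H \<and> y \<in> lower_central scale bracket H n}"

text \<open>A nilpotent subalgebra that is equal to its own normalizer.\<close>

definition cartan_subalgebra ::
  "(complex \<Rightarrow> 'g::ab_group_add \<Rightarrow> 'g) \<Rightarrow> ('g \<Rightarrow> 'g \<Rightarrow> 'g) \<Rightarrow> 'g set \<Rightarrow> bool" where
  "cartan_subalgebra scale bracket H \<longleftrightarrow>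
     module.subspace scale H \<and> (\<forall>x\<in>H. \<forall>y\<in>H. bracket x y \<in> H) \<and>
     (\<exists>n. lower_central scale bracket H n = {0}) \<and>
     {x. \<forall>y\<in>H. bracket x y \<in> H} = H"

text \<open>
  A linear functional on the subspace \<open>H\<close> is encoded as a function on the whole type that is
  linear on \<open>H\<close> and vanishes outside \<open>H\<close>. Equality, sums and differences of functionals are then
  those of functions.
\<close>

definition dual :: "(complex \<Rightarrow> 'g::ab_group_add \<Rightarrow> 'g) \<Rightarrow> 'g set \<Rightarrow> ('g \<Rightarrow> complex) set" where
  "dual scale H = {f. (\<forall>x\<in>H. \<forall>y\<in>H. f (x + y) = f x + f y) \<and>
     (\<forall>c. \<forall>x\<in>H. f (scale c x) = c * f x) \<and> (\<forall>x. x \<notin> H \<longrightarrow> f x = 0)}"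

definition fun_scale :: "complex \<Rightarrow> ('a \<Rightarrow> complex) \<Rightarrow> 'a \<Rightarrow> complex" where
  "fun_scale c f = (\<lambda>x. c * f x)"

definition weight_space ::
  "(complex \<Rightarrow> 'v \<Rightarrow> 'v) \<Rightarrow> ('g \<Rightarrow> 'v \<Rightarrow> 'v) \<Rightarrow> 'g set \<Rightarrow> ('g \<Rightarrow> complex) \<Rightarrow> 'v set" where
  "weight_space vscale act H \<mu> = {v. \<forall>h\<in>H. act h v = vscale (\<mu> h) v}"

definition weights ::
  "(complex \<Rightarrow> 'g::ab_group_add \<Rightarrow> 'g) \<Rightarrow> (complex \<Rightarrow> 'v::zero \<Rightarrow> 'v) \<Rightarrow>
   ('g \<Rightarrow> 'v \<Rightarrow> 'v) \<Rightarrow> 'g set \<Rightarrow> ('g \<Rightarrow> complex) set" where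
  "weights scale vscale act H = {\<mu> \<in> dual scale H. weight_space vscale act H \<mu> \<noteq> {0}}"

text \<open>Roots and root spaces are the nonzero weights and the weight spaces of the adjoint module.\<close>

definition roots ::
  "(complex \<Rightarrow> 'g::ab_group_add \<Rightarrow> 'g) \<Rightarrow> ('g \<Rightarrow> 'g \<Rightarrow> 'g) \<Rightarrow> 'g set \<Rightarrow> ('g \<Rightarrow> complex) set" where
  "roots scale bracket H = weights scale scale bracket H - {0}"

abbreviation root_space ::
  "(complex \<Rightarrow> 'g::ab_group_add \<Rightarrow> 'g) \<Rightarrow> ('g \<Rightarrow> 'g \<Rightarrow> 'g) \<Rightarrow> 'g set \<Rightarrow>
   ('g \<Rightarrow> complex) \<Rightarrow> 'g set" where
  "root_space \<equiv> weight_space"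

definition nonneg_combinations :: "'i set \<Rightarrow> ('i \<Rightarrow> 'g \<Rightarrow> complex) \<Rightarrow> ('g \<Rightarrow> complex) set" where
  "nonneg_combinations I \<alpha> = {\<lambda>x. \<Sum>i\<in>I. of_nat (c i) * \<alpha> i x | c :: 'i \<Rightarrow> nat. True}"

definition simple_roots ::
  "(complex \<Rightarrow> 'g::ab_group_add \<Rightarrow> 'g) \<Rightarrow> ('g \<Rightarrow> 'g \<Rightarrow> 'g) \<Rightarrow> 'g set \<Rightarrow>
   'i set \<Rightarrow> ('i \<Rightarrow> 'g \<Rightarrow> complex) \<Rightarrow> bool" where
  "simple_roots scale bracket H I \<alpha> \<longleftrightarrow>
     finite I \<and> inj_on \<alpha> I \<and> \<alpha> ` I \<subseteq> roots scale bracket H \<and>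
     \<not> module.dependent fun_scale (\<alpha> ` I) \<and>
     module.span fun_scale (\<alpha> ` I) = dual scale H \<and>
     (\<forall>\<beta>\<in>roots scale bracket H.
        \<beta> \<in> nonneg_combinations I \<alpha> \<or> - \<beta> \<in> nonneg_combinations I \<alpha>)"

definition positive_roots ::
  "(complex \<Rightarrow> 'g::ab_group_add \<Rightarrow> 'g) \<Rightarrow> ('g \<Rightarrow> 'g \<Rightarrow> 'g) \<Rightarrow> 'g set \<Rightarrow>
   'i set \<Rightarrow> ('i \<Rightarrow> 'g \<Rightarrow> complex) \<Rightarrow> ('g \<Rightarrow> complex) set" where
  "positive_roots scale bracket H I \<alpha> = roots scale bracket H \<inter> nonneg_combinations I \<alpha>"

text \<open>The coroot of \<open>\<beta>\<close> is the element \<open>h\<close> of \<open>[g\<^sub>\<beta>, g\<^sub>-\<^sub>\<beta>]\<close> with \<open>\<beta>(h) = 2\<close>.\<close>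

definition is_coroot ::
  "(complex \<Rightarrow> 'g::ab_group_add \<Rightarrow> 'g) \<Rightarrow> ('g \<Rightarrow> 'g \<Rightarrow> 'g) \<Rightarrow> 'g set \<Rightarrow>
   ('g \<Rightarrow> complex) \<Rightarrow> 'g \<Rightarrow> bool" where
  "is_coroot scale bracket H \<beta> h \<longleftrightarrow>
     h \<in> module.span scale {bracket x y | x y.
       x \<in> root_space scale bracket H \<beta> \<and> y \<in> root_space scale bracket H (- \<beta>)} \<and>
     \<beta> h = 2"

definition weight_lattice ::
  "(complex \<Rightarrow> 'g::ab_group_add \<Rightarrow> 'g) \<Rightarrow> 'g set \<Rightarrow> 'i set \<Rightarrow> ('i \<Rightarrow> 'g) \<Rightarrow> ('g \<Rightarrow> complex) set" where
  "weight_lattice scale H I h = {\<mu> \<in> dual scale H. \<forall>i\<in>I. \<mu> (h i) \<in> \<int>}"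

text \<open>
  In the last bracket relation \<open>p\<close> is the largest integer with \<open>\<gamma> - p\<beta>\<close> a root. The brackets of
  the \<open>h i\<close> with each other and with the \<open>x \<beta>\<close> are determined by \<open>x \<beta> \<in> g\<^sub>\<beta>\<close>.
\<close>

definition chevalley_basis ::
  "(complex \<Rightarrow> 'g::ab_group_add \<Rightarrow> 'g) \<Rightarrow> ('g \<Rightarrow> 'g \<Rightarrow> 'g) \<Rightarrow> 'g set \<Rightarrow> 'i set \<Rightarrow>
   ('i \<Rightarrow> 'g \<Rightarrow> complex) \<Rightarrow> (('g \<Rightarrow> complex) \<Rightarrow> 'g) \<Rightarrow> (('g \<Rightarrow> complex) \<Rightarrow> 'g) \<Rightarrow> bool" where
  "chevalley_basis scale bracket H I \<alpha> coroot x \<longleftrightarrow>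
     (let \<Delta> = roots scale bracket H; h = (\<lambda>i. coroot (\<alpha> i)) in
      inj_on x \<Delta> \<and> inj_on h I \<and> x ` \<Delta> \<inter> h ` I = {} \<and>
      \<not> module.dependent scale (x ` \<Delta> \<union> h ` I) \<and>
      module.span scale (x ` \<Delta> \<union> h ` I) = UNIV \<and>
      (\<forall>\<beta>\<in>\<Delta>. x \<beta> \<in> root_space scale bracket H \<beta>) \<and>
      (\<forall>\<beta>\<in>\<Delta>. bracket (x \<beta>) (x (- \<beta>)) = coroot \<beta>) \<and>
      (\<forall>\<beta>\<in>\<Delta>. \<forall>\<gamma>\<in>\<Delta>. \<beta> + \<gamma> \<in> \<Delta> \<longrightarrow>
         (let p = (GREATEST p::nat. \<gamma> - fun_scale (of_nat p) \<beta> \<in> \<Delta>)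
          in bracket (x \<beta>) (x \<gamma>) = scale (of_nat (p + 1)) (x (\<beta> + \<gamma>)) \<or>
             bracket (x \<beta>) (x \<gamma>) = scale (- of_nat (p + 1)) (x (\<beta> + \<gamma>)))))"

definition highest_weight_vector ::
  "(complex \<Rightarrow> 'g::ab_group_add \<Rightarrow> 'g) \<Rightarrow> ('g \<Rightarrow> 'g \<Rightarrow> 'g) \<Rightarrow> 'g set \<Rightarrow> 'i set \<Rightarrow>
   ('i \<Rightarrow> 'g \<Rightarrow> complex) \<Rightarrow> (complex \<Rightarrow> 'v::ab_group_add \<Rightarrow> 'v) \<Rightarrow> ('g \<Rightarrow> 'v \<Rightarrow> 'v) \<Rightarrow>
   ('g \<Rightarrow> complex) \<Rightarrow> 'v \<Rightarrow> bool" where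
  "highest_weight_vector scale bracket H I \<alpha> vscale act \<Lambda> v \<longleftrightarrow>
     \<Lambda> \<in> dual scale H \<and> v \<noteq> 0 \<and> v \<in> weight_space vscale act H \<Lambda> \<and>
     (\<forall>\<beta>\<in>positive_roots scale bracket H I \<alpha>. \<forall>y\<in>root_space scale bracket H \<beta>. act y v = 0)"


section \<open>The universal enveloping algebra and its Cartier--Kostant form\<close>

datatype 'g word = Word (letters: "'g list")

instantiation word :: (type) monoid_add
begin
definition "0 = Word []"
definition "u + w = Word (letters u @ letters w)"
instance by standard (auto simp: zero_word_def plus_word_def)
end

text \<open>The free associative unital complex algebra on the set \<open>'g\<close>.\<close>

type_synonym 'g free_algebra = "'g word \<Rightarrow>\<^sub>0 complex"

definition gen :: "'g \<Rightarrow> 'g free_algebra" where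
  "gen x = Poly_Mapping.single (Word [x]) 1"

definition scalar :: "complex \<Rightarrow> 'g free_algebra" where
  "scalar c = Poly_Mapping.single 0 c"

abbreviation free_ring :: "'g free_algebra ring" where
  "free_ring \<equiv> ring_of_type_algebra"

text \<open>
  Linearity of \<open>gen\<close> is imposed together with the bracket relation, so that the quotient is
  that of the tensor algebra by the bracket relation.
\<close>

definition envelope_ideal ::
  "(complex \<Rightarrow> 'g::ab_group_add \<Rightarrow> 'g) \<Rightarrow> ('g \<Rightarrow> 'g \<Rightarrow> 'g) \<Rightarrow> 'g free_algebra set" where
  "envelope_ideal scale bracket = Idl\<^bsub>free_ring\<^esub>
     ({gen (x + y) - gen x - gen y | x y. True} \<union>
      {gen (scale c x) - scalar c * gen x | c x. True} \<union>
      {gen x * gen y - gen y * gen x - gen (bracket x y) | x y. True})"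

definition envelope ::
  "(complex \<Rightarrow> 'g::ab_group_add \<Rightarrow> 'g) \<Rightarrow> ('g \<Rightarrow> 'g \<Rightarrow> 'g) \<Rightarrow> 'g free_algebra set ring" where
  "envelope scale bracket = free_ring Quot envelope_ideal scale bracket"

definition envelope_class ::
  "(complex \<Rightarrow> 'g::ab_group_add \<Rightarrow> 'g) \<Rightarrow> ('g \<Rightarrow> 'g \<Rightarrow> 'g) \<Rightarrow>
   'g free_algebra \<Rightarrow> 'g free_algebra set" where
  "envelope_class scale bracket f = envelope_ideal scale bracket +>\<^bsub>free_ring\<^esub> f"

definition divided_power :: "'g \<Rightarrow> nat \<Rightarrow> 'g free_algebra" where
  "divided_power x m = scalar (1 / fact m) * gen x ^ m"

text \<open>The binomial coefficient \<open>h (h - 1) \<dots> (h - m + 1) / m!\<close>.\<close>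

definition binomial_elt :: "'g \<Rightarrow> nat \<Rightarrow> 'g free_algebra" where
  "binomial_elt h m = scalar (1 / fact m) * prod_list (map (\<lambda>k. gen h - of_nat k) [0..<m])"

definition kostant_form ::
  "(complex \<Rightarrow> 'g::ab_group_add \<Rightarrow> 'g) \<Rightarrow> ('g \<Rightarrow> 'g \<Rightarrow> 'g) \<Rightarrow> 'g set \<Rightarrow> 'i set \<Rightarrow>
   ('i \<Rightarrow> 'g) \<Rightarrow> (('g \<Rightarrow> complex) \<Rightarrow> 'g) \<Rightarrow> 'g free_algebra set set" where
  "kostant_form scale bracket H I h x =
     generate_ring (envelope scale bracket) (envelope_class scale bracket `
       ({divided_power (x \<beta>) m | \<beta> m. \<beta> \<in> roots scale bracket H} \<union>
        {binomial_elt (h i) m | i m. i \<in> I}))"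

definition free_act ::
  "(complex \<Rightarrow> 'v::ab_group_add \<Rightarrow> 'v) \<Rightarrow> ('g \<Rightarrow> 'v \<Rightarrow> 'v) \<Rightarrow> 'g free_algebra \<Rightarrow> 'v \<Rightarrow> 'v" where
  "free_act vscale act f v =
     (\<Sum>w\<in>Poly_Mapping.keys f. vscale (Poly_Mapping.lookup f w) (foldr act (letters w) v))"

text \<open>All representatives of a class act in the same way when \<open>act\<close> is a module structure.\<close>

definition envelope_act ::
  "(complex \<Rightarrow> 'v::ab_group_add \<Rightarrow> 'v) \<Rightarrow> ('g \<Rightarrow> 'v \<Rightarrow> 'v) \<Rightarrow> 'g free_algebra set \<Rightarrow> 'v \<Rightarrow> 'v" where
  "envelope_act vscale act C v = (THE w. \<forall>f\<in>C. free_act vscale act f v = w)"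

definition lattice_Z ::
  "(complex \<Rightarrow> 'g::ab_group_add \<Rightarrow> 'g) \<Rightarrow> ('g \<Rightarrow> 'g \<Rightarrow> 'g) \<Rightarrow> 'g set \<Rightarrow> 'i set \<Rightarrow>
   ('i \<Rightarrow> 'g) \<Rightarrow> (('g \<Rightarrow> complex) \<Rightarrow> 'g) \<Rightarrow>
   (complex \<Rightarrow> 'v::ab_group_add \<Rightarrow> 'v) \<Rightarrow> ('g \<Rightarrow> 'v \<Rightarrow> 'v) \<Rightarrow> 'v \<Rightarrow> 'v set" where
  "lattice_Z scale bracket H I h x vscale act v =
     {envelope_act vscale act u v | u. u \<in> kostant_form scale bracket H I h x}"


section \<open>The Chevalley group and its subgroups\<close>

text \<open>\<open>exp (u f)\<close> for a nilpotent \<open>f\<close>: only finitely many terms are nonzero.\<close>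

definition exp_nilpotent ::
  "(complex \<Rightarrow> 'v::ab_group_add \<Rightarrow> 'v) \<Rightarrow> ('v \<Rightarrow> 'v) \<Rightarrow> complex \<Rightarrow> 'v \<Rightarrow> 'v" where
  "exp_nilpotent vscale f u = (\<lambda>v. Sum_any (\<lambda>n. vscale (u ^ n / fact n) ((f ^^ n) v)))"

definition root_elt ::
  "(complex \<Rightarrow> 'v::ab_group_add \<Rightarrow> 'v) \<Rightarrow> ('g \<Rightarrow> 'v \<Rightarrow> 'v) \<Rightarrow>
   (('g \<Rightarrow> complex) \<Rightarrow> 'g) \<Rightarrow> ('g \<Rightarrow> complex) \<Rightarrow> rat \<Rightarrow> 'v \<Rightarrow> 'v" where
  "root_elt vscale act x \<beta> u = exp_nilpotent vscale (act (x \<beta>)) (of_rat u)"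

text \<open>
  \<open>h(t)\<close> for a coroot \<open>h\<close>: the linear map acting on the weight space of \<open>\<mu>\<close> as
  \<open>t\<close> to the power \<open>\<mu>(h)\<close>, an integer on a finite-dimensional module.
\<close>

definition torus_elt ::
  "(complex \<Rightarrow> 'g::ab_group_add \<Rightarrow> 'g) \<Rightarrow> 'g set \<Rightarrow>
   (complex \<Rightarrow> 'v::ab_group_add \<Rightarrow> 'v) \<Rightarrow> ('g \<Rightarrow> 'v \<Rightarrow> 'v) \<Rightarrow> 'g \<Rightarrow> rat \<Rightarrow> 'v \<Rightarrow> 'v" where
  "torus_elt scale H vscale act h t =
     (THE f. Vector_Spaces.linear vscale vscale f \<and>
        (\<forall>\<mu>\<in>weights scale vscale act H. \<forall>m::int. \<mu> h = of_int m \<longrightarrow>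
           (\<forall>v\<in>weight_space vscale act H \<mu>. f v = vscale (of_rat t powi m) v)))"

definition chevalley_Q ::
  "(complex \<Rightarrow> 'g::ab_group_add \<Rightarrow> 'g) \<Rightarrow> ('g \<Rightarrow> 'g \<Rightarrow> 'g) \<Rightarrow> 'g set \<Rightarrow> 'i set \<Rightarrow>
   ('i \<Rightarrow> 'g) \<Rightarrow> (('g \<Rightarrow> complex) \<Rightarrow> 'g) \<Rightarrow>
   (complex \<Rightarrow> 'v::ab_group_add \<Rightarrow> 'v) \<Rightarrow> ('g \<Rightarrow> 'v \<Rightarrow> 'v) \<Rightarrow> ('v \<Rightarrow> 'v) set" where
  "chevalley_Q scale bracket H I h x vscale act = generate (BijGroup UNIV)
     ({root_elt vscale act x \<beta> u | \<beta> u. \<beta> \<in> roots scale bracket H} \<union>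
      {torus_elt scale H vscale act (h i) t | i t. i \<in> I \<and> t \<noteq> 0})"

definition chevalley_Z ::
  "(complex \<Rightarrow> 'g::ab_group_add \<Rightarrow> 'g) \<Rightarrow> ('g \<Rightarrow> 'g \<Rightarrow> 'g) \<Rightarrow> 'g set \<Rightarrow> 'i set \<Rightarrow>
   ('i \<Rightarrow> 'g) \<Rightarrow> (('g \<Rightarrow> complex) \<Rightarrow> 'g) \<Rightarrow>
   (complex \<Rightarrow> 'v::ab_group_add \<Rightarrow> 'v) \<Rightarrow> ('g \<Rightarrow> 'v \<Rightarrow> 'v) \<Rightarrow> ('v \<Rightarrow> 'v) set" where
  "chevalley_Z scale bracket H I h x vscale act = generate (BijGroup UNIV)
     ({root_elt vscale act x \<beta> u | \<beta> u. \<beta> \<in> roots scale bracket H \<and> u \<in> \<int>} \<union>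
      {torus_elt scale H vscale act (h i) (- 1) | i. i \<in> I})"

definition unipotent_Q ::
  "(complex \<Rightarrow> 'g::ab_group_add \<Rightarrow> 'g) \<Rightarrow> ('g \<Rightarrow> 'g \<Rightarrow> 'g) \<Rightarrow> 'g set \<Rightarrow> 'i set \<Rightarrow>
   ('i \<Rightarrow> 'g \<Rightarrow> complex) \<Rightarrow> (('g \<Rightarrow> complex) \<Rightarrow> 'g) \<Rightarrow>
   (complex \<Rightarrow> 'v::ab_group_add \<Rightarrow> 'v) \<Rightarrow> ('g \<Rightarrow> 'v \<Rightarrow> 'v) \<Rightarrow> ('v \<Rightarrow> 'v) set" where
  "unipotent_Q scale bracket H I \<alpha> x vscale act = generate (BijGroup UNIV)
     {root_elt vscale act x \<beta> u | \<beta> u. \<beta> \<in> positive_roots scale bracket H I \<alpha>}"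

end

theory Submission
  imports Defs
begin

text \<open>
  \<^bold>\<open>The lattice.\<close> Write \<open>M\<close> for the \<open>\<int>\<close>-span of the monomials in the divided powers of the simple negative root
  vectors, applied to \<open>v\<close>. Kostant's \<open>sl\<^sub>2\<close> commutation formula shows that \<open>M\<close> is stable under the divided
  powers of the simple positive root vectors as well, hence under the simple reflections
  \<open>exp(e\<^sub>i) exp(-f\<^sub>i) exp(e\<^sub>i)\<close>. These permute the \<open>x\<^sub>\<beta>\<close> up to sign, by the Chevalley relations along root strings,
  so \<open>M\<close> is stable under all divided powers, and \<open>V\<^sub>\<int> = M\<close>. In particular \<open>V\<^sub>\<int>\<close> is the sum of its weight components and
  its highest one is \<open>\<int> v\<close>; the latter implies that \<open>c x\<^sub>\<beta> V\<^sub>\<int> \<subseteq> V\<^sub>\<int>\<close> only for integers \<open>c\<close>.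

  \<^bold>\<open>The unipotent group.\<close> Let \<open>h\<^sub>0\<close> be the element of the Cartan subalgebra on which all simple roots are \<open>1\<close>. An
  element \<open>g\<close> of \<open>U(\<rat>)\<close> satisfies \<open>g h\<^sub>0 g\<^sup>-\<^sup>1 = h\<^sub>0 + y\<close> with \<open>y\<close> in the span of the positive root vectors. Let
  \<open>c x\<^sub>\<beta>\<close> be a term of \<open>y\<close> of least height. On a vector \<open>w\<close> of weight \<open>\<mu>\<close>, the component of \<open>g w\<close> of weight
  \<open>\<mu> + \<beta>\<close> is \<open>- (c / ht \<beta>) x\<^sub>\<beta> w\<close>. If \<open>g\<close> stabilizes \<open>V\<^sub>\<int>\<close> then \<open>n = c / ht \<beta>\<close> is therefore an integer, and
  \<open>\<chi>\<^sub>\<beta>(n) g\<close> still stabilizes \<open>V\<^sub>\<int>\<close> and has fewer terms. When no term is left, \<open>g\<close> commutes with \<open>h\<^sub>0\<close>, and being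
  unipotent it is the identity.
\<close>

section \<open>Divided powers and exponentials of linear operators\<close>

text \<open>For \<open>V_Z = M\<close> it is enough that each generator of the Kostant form
  preserves \<open>M\<close>: the binomials in the \<open>h i\<close> do so because they are
  integers on each weight component of \<open>M\<close>. On the group side the conjugate
  \<open>h_0 + y\<close> serves as coordinates of an element of \<open>U(Q)\<close>.

  The signs under a simple reflection come from integrality alone. Along a root string the structure
  constants +-(p + 1), divided by factorials, become binomial coefficients, so a reflection sends a
  root vector to an integer multiple of another one. Its inverse does the same, and two integers
  with product 1 are both 1 or both -1. The vectors of the roots \<open>\<alpha> i\<close> and
  \<open>- \<alpha> i\<close> are kept apart, because their string passes through the Cartan
  subalgebra; their divided powers preserve \<open>M\<close> by the commutation formula and by
  construction.

  That c is an integer cannot be read off a single matrix entry of \<open>x \<beta>\<close>, which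
  need not be a unit. What decides is the spectrum of c^2 times the coroot: this operator preserves
  the lattice, so the powers of an eigenvalue have bounded denominators.\<close>

definition dpow :: "(complex \<Rightarrow> 'v::ab_group_add \<Rightarrow> 'v) \<Rightarrow> ('v \<Rightarrow> 'v) \<Rightarrow> nat \<Rightarrow> 'v \<Rightarrow> 'v" where
  "dpow scale f n w = scale (1 / fact n) ((f ^^ n) w)"

text \<open>Cauchy product for truncated exponentials: i, j < N implies i + j < 2N, so the triangle
  contains the square outside which every term vanishes.\<close>

lemma sum_triangle_eq_square:
  fixes a :: "nat \<Rightarrow> nat \<Rightarrow> 'a::comm_monoid_add"
  assumes "\<And>i j. i \<ge> N \<or> j \<ge> N \<Longrightarrow> a i j = 0"
  shows "(\<Sum>n<2*N. \<Sum>k\<le>n. a k (n - k)) = (\<Sum>i<N. \<Sum>j<N. a i j)"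
proof -
  have "(\<Sum>n<2*N. \<Sum>k\<le>n. a k (n - k)) = (\<Sum>(i,j)\<in>{(i,j). i + j < 2*N}. a i j)"
    by (rule sum.triangle_reindex [symmetric])
  also have "\<dots> = (\<Sum>(i,j)\<in>{..<N} \<times> {..<N}. a i j)"
  proof (rule sum.mono_neutral_right)
    show "finite {(i,j). i + j < 2*N}"
      by (rule finite_subset[of _ "{..<2*N} \<times> {..<2*N}"]) auto
    show "\<forall>p\<in>{(i, j). i + j < 2 * N} - {..<N} \<times> {..<N}. (case p of (i, j) \<Rightarrow> a i j) = 0"
    proof
      fix p assume p: "p \<in> {(i, j). i + j < 2 * N} - {..<N} \<times> {..<N}"
      obtain i j where "p = (i, j)" by force
      with p show "(case p of (i, j) \<Rightarrow> a i j) = 0"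
        by (auto intro: assms)
    qed
  qed auto
  also have "\<dots> = (\<Sum>i<N. \<Sum>j<N. a i j)"
    by (simp add: sum.cartesian_product)
  finally show ?thesis .
qed

locale complex_vector_space = vector_space scale
  for scale :: "complex \<Rightarrow> 'v::ab_group_add \<Rightarrow> 'v"
begin

abbreviation lin :: "('v \<Rightarrow> 'v) \<Rightarrow> bool" where
  "lin \<equiv> Vector_Spaces.linear scale scale"

lemma linI:
  assumes "\<And>a b. f (a + b) = f a + f b" "\<And>c a. f (scale c a) = scale c (f a)"
  shows "lin f"
  using assms by (simp add: Vector_Spaces.linear_iff vector_space_axioms)

lemma lin_add: "lin f \<Longrightarrow> f (a + b) = f a + f b"
  and lin_scale: "lin f \<Longrightarrow> f (scale c a) = scale c (f a)"
  and lin_zero: "lin f \<Longrightarrow> f 0 = 0"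
  and lin_minus: "lin f \<Longrightarrow> f (- a) = - f a"
  and lin_diff: "lin f \<Longrightarrow> f (a - b) = f a - f b"
  and lin_sum: "lin f \<Longrightarrow> f (sum t A) = (\<Sum>i\<in>A. f (t i))"
  by (simp_all add: module_hom.add module_hom.scale module_hom.zero module_hom.neg module_hom.diff
      module_hom.sum module_hom_iff_linear[symmetric])

lemmas lin_simps = lin_add lin_scale lin_zero lin_minus lin_diff lin_sum

lemma lin_eq_on_span:
  assumes "lin f" "lin g" "\<And>b. b \<in> B \<Longrightarrow> f b = g b" "w \<in> span B"
  shows "f w = g w"
  using assms(4)
  by (induction rule: span_induct_alt) (simp_all add: assms lin_simps)

lemma lin_funpow: "lin f \<Longrightarrow> lin (f ^^ n)"
proof (induction n)
  case (Suc n)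
  then show ?case by (intro linI) (simp_all add: lin_simps)
qed (auto intro: linI)

lemma lin_dpow: "lin f \<Longrightarrow> lin (dpow scale f n)"
  using lin_funpow[of f n] by (intro linI) (simp_all add: dpow_def lin_simps scale_right_distrib mult.commute)

lemma dpow_0 [simp]: "dpow scale f 0 w = w"
  by (simp add: dpow_def)

lemma dpow_1 [simp]: "dpow scale f (Suc 0) w = f w"
  by (simp add: dpow_def)

lemma apply_dpow: "lin f \<Longrightarrow> f (dpow scale f n w) = scale (of_nat (Suc n)) (dpow scale f (Suc n) w)"
  by (simp add: dpow_def lin_simps del: of_nat_Suc)

lemma dpow_Suc: "lin f \<Longrightarrow> dpow scale f (Suc n) w = scale (1 / of_nat (Suc n)) (f (dpow scale f n w))"
  by (simp add: apply_dpow del: of_nat_Suc)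

lemma dpow_dpow:
  assumes "lin f"
  shows "dpow scale f m (dpow scale f n w) = scale (of_nat ((m + n) choose m)) (dpow scale f (m + n) w)"
  by (simp add: dpow_def lin_simps lin_funpow[OF assms] funpow_add binomial_fact field_simps)

lemma dpow_vanishes:
  assumes "lin f" "\<And>w. (f ^^ N) w = 0" "n \<ge> N"
  shows "dpow scale f n w = 0"
proof -
  have "(f ^^ n) w = (f ^^ (n - N)) ((f ^^ N) w)"
    using assms(3) funpow_add[of "n - N" N f] by (metis comp_apply le_add_diff_inverse2)
  then show ?thesis
    by (simp add: dpow_def assms lin_zero[OF lin_funpow[OF assms(1)]])
qed

text \<open>With c = 1 this moves divided powers past a commuting operator; with c = 1 or -1 it
  transports them through a reflection that permutes root vectors up to sign.\<close>

lemma dpow_conj: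
  assumes "lin g" "\<And>w. g (p w) = scale c (q (g w))" "lin q"
  shows "g (dpow scale p n w) = scale (c ^ n) (dpow scale q n (g w))"
proof -
  have "g ((p ^^ n) w) = scale (c ^ n) ((q ^^ n) (g w))"
    by (induction n) (simp_all add: assms lin_simps mult.commute)
  then show ?thesis
    by (simp add: dpow_def assms lin_simps mult.commute)
qed

text \<open>Nilpotency is asked at the single vector w only: the explicit adjoint exponentials below
  stop after one, two or three terms, depending on the vector.\<close>

lemma exp_nilpotent_finite:
  assumes "lin f" "(f ^^ K) w = 0"
  shows "exp_nilpotent scale f u w = (\<Sum>n<K. scale (u ^ n) (dpow scale f n w))"
proof -
  have 0: "(f ^^ n) w = 0" if "n \<ge> K" for n
    using funpow_add[of "n - K" K f] that assms(2) lin_zero[OF lin_funpow[OF assms(1)], of "n - K"]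
    by simp
  have "Sum_any (\<lambda>n. scale (u ^ n) (dpow scale f n w)) = (\<Sum>n<K. scale (u ^ n) (dpow scale f n w))"
  proof (rule Sum_any.expand_superset)
    show "{n. scale (u ^ n) (dpow scale f n w) \<noteq> 0} \<subseteq> {..<K}"
    proof
      fix n assume n: "n \<in> {n. scale (u ^ n) (dpow scale f n w) \<noteq> 0}"
      show "n \<in> {..<K}"
      proof (rule ccontr)
        assume "n \<notin> {..<K}"
        then have "(f ^^ n) w = 0" by (intro 0) simp
        then have "dpow scale f n w = 0" by (simp add: dpow_def)
        then show False using n by simp
      qed
    qed
  qed simp
  then show ?thesis
    by (simp add: exp_nilpotent_def dpow_def)
qed

lemma exp_nilpotent_eq_sum:
  assumes "lin f" "\<And>w. (f ^^ N) w = 0"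
  shows "exp_nilpotent scale f u w = (\<Sum>n<N. scale (u ^ n) (dpow scale f n w))"
  by (rule exp_nilpotent_finite[OF assms])

lemma lin_exp:
  assumes "lin f" "\<And>w. (f ^^ N) w = 0"
  shows "lin (exp_nilpotent scale f u)"
  by (rule linI)
    (simp_all add: exp_nilpotent_eq_sum[OF assms] lin_simps[OF lin_dpow[OF assms(1)]]
      scale_right_distrib sum.distrib scale_sum_right mult.commute)

lemma exp_nilpotent_0:
  assumes "lin f" "\<And>w. (f ^^ N) w = 0"
  shows "exp_nilpotent scale f 0 w = w"
proof -
  have "exp_nilpotent scale f 0 w = (\<Sum>n<Suc N. scale (0 ^ n) (dpow scale f n w))"
    using assms by (intro exp_nilpotent_eq_sum) (auto simp: lin_simps)
  also have "\<dots> = w" by (simp add: sum.lessThan_Suc_shift del: sum.lessThan_Suc)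
  finally show ?thesis .
qed

lemma exp_nilpotent_add:
  assumes "lin f" "\<And>w. (f ^^ N) w = 0"
  shows "exp_nilpotent scale f u (exp_nilpotent scale f t w) = exp_nilpotent scale f (u + t) w"
proof -
  let ?a = "\<lambda>i j. scale (u ^ i * t ^ j) (dpow scale f i (dpow scale f j w))"
  have nil: "(f ^^ (2*N)) w = 0" for w
    unfolding mult_2 funpow_add by (simp add: assms(2))
  have "exp_nilpotent scale f (u + t) w = (\<Sum>n<2*N. scale ((u + t) ^ n) (dpow scale f n w))"
    by (rule exp_nilpotent_eq_sum[OF assms(1) nil])
  also have "\<dots> = (\<Sum>n<2*N. \<Sum>k\<le>n. ?a k (n - k))"
  proof (rule sum.cong[OF refl])
    fix n
    show "scale ((u + t) ^ n) (dpow scale f n w) = (\<Sum>k\<le>n. ?a k (n - k))"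
      unfolding binomial_ring scale_sum_left
      by (rule sum.cong) (simp_all add: dpow_dpow[OF assms(1)] mult_ac)
  qed
  also have "\<dots> = (\<Sum>i<N. \<Sum>j<N. ?a i j)"
    by (rule sum_triangle_eq_square[where a = ?a])
      (elim disjE, simp_all add: dpow_vanishes[OF assms] lin_zero[OF lin_dpow[OF assms(1)]])
  also have "\<dots> = exp_nilpotent scale f u (exp_nilpotent scale f t w)"
    by (simp add: exp_nilpotent_eq_sum[OF assms] lin_simps[OF lin_dpow[OF assms(1)]] scale_sum_right)
  finally show ?thesis by simp
qed

text \<open>Moving e past n + 1 factors f leaves h in each gap. Its eigenvalues m, m - 2, ..., m -
  2n add up to (n + 1)(m - n), and the factor n + 1 is absorbed by the factorial.\<close>

lemma sl2_apply_dpow: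
  assumes lin: "lin e" "lin f" and ef: "\<And>w. e (f w) = f (e w) + h w"
    and hf: "\<And>w. h (f w) = f (h w) - scale 2 (f w)"
    and w: "h w = scale m w"
  shows "e (dpow scale f (Suc n) w) = dpow scale f (Suc n) (e w) + scale (m - of_nat n) (dpow scale f n w)"
    (is "?P n")
    and "h (dpow scale f n w) = scale (m - 2 * of_nat n) (dpow scale f n w)"
proof -
  have hn: "h ((f ^^ n) w) = scale (m - 2 * of_nat n) ((f ^^ n) w)" for n
  proof (induction n)
    case (Suc n)
    then show ?case using lin
      by (simp add: hf lin_simps scale_left_diff_distrib[symmetric])
  qed (simp add: w)
  \<comment> \<open>Homogeneity of \<open>h\<close> is inherited from \<open>e\<close> and
    \<open>f\<close>, since \<open>ef\<close> makes \<open>h\<close> their commutator.\<close>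
  have hl: "h (scale c a) = scale c (h a)" for c a
    using ef[of "scale c a"] ef[of a] lin by (simp add: lin_simps scale_right_distrib)
  show hd: "h (dpow scale f n w) = scale (m - 2 * of_nat n) (dpow scale f n w)" for n
    by (simp add: dpow_def hl hn mult.commute)
  show "?P n"
  proof (induction n)
    case 0
    then show ?case by (simp add: ef w)
  next
    case (Suc n)
    have "e (dpow scale f (Suc (Suc n)) w) =
        scale (1 / of_nat (Suc (Suc n))) (f (e (dpow scale f (Suc n) w)) + h (dpow scale f (Suc n) w))"
      using lin by (simp add: dpow_Suc[of f "Suc n"] lin_simps ef)
    also have "\<dots> = scale (1 / of_nat (Suc (Suc n))) (scale (of_nat (Suc (Suc n))) (dpow scale f (Suc (Suc n)) (e w))
        + scale ((m - of_nat n) * of_nat (Suc n) + (m - 2 * of_nat (Suc n))) (dpow scale f (Suc n) w))"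
      using lin unfolding Suc.IH hd
      by (simp add: lin_simps apply_dpow scale_left_distrib del: of_nat_Suc)
    also have "(m - of_nat n) * of_nat (Suc n) + (m - 2 * of_nat (Suc n)) = (m - of_nat (Suc n)) * of_nat (Suc (Suc n))"
      by (simp add: algebra_simps)
    finally show ?case
      by (simp add: scale_right_distrib del: of_nat_Suc)
  qed
qed

text \<open>Kostant's commutation formula for \<open>e\<^sup>a/a!\<close> and \<open>f\<^sup>b/b!\<close>, its binomial coefficients in \<open>h\<close> being
  evaluated on an eigenvector.\<close>

lemma sl2_dpow_dpow:
  assumes lin: "lin e" "lin f" and ef: "\<And>w. e (f w) = f (e w) + h w"
    and hf: "\<And>w. h (f w) = f (h w) - scale 2 (f w)"
    and he: "\<And>w. h (e w) = e (h w) + scale 2 (e w)"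
    and w: "h w = scale m w"
  shows "dpow scale e a (dpow scale f b w) =
    (\<Sum>k\<le>a. scale ((m + of_nat a - of_nat b) gchoose k)
      (if k \<le> b then dpow scale f (b - k) (dpow scale e (a - k) w) else 0))"
proof -
  \<comment> \<open>Divided powers of negative order are set to 0, so that the recursion
    \<open>eG\<close> holds for every k and the sums can be reindexed freely.\<close>
  define G where "G k w = (if k \<le> b then dpow scale f (b - k) w else 0)" for k w
  have Gs: "G k (scale c w) = scale c (G k w)" for k c w
    by (simp add: G_def lin_simps[OF lin_dpow[OF lin(2)]])
  have he': "h ((e ^^ j) w) = scale (m + 2 * of_nat j) ((e ^^ j) w)" for j
  proof (induction j)
    case (Suc j)
    then show ?case using lin
      by (simp add: he lin_simps scale_left_distrib[symmetric])
  qed (simp add: w)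
  have hl: "h (scale c a) = scale c (h a)" for c a
    using ef[of "scale c a"] ef[of a] lin by (simp add: lin_simps scale_right_distrib)
  have hd: "h (dpow scale e j w) = scale (m + 2 * of_nat j) (dpow scale e j w)" for j
    by (simp add: dpow_def hl he' mult.commute)
  have eG: "e (G k (dpow scale e j w)) = scale (of_nat (Suc j)) (G k (dpow scale e (Suc j) w))
      + scale (m + 2 * of_nat j - of_nat b + of_nat k + 1) (G (Suc k) (dpow scale e j w))" for j k
  proof (cases "k < b")
    case True
    then obtain n where n: "b = Suc (n + k)"
      by (metis add.commute less_imp_Suc_add add_Suc_right)
    show ?thesis
      using sl2_apply_dpow(1)[OF lin ef hf hd[of j], of n] n lin
      by (simp add: G_def apply_dpow lin_simps[OF lin_dpow[OF lin(2)]] Suc_diff_le algebra_simps)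
  next
    case False
    then show ?thesis
      using lin by (auto simp: G_def apply_dpow lin_simps simp del: of_nat_Suc)
  qed
  have "dpow scale e a (dpow scale f b w) =
    (\<Sum>k\<le>a. scale ((m + of_nat a - of_nat b) gchoose k) (G k (dpow scale e (a - k) w)))"
  proof (induction a)
    case 0
    then show ?case by (simp add: G_def)
  next
    case (Suc a)
    define n where "n = m + of_nat a - of_nat b"
    let ?T = "\<lambda>k. G k (dpow scale e (Suc a - k) w)"
    have "scale (of_nat (Suc a)) (dpow scale e (Suc a) (dpow scale f b w)) = e (dpow scale e a (dpow scale f b w))"
      using lin by (simp add: apply_dpow)
    also have "\<dots> = (\<Sum>k\<le>a. scale (n gchoose k) (e (G k (dpow scale e (a - k) w))))"
      using lin by (simp add: Suc.IH n_def lin_simps)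
    also have "\<dots> = (\<Sum>k\<le>a. scale ((n gchoose k) * (of_nat (Suc a) - of_nat k)) (?T k))
        + (\<Sum>k\<le>a. scale ((n gchoose k) * (n + of_nat a - of_nat k + 1)) (?T (Suc k)))"
      unfolding sum.distrib[symmetric]
    proof (rule sum.cong[OF refl])
      fix k assume "k \<in> {..a}"
      then have k: "k \<le> a" by simp
      have "scale (n gchoose k) (e (G k (dpow scale e (a - k) w))) =
        scale (n gchoose k) (scale (of_nat (Suc (a - k))) (G k (dpow scale e (Suc (a - k)) w))
          + scale (m + 2 * of_nat (a - k) - of_nat b + of_nat k + 1) (G (Suc k) (dpow scale e (a - k) w)))"
        by (simp add: eG)
      also have "m + 2 * of_nat (a - k) - of_nat b + of_nat k + 1 = n + of_nat a - of_nat k + 1"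
        using k by (simp add: n_def of_nat_diff)
      also have "complex_of_nat (Suc (a - k)) = of_nat (Suc a) - of_nat k"
        using k by (simp add: of_nat_diff)
      finally show "scale (n gchoose k) (e (G k (dpow scale e (a - k) w))) =
         scale ((n gchoose k) * (of_nat (Suc a) - of_nat k)) (?T k)
         + scale ((n gchoose k) * (n + of_nat a - of_nat k + 1)) (?T (Suc k))"
        using k by (simp add: scale_right_distrib Suc_diff_le)
    qed
    also have "(\<Sum>k\<le>a. scale ((n gchoose k) * (of_nat (Suc a) - of_nat k)) (?T k)) =
        (\<Sum>k\<le>Suc a. scale ((n gchoose k) * (of_nat (Suc a) - of_nat k)) (?T k))"
      by simp
    also have "(\<Sum>k\<le>a. scale ((n gchoose k) * (n + of_nat a - of_nat k + 1)) (?T (Suc k))) =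
        (\<Sum>k\<le>Suc a. scale (if k = 0 then 0 else (n gchoose (k - 1)) * (n + of_nat a - of_nat k + 2)) (?T k))"
      by (simp add: sum.atMost_Suc_shift[of _ a] algebra_simps del: sum.atMost_Suc)
    also have "(\<Sum>k\<le>Suc a. scale ((n gchoose k) * (of_nat (Suc a) - of_nat k)) (?T k)) + \<dots> =
       (\<Sum>k\<le>Suc a. scale (of_nat (Suc a) * ((n + 1) gchoose k)) (?T k))"
      unfolding sum.distrib[symmetric] scale_left_distrib[symmetric]
    proof (rule sum.cong[OF refl], goal_cases)
      case (1 k)
      \<comment> \<open>Pascal's rule on the right reduces this to k (n choose k) = (n - k + 1) (n
        choose k - 1).\<close>
      have "(n gchoose k) * (of_nat (Suc a) - of_nat k) + (if k = 0 then 0 else (n gchoose (k - 1)) * (n + of_nat a - of_nat k + 2))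
        = of_nat (Suc a) * ((n + 1) gchoose k)"
      proof (cases k)
        case (Suc j)
        have "of_nat (Suc j) * (n gchoose Suc j) = (n - of_nat j) * (n gchoose j)"
          using gbinomial_absorption[of j n] gbinomial_absorb_comp[of n j]
          by (simp add: gbinomial_mult_1 algebra_simps)
        then show ?thesis
          unfolding Suc gbinomial_Suc_Suc by (simp add: algebra_simps)
      qed simp
      then show ?case by simp
    qed
    also have "\<dots> = scale (of_nat (Suc a)) (\<Sum>k\<le>Suc a. scale ((n + 1) gchoose k) (?T k))"
      by (simp add: scale_sum_right del: of_nat_Suc sum.atMost_Suc)
    finally have "dpow scale e (Suc a) (dpow scale f b w) = (\<Sum>k\<le>Suc a. scale ((n + 1) gchoose k) (?T k))"
      by (simp del: of_nat_Suc sum.atMost_Suc)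
    then show ?case
      by (simp add: n_def algebra_simps del: sum.atMost_Suc)
  qed
  then show ?thesis unfolding G_def .
qed

end

section \<open>Divided powers and exponentials in a Lie module\<close>

context lie_module
begin

sublocale V: complex_vector_space vscale ..
sublocale g: complex_vector_space scale ..

lemma act_add_left [simp]: "act (y + z) w = act y w + act z w"
  and act_scale_left [simp]: "act (scale c y) w = vscale c (act y w)"
  and act_zero_left [simp]: "act 0 w = 0"
  and act_minus_left [simp]: "act (- y) w = - act y w"
  and act_diff_left [simp]: "act (y - z) w = act y w - act z w"
  and act_sum_left: "act (sum t A) w = (\<Sum>i\<in>A. act (t i) w)"
proof -
  have m: "module_hom scale vscale (\<lambda>x. act x w)"
    using act_linear_left[of w] by (simp add: module_hom_iff_linear)
  show "act (y + z) w = act y w + act z w" "act (scale c y) w = vscale c (act y w)"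
    "act 0 w = 0" "act (- y) w = - act y w" "act (y - z) w = act y w - act z w"
    "act (sum t A) w = (\<Sum>i\<in>A. act (t i) w)"
    using module_hom.add[OF m] module_hom.scale[OF m] module_hom.zero[OF m] module_hom.neg[OF m]
      module_hom.diff[OF m] module_hom.sum[OF m] by simp_all
qed

lemmas act_right [simp] = V.lin_simps(1-5)[OF act_linear_right]
lemmas act_sum_right = V.lin_sum[OF act_linear_right]
lemmas lin_dpow_act = V.lin_dpow[OF act_linear_right]

text \<open>The Leibniz rule for the derivation \<open>bracket y\<close>; divided powers absorb its
  binomial coefficients.\<close>

lemma dpow_act:
  "dpow vscale (act y) n (act z w) =
    (\<Sum>k\<le>n. act (dpow scale (bracket y) k z) (dpow vscale (act y) (n - k) w))"
proof (induction n)
  case (Suc n)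
  let ?A = "dpow scale (bracket y)" and ?D = "dpow vscale (act y)"
  have "vscale (of_nat (Suc n)) (?D (Suc n) (act z w)) = act y (?D n (act z w))"
    by (simp add: V.apply_dpow act_linear_right)
  also have "\<dots> = (\<Sum>k\<le>n. act (bracket y (?A k z)) (?D (n - k) w)) + (\<Sum>k\<le>n. act (?A k z) (act y (?D (n - k) w)))"
    by (simp add: Suc.IH act_sum_right act_bracket sum.distrib[symmetric])
  also have "(\<Sum>k\<le>n. act (bracket y (?A k z)) (?D (n - k) w)) =
      (\<Sum>k\<le>Suc n. vscale (of_nat k) (act (?A k z) (?D (Suc n - k) w)))"
    by (simp add: sum.atMost_Suc_shift[of _ n] g.apply_dpow bracket_linear_right del: of_nat_Suc sum.atMost_Suc)
  also have "(\<Sum>k\<le>n. act (?A k z) (act y (?D (n - k) w))) =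
      (\<Sum>k\<le>Suc n. vscale (of_nat (Suc n) - of_nat k) (act (?A k z) (?D (Suc n - k) w)))"
    by (simp, rule sum.cong) (simp_all add: V.apply_dpow act_linear_right Suc_diff_le of_nat_diff add_diff_eq)
  also have "(\<Sum>k\<le>Suc n. vscale (of_nat k) (act (?A k z) (?D (Suc n - k) w))) + \<dots> =
     vscale (of_nat (Suc n)) (\<Sum>k\<le>Suc n. act (?A k z) (?D (Suc n - k) w))"
    unfolding sum.distrib[symmetric] V.scale_left_distrib[symmetric] V.scale_sum_right by simp
  finally show ?case
    by (simp del: of_nat_Suc sum.atMost_Suc)
qed simp

text \<open>The Leibniz rule \<open>dpow_act\<close>, summed over n, is a Cauchy product. It reduces
  conjugation by group elements to computations in the adjoint module.\<close>

lemma exp_act: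
  assumes nil: "\<And>w. (act y ^^ N) w = 0" "\<And>z. (bracket y ^^ N) z = 0"
  shows "exp_nilpotent vscale (act y) u (act z w) =
    act (exp_nilpotent scale (bracket y) u z) (exp_nilpotent vscale (act y) u w)"
proof -
  let ?a = "\<lambda>i j. vscale (u ^ i * u ^ j) (act (dpow scale (bracket y) i z) (dpow vscale (act y) j w))"
  have nil2: "(act y ^^ (2*N)) w = 0" for w
    unfolding mult_2 funpow_add by (simp add: nil)
  have "exp_nilpotent vscale (act y) u (act z w) = (\<Sum>n<2*N. vscale (u ^ n) (dpow vscale (act y) n (act z w)))"
    by (rule V.exp_nilpotent_eq_sum[OF act_linear_right nil2])
  also have "\<dots> = (\<Sum>n<2*N. \<Sum>k\<le>n. ?a k (n - k))"
    unfolding dpow_act V.scale_sum_right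
    by (intro sum.cong refl) (simp flip: power_add)
  also have "\<dots> = (\<Sum>i<N. \<Sum>j<N. ?a i j)"
    by (rule sum_triangle_eq_square[where a = ?a])
      (elim disjE, simp_all add: V.dpow_vanishes[OF act_linear_right nil(1)] g.dpow_vanishes[OF bracket_linear_right nil(2)])
  also have "\<dots> = act (exp_nilpotent scale (bracket y) u z) (exp_nilpotent vscale (act y) u w)"
    by (simp add: V.exp_nilpotent_eq_sum[OF act_linear_right nil(1)] act_sum_right act_sum_left
        g.exp_nilpotent_eq_sum[OF bracket_linear_right nil(2)] V.scale_sum_right)
      (subst sum.swap, simp add: mult.commute)
  finally show ?thesis .
qed

end

section \<open>Weight modules\<close>

context lie_algebra
begin

lemma bracket_antisym: "bracket y z = - bracket z y"
proof -
  have l: "module_hom scale scale (\<lambda>y. bracket y z)" and r: "module_hom scale scale (bracket y)" for y z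
    using bracket_linear_left bracket_linear_right by (simp_all add: module_hom_iff_linear)
  have "bracket (y + z) (y + z) = bracket y z + bracket z y"
    by (simp add: module_hom.add[OF l] module_hom.add[OF r] bracket_self[of y] bracket_self[of z])
  then have "bracket y z + bracket z y = 0"
    by (metis bracket_self)
  then show ?thesis
    by (simp add: eq_neg_iff_add_eq_0)
qed

text \<open>The adjoint representation: whatever is proved for modules holds for the Lie algebra
  itself under the prefix \<open>ad\<close>.\<close>

sublocale ad: lie_module scale bracket scale bracket
proof (intro lie_module.intro lie_module_axioms.intro lie_algebra_axioms vector_space_axioms
    bracket_linear_left bracket_linear_right)
  fix y z w
  have "bracket z (bracket w y) = bracket z (- bracket y w)"
    by (subst bracket_antisym[of w y]) (rule refl)
  also have "\<dots> = - bracket z (bracket y w)"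
    using bracket_linear_right[of z] by (simp add: module_hom.neg module_hom_iff_linear[symmetric])
  finally have 1: "bracket z (bracket w y) = - bracket z (bracket y w)" .
  have "bracket (bracket y z) w = - bracket w (bracket y z)"
    by (rule bracket_antisym)
  also have "\<dots> = bracket y (bracket z w) + bracket z (bracket w y)"
    using jacobi[of y z w] by (metis eq_neg_iff_add_eq_0)
  finally show "bracket (bracket y z) w = bracket y (bracket z w) - bracket z (bracket y w)"
    unfolding 1 by (simp only: diff_conv_add_uminus)
qed

end

context lie_module
begin

lemma act_root_space:
  assumes "y \<in> root_space scale bracket H \<beta>" "w \<in> weight_space vscale act H \<mu>"
  shows "act y w \<in> weight_space vscale act H (\<mu> + \<beta>)"
  unfolding weight_space_def
proof safe
  fix z assume z: "z \<in> H"
  have "act z (act y w) = act (bracket z y) w + act y (act z w)"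
    by (simp add: act_bracket)
  also have "\<dots> = vscale ((\<mu> + \<beta>) z) (act y w)"
    using assms z by (simp add: weight_space_def V.scale_left_distrib)
  finally show "act z (act y w) = vscale ((\<mu> + \<beta>) z) (act y w)" .
qed

end

lemma zero_in_dual [simp]: "0 \<in> dual scale H"
  by (simp add: dual_def)

lemma dual_add: "f \<in> dual scale H \<Longrightarrow> k \<in> dual scale H \<Longrightarrow> f + k \<in> dual scale H"
  and dual_minus: "f \<in> dual scale H \<Longrightarrow> - f \<in> dual scale H"
  and dual_diff: "f \<in> dual scale H \<Longrightarrow> k \<in> dual scale H \<Longrightarrow> f - k \<in> dual scale H"
  and dual_fun_scale: "f \<in> dual scale H \<Longrightarrow> fun_scale c f \<in> dual scale H"
  by (auto simp: dual_def fun_scale_def algebra_simps)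

lemma dual_eqI:
  assumes "f \<in> dual scale H" "k \<in> dual scale H" "\<And>z. z \<in> H \<Longrightarrow> f z = k z"
  shows "f = k"
proof
  fix z
  show "f z = k z"
    using assms by (cases "z \<in> H") (auto simp: dual_def)
qed

locale chevalley = lie_algebra scale bracket
  for scale :: "complex \<Rightarrow> 'g::ab_group_add \<Rightarrow> 'g" and bracket +
  fixes H :: "'g set" and I :: "'i set" and \<alpha> :: "'i \<Rightarrow> 'g \<Rightarrow> complex"
    and coroot :: "('g \<Rightarrow> complex) \<Rightarrow> 'g" and x :: "('g \<Rightarrow> complex) \<Rightarrow> 'g"
  assumes finite_dim_g: "finite_dim scale"
    and cartan: "cartan_subalgebra scale bracket H"
    and simple: "simple_roots scale bracket H I \<alpha>"
    and coroots: "\<forall>\<beta>\<in>roots scale bracket H. is_coroot scale bracket H \<beta> (coroot \<beta>)"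
    and chevalley_basis: "chevalley_basis scale bracket H I \<alpha> coroot x"
begin

abbreviation "\<Delta> \<equiv> roots scale bracket H"
abbreviation "\<Delta>p \<equiv> positive_roots scale bracket H I \<alpha>"
abbreviation "h i \<equiv> coroot (\<alpha> i)"
abbreviation "functionals \<equiv> dual scale H"
abbreviation "gs \<equiv> weight_space scale bracket H"

lemma root_dual: "\<beta> \<in> \<Delta> \<Longrightarrow> \<beta> \<in> functionals"
  and root_nonzero: "\<beta> \<in> \<Delta> \<Longrightarrow> \<beta> \<noteq> 0"
  and pos_root: "\<beta> \<in> \<Delta>p \<Longrightarrow> \<beta> \<in> \<Delta>"
  by (auto simp: roots_def weights_def positive_roots_def)

lemma H_subspace: "subspace H"
  and H_normalizer: "(\<And>z. z \<in> H \<Longrightarrow> bracket y z \<in> H) \<Longrightarrow> y \<in> H"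
  and H_nilpotent: "\<exists>n. lower_central scale bracket H n = {0}"
  using cartan unfolding cartan_subalgebra_def by blast+

lemma x_in: "\<beta> \<in> \<Delta> \<Longrightarrow> x \<beta> \<in> gs \<beta>"
  and bracket_x_minus: "\<beta> \<in> \<Delta> \<Longrightarrow> bracket (x \<beta>) (x (- \<beta>)) = coroot \<beta>"
  and basis_span: "span (x ` \<Delta> \<union> h ` I) = UNIV"
  and basis_independent: "\<not> dependent (x ` \<Delta> \<union> h ` I)"
  and inj_h: "inj_on h I"
  using chevalley_basis unfolding chevalley_basis_def Let_def by blast+

lemma x_nonzero: "\<beta> \<in> \<Delta> \<Longrightarrow> x \<beta> \<noteq> 0"
  using basis_independent dependent_zero[of "x ` \<Delta> \<union> h ` I"] by (metis UnI1 imageI)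

lemma finite_I: "finite I"
  and inj_alpha: "inj_on \<alpha> I"
  and simple_root: "i \<in> I \<Longrightarrow> \<alpha> i \<in> \<Delta>"
  and root_sign: "\<beta> \<in> \<Delta> \<Longrightarrow> \<beta> \<in> nonneg_combinations I \<alpha> \<or> - \<beta> \<in> nonneg_combinations I \<alpha>"
  using simple unfolding simple_roots_def by blast+

lemma functional_add: "f \<in> functionals \<Longrightarrow> y \<in> H \<Longrightarrow> z \<in> H \<Longrightarrow> f (y + z) = f y + f z"
  and functional_scale: "f \<in> functionals \<Longrightarrow> y \<in> H \<Longrightarrow> f (scale c y) = c * f y"
  by (auto simp: dual_def)

lemma functional_0 [simp]: "f \<in> functionals \<Longrightarrow> f 0 = 0"
  using functional_scale[of f 0 0] H_subspace subspace_0 by auto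

lemma functional_sum:
  assumes "f \<in> functionals" "\<And>i. i \<in> A \<Longrightarrow> t i \<in> H"
  shows "f (\<Sum>i\<in>A. scale (c i) (t i)) = (\<Sum>i\<in>A. c i * f (t i))"
  using assms(2)
proof (induction A rule: infinite_finite_induct)
  case (insert a A)
  then have "scale (c a) (t a) \<in> H" "(\<Sum>i\<in>A. scale (c i) (t i)) \<in> H"
    using H_subspace by (auto intro!: subspace_scale subspace_sum)
  then show ?case using insert assms(1)
    by (simp add: functional_add functional_scale)
qed (simp_all add: assms)

end

text \<open>Both V and the adjoint module become instances, so weight components, nilpotency and
  reflections are set up once. That the weight spaces span follows from the Chevalley basis for the
  adjoint module and from irreducibility for V.\<close>

locale weight_module = chevalley scale bracket H I \<alpha> coroot x + lie_module scale bracket vscale act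
  for scale :: "complex \<Rightarrow> 'g::ab_group_add \<Rightarrow> 'g" and bracket and H :: "'g set" and I :: "'i set"
    and \<alpha> coroot x and vscale :: "complex \<Rightarrow> 'v::ab_group_add \<Rightarrow> 'v" and act +
  assumes finite_dim_V: "finite_dim vscale"
    and weight_spaces_span: "V.span (\<Union>\<mu>\<in>dual scale H. weight_space vscale act H \<mu>) = UNIV"
begin

abbreviation "W \<equiv> weights scale vscale act H"
abbreviation "wsp \<equiv> weight_space vscale act H"
abbreviation "xdp \<beta> \<equiv> dpow vscale (act (x \<beta>))"

lemma weight_dual: "\<mu> \<in> W \<Longrightarrow> \<mu> \<in> functionals"
  by (simp add: weights_def)

lemma subspace_wsp: "V.subspace (wsp \<mu>)"
  by (auto simp: V.subspace_def weight_space_def V.scale_right_distrib mult.commute)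

lemmas wsp_closed = V.subspace_add[OF subspace_wsp] V.subspace_scale[OF subspace_wsp]
  V.subspace_sum[OF subspace_wsp] V.subspace_neg[OF subspace_wsp] V.subspace_diff[OF subspace_wsp]

lemma zero_wsp [simp]: "0 \<in> wsp \<mu>"
  by (rule V.subspace_0[OF subspace_wsp])

lemma wspD: "w \<in> wsp \<mu> \<Longrightarrow> z \<in> H \<Longrightarrow> act z w = vscale (\<mu> z) w"
  by (simp add: weight_space_def)

lemma wsp_trivial: "\<mu> \<in> functionals \<Longrightarrow> \<mu> \<notin> W \<Longrightarrow> w \<in> wsp \<mu> \<Longrightarrow> w = 0"
  unfolding weights_def by blast

lemma weightI: "\<mu> \<in> functionals \<Longrightarrow> w \<in> wsp \<mu> \<Longrightarrow> w \<noteq> 0 \<Longrightarrow> \<mu> \<in> W"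
  using wsp_trivial by blast

text \<open>Choose z in \<open>H\<close> that separates two of the weights. Applying z minus its
  eigenvalue on the last weight kills that summand and multiplies another one by a nonzero
  number.\<close>

lemma weight_vectors_independent:
  assumes "finite F" "F \<subseteq> functionals" "\<And>\<nu>. \<nu> \<in> F \<Longrightarrow> c \<nu> \<in> wsp \<nu>" "(\<Sum>\<nu>\<in>F. c \<nu>) = 0" "\<mu> \<in> F"
  shows "c \<mu> = 0"
  using assms
proof (induction F arbitrary: c \<mu> rule: finite_induct)
  case (insert \<kappa> F)
  have z0: "c \<nu> = 0" if \<nu>: "\<nu> \<in> F" for \<nu>
  proof -
    have "\<exists>z\<in>H. \<nu> z \<noteq> \<kappa> z"
      using dual_eqI[of \<nu> scale H \<kappa>] insert.hyps insert.prems(1) \<nu> by (metis insert_subset subsetD)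
    then obtain z where z: "z \<in> H" "\<nu> z \<noteq> \<kappa> z" by blast
    have az: "act z (c \<nu>) = vscale (\<nu> z) (c \<nu>)" if "\<nu> \<in> insert \<kappa> F" for \<nu>
      using insert.prems(2)[OF that] z(1) by (rule wspD)
    have "(\<Sum>\<nu>\<in>F. vscale (\<nu> z - \<kappa> z) (c \<nu>)) = act z (\<Sum>\<nu>\<in>insert \<kappa> F. c \<nu>) - vscale (\<kappa> z) (\<Sum>\<nu>\<in>insert \<kappa> F. c \<nu>)"
      using insert.hyps unfolding act_sum_right V.scale_sum_right sum_subtractf[symmetric]
      by (simp add: az V.scale_left_diff_distrib)
    also have "\<dots> = 0" using insert.prems by (simp del: sum.insert)
    finally have "vscale (\<nu> z - \<kappa> z) (c \<nu>) = 0"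
      using insert.IH[of "\<lambda>\<nu>. vscale (\<nu> z - \<kappa> z) (c \<nu>)" \<nu>] insert.prems \<nu>
      by (auto intro: wsp_closed)
    then show ?thesis using z by auto
  qed
  then have "(\<Sum>\<nu>\<in>F. c \<nu>) = 0" by simp
  then have "c \<kappa> = 0" using insert by simp
  then show ?case using z0 insert.prems by auto
qed simp

text \<open>One nonzero vector for each weight gives an independent family, which is no larger than
  a finite spanning set. The count is made on finite subsets, since finiteness is the claim.\<close>

lemma finite_weights: "finite W"
proof -
  obtain B where B: "finite B" "V.span B = UNIV"
    using finite_dim_V unfolding finite_dim_def by blast
  have "\<forall>\<mu>\<in>W. \<exists>w. w \<in> wsp \<mu> \<and> w \<noteq> 0"
    unfolding weights_def using zero_wsp by blast
  then obtain c where c: "\<And>\<mu>. \<mu> \<in> W \<Longrightarrow> c \<mu> \<in> wsp \<mu> \<and> c \<mu> \<noteq> 0"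
    by metis
  have inj: "inj_on c W"
  proof (rule inj_onI, rule ccontr)
    fix \<mu> \<nu> assume a: "\<mu> \<in> W" "\<nu> \<in> W" "c \<mu> = c \<nu>" "\<mu> \<noteq> \<nu>"
    have "(if \<mu> = \<mu> then c \<mu> else - c \<nu>) = 0"
      by (rule weight_vectors_independent[of "{\<mu>, \<nu>}" "\<lambda>\<kappa>. if \<kappa> = \<mu> then c \<mu> else - c \<nu>"])
        (use a c[OF a(1)] c[OF a(2)] weight_dual in \<open>auto intro: wsp_closed\<close>)
    then show False using a c by auto
  qed
  have "card F \<le> card B" if F: "F \<subseteq> W" "finite F" for F
  proof -
    have "V.independent (c ` F)"
      unfolding V.independent_explicit_module
    proof safe
      fix t u w0
      assume t: "finite t" "t \<subseteq> c ` F" "(\<Sum>w\<in>t. vscale (u w) w) = 0" "w0 \<in> t"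
      obtain G where G: "G \<subseteq> F" "t = c ` G"
        using t(2) by (auto simp: subset_image_iff)
      have injG: "inj_on c G" by (rule inj_on_subset[OF inj order_trans[OF G(1) F(1)]])
      obtain \<mu> where \<mu>: "\<mu> \<in> G" and w0: "w0 = c \<mu>"
        using t(4) G(2) by blast
      have "(\<Sum>\<nu>\<in>G. vscale (u (c \<nu>)) (c \<nu>)) = 0"
        using t(3) unfolding G(2) by (simp add: sum.reindex[OF injG])
      moreover have "finite G" "G \<subseteq> functionals"
        using finite_subset[OF G(1) F(2)] G(1) F(1) weight_dual by blast+
      moreover have "vscale (u (c \<nu>)) (c \<nu>) \<in> wsp \<nu>" if "\<nu> \<in> G" for \<nu>
        using c[of \<nu>] that G(1) F(1) by (intro wsp_closed(2)) blast
      ultimately have "vscale (u (c \<mu>)) (c \<mu>) = 0"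
        using \<mu> by (intro weight_vectors_independent[of G "\<lambda>\<nu>. vscale (u (c \<nu>)) (c \<nu>)"]) blast+
      moreover have "c \<mu> \<noteq> 0"
        using c[of \<mu>] \<mu> G(1) F(1) by blast
      ultimately show "u w0 = 0"
        by (simp add: w0)
    qed
    moreover have "c ` F \<subseteq> V.span B" using B by simp
    ultimately have "card (c ` F) \<le> card B"
      using V.independent_span_bound[OF B(1)] by blast
    then show ?thesis
      using card_image[OF inj_on_subset[OF inj F(1)]] by simp
  qed
  then show ?thesis
    using finite_if_finite_subsets_card_bdd[of W "card B"] by blast
qed

text \<open>\<open>wcomp \<mu> w\<close> is the component of \<open>w\<close> in the weight space of \<open>\<mu>\<close>.\<close>

definition wcomp :: "('g \<Rightarrow> complex) \<Rightarrow> 'v \<Rightarrow> 'v" where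
  "wcomp \<mu> w = (SOME c. (\<forall>\<nu>. c \<nu> \<in> wsp \<nu>) \<and> (\<forall>\<nu>. \<nu> \<notin> W \<longrightarrow> c \<nu> = 0) \<and> w = (\<Sum>\<nu>\<in>W. c \<nu>)) \<mu>"

lemma weight_decomposition_exists:
  "\<exists>c. (\<forall>\<nu>. c \<nu> \<in> wsp \<nu>) \<and> (\<forall>\<nu>. \<nu> \<notin> W \<longrightarrow> c \<nu> = 0) \<and> w = (\<Sum>\<nu>\<in>W. c \<nu>)"
    (is "\<exists>c. ?P c w")
proof -
  have "w \<in> V.span (\<Union>\<mu>\<in>functionals. wsp \<mu>)"
    using weight_spaces_span by simp
  then show ?thesis
  proof (induction rule: V.span_induct_alt)
    case base
    show ?case by (rule exI[of _ "\<lambda>_. 0"]) simp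
  next
    case (step k u w)
    then obtain c \<mu> where c: "?P c w" and \<mu>: "\<mu> \<in> functionals" "u \<in> wsp \<mu>" by auto
    show ?case
    proof (cases "\<mu> \<in> W")
      case True
      show ?thesis
        by (rule exI[of _ "\<lambda>\<nu>. (if \<nu> = \<mu> then vscale k u else 0) + c \<nu>"])
          (use c True \<mu> in \<open>auto simp: sum.distrib finite_weights intro: wsp_closed\<close>)
    next
      case False
      then have "u = 0" using \<mu> wsp_trivial by blast
      then show ?thesis using c by auto
    qed
  qed
qed

lemma wcomp_props:
  shows wcomp_in: "wcomp \<mu> w \<in> wsp \<mu>"
    and wcomp_outside: "\<mu> \<notin> W \<Longrightarrow> wcomp \<mu> w = 0"
    and wcomp_sum: "(\<Sum>\<nu>\<in>W. wcomp \<nu> w) = w"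
proof -
  define c where "c = (SOME c. (\<forall>\<nu>. c \<nu> \<in> wsp \<nu>) \<and> (\<forall>\<nu>. \<nu> \<notin> W \<longrightarrow> c \<nu> = 0) \<and> w = (\<Sum>\<nu>\<in>W. c \<nu>))"
  have c: "(\<forall>\<nu>. c \<nu> \<in> wsp \<nu>) \<and> (\<forall>\<nu>. \<nu> \<notin> W \<longrightarrow> c \<nu> = 0) \<and> w = (\<Sum>\<nu>\<in>W. c \<nu>)"
    unfolding c_def by (rule someI_ex[OF weight_decomposition_exists])
  have "wcomp \<nu> w = c \<nu>" for \<nu>
    by (simp add: wcomp_def c_def)
  then show "wcomp \<mu> w \<in> wsp \<mu>" "\<mu> \<notin> W \<Longrightarrow> wcomp \<mu> w = 0" "(\<Sum>\<nu>\<in>W. wcomp \<nu> w) = w"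
    using c by simp_all
qed

lemma wcomp_eqI:
  assumes "finite F" "F \<subseteq> functionals" "\<And>\<nu>. \<nu> \<in> F \<Longrightarrow> c \<nu> \<in> wsp \<nu>" "w = (\<Sum>\<nu>\<in>F. c \<nu>)"
    and \<mu>: "\<mu> \<in> functionals"
  shows "wcomp \<mu> w = (if \<mu> \<in> F then c \<mu> else 0)"
proof -
  let ?d = "\<lambda>\<nu>. wcomp \<nu> w - (if \<nu> \<in> F then c \<nu> else 0)"
  let ?G = "insert \<mu> (F \<union> W)"
  have fin: "finite ?G" using assms finite_weights by auto
  have "(\<Sum>\<nu>\<in>?G. wcomp \<nu> w) = (\<Sum>\<nu>\<in>W. wcomp \<nu> w)"
    by (rule sum.mono_neutral_right) (use fin in \<open>auto simp: wcomp_outside\<close>)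
  moreover have "(\<Sum>\<nu>\<in>?G. if \<nu> \<in> F then c \<nu> else 0) = (\<Sum>\<nu>\<in>F. c \<nu>)"
    by (rule sum.mono_neutral_cong_right) (use fin in auto)
  ultimately have "(\<Sum>\<nu>\<in>?G. ?d \<nu>) = 0"
    using assms(4) by (simp add: sum_subtractf wcomp_sum del: sum.insert)
  then have "?d \<mu> = 0"
    using assms(2,3) \<mu> weight_dual fin
    by (intro weight_vectors_independent[of ?G ?d]) (auto intro!: wsp_closed wcomp_in)
  then show ?thesis by simp
qed

lemma wcomp_weight_vector:
  assumes "w \<in> wsp \<mu>" "\<mu> \<in> functionals" "\<nu> \<in> functionals"
  shows "wcomp \<nu> w = (if \<nu> = \<mu> then w else 0)"
  using wcomp_eqI[of "{\<mu>}" "\<lambda>_. w" w \<nu>] assms by auto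

lemma lin_wcomp: "\<mu> \<in> functionals \<Longrightarrow> V.lin (wcomp \<mu>)"
proof (rule V.linI)
  fix a b assume \<mu>: "\<mu> \<in> functionals"
  have "wcomp \<mu> (a + b) = (if \<mu> \<in> W then wcomp \<mu> a + wcomp \<mu> b else 0)"
    by (rule wcomp_eqI) (use finite_weights weight_dual \<mu> in
        \<open>auto simp: sum.distrib wcomp_sum intro!: wsp_closed wcomp_in\<close>)
  then show "wcomp \<mu> (a + b) = wcomp \<mu> a + wcomp \<mu> b" by (simp add: wcomp_outside split: if_splits)
next
  fix c a assume \<mu>: "\<mu> \<in> functionals"
  have "wcomp \<mu> (vscale c a) = (if \<mu> \<in> W then vscale c (wcomp \<mu> a) else 0)"
    by (rule wcomp_eqI) (use finite_weights weight_dual \<mu> in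
        \<open>auto simp: wcomp_sum V.scale_sum_right[symmetric] intro!: wsp_closed wcomp_in\<close>)
  then show "wcomp \<mu> (vscale c a) = vscale c (wcomp \<mu> a)" by (simp add: wcomp_outside split: if_splits)
qed

lemmas wcomp_simps = V.lin_simps[OF lin_wcomp]

lemma wcomp_act:
  assumes "y \<in> gs \<beta>" "\<beta> \<in> functionals" "\<mu> \<in> functionals"
  shows "wcomp (\<mu> + \<beta>) (act y w) = act y (wcomp \<mu> w)"
proof -
  have inj: "inj_on (\<lambda>\<nu>. \<nu> + \<beta>) W" by (auto intro: inj_onI)
  have "wcomp (\<mu> + \<beta>) (act y w) = (if \<mu> + \<beta> \<in> (\<lambda>\<nu>. \<nu> + \<beta>) ` W then act y (wcomp ((\<mu> + \<beta>) - \<beta>) w) else 0)"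
  proof (rule wcomp_eqI)
    show "act y w = (\<Sum>\<nu>\<in>(\<lambda>\<nu>. \<nu> + \<beta>) ` W. act y (wcomp (\<nu> - \<beta>) w))"
      by (simp add: sum.reindex[OF inj] act_sum_right[symmetric] wcomp_sum)
    show "act y (wcomp (\<nu> - \<beta>) w) \<in> wsp \<nu>" for \<nu>
      using act_root_space[OF assms(1) wcomp_in[of "\<nu> - \<beta>" w]] by simp
    show "(\<lambda>\<nu>. \<nu> + \<beta>) ` W \<subseteq> functionals"
      using dual_add[OF weight_dual assms(2)] by blast
    show "\<mu> + \<beta> \<in> functionals"
      by (rule dual_add[OF assms(3,2)])
  qed (simp add: finite_weights)
  moreover have "\<mu> + \<beta> \<in> (\<lambda>\<nu>. \<nu> + \<beta>) ` W \<longleftrightarrow> \<mu> \<in> W"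
    by (metis (no_types, lifting) add_right_imp_eq image_iff)
  ultimately show ?thesis by (simp add: wcomp_outside)
qed

lemma weight_vectors_induct:
  assumes "\<And>\<mu> w. \<mu> \<in> W \<Longrightarrow> w \<in> wsp \<mu> \<Longrightarrow> P w" "\<And>a b. P a \<Longrightarrow> P b \<Longrightarrow> P (a + b)" "P 0"
  shows "P w"
proof -
  have "P (\<Sum>\<nu>\<in>A. wcomp \<nu> w)" if "A \<subseteq> W" for A
    using finite_subset[OF that finite_weights] that
    by (induction A rule: finite_induct) (use assms wcomp_in in auto)
  from this[of W] show ?thesis by (simp add: wcomp_sum)
qed

lemma lin_eq_on_weight_vectors:
  assumes "V.lin f" "V.lin g" "\<And>\<mu> w. \<mu> \<in> W \<Longrightarrow> w \<in> wsp \<mu> \<Longrightarrow> f w = g w"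
  shows "f w = g w"
  by (rule weight_vectors_induct[of "\<lambda>w. f w = g w"]) (simp_all add: assms V.lin_simps)

lemma funpow_act_root_space:
  assumes "y \<in> gs \<beta>" "w \<in> wsp \<mu>"
  shows "(act y ^^ n) w \<in> wsp (\<mu> + fun_scale (of_nat n) \<beta>)"
proof (induction n)
  case (Suc n)
  have "act y ((act y ^^ n) w) \<in> wsp (\<mu> + fun_scale (of_nat n) \<beta> + \<beta>)"
    by (rule act_root_space[OF assms(1) Suc])
  also have "\<mu> + fun_scale (of_nat n) \<beta> + \<beta> = \<mu> + fun_scale (of_nat (Suc n)) \<beta>"
    by (auto simp: fun_scale_def algebra_simps fun_eq_iff)
  finally show ?case by simp
qed (use assms in \<open>simp add: fun_scale_def plus_fun_def\<close>)

lemma dpow_act_root_space: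
  assumes "y \<in> gs \<beta>" "w \<in> wsp \<mu>"
  shows "dpow vscale (act y) n w \<in> wsp (\<mu> + fun_scale (of_nat n) \<beta>)"
  unfolding dpow_def by (rule wsp_closed(2)[OF funpow_act_root_space[OF assms]])

text \<open>If the n-th power did not kill a vector of weight \<mu>, then \<mu>, \<mu> + \<beta>,
  ..., \<mu> + n\<beta> would be n + 1 distinct weights.\<close>

lemma act_root_nilpotent:
  assumes "y \<in> gs \<beta>" "\<beta> \<in> functionals" "\<beta> \<noteq> 0" "n \<ge> card W"
  shows "(act y ^^ n) w = 0"
proof -
  have weight: "(act y ^^ n) w = 0" if w: "w \<in> wsp \<mu>" and \<mu>: "\<mu> \<in> functionals" for w \<mu>
  proof (rule ccontr)
    assume nz: "(act y ^^ n) w \<noteq> 0"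
    let ?f = "\<lambda>k. \<mu> + fun_scale (of_nat k) \<beta>"
    have "?f k \<in> W" if "k \<le> n" for k
    proof (rule weightI)
      show "?f k \<in> functionals" by (intro dual_add dual_fun_scale assms \<mu>)
      show "(act y ^^ k) w \<in> wsp (?f k)" by (rule funpow_act_root_space[OF assms(1) w])
      have "(act y ^^ n) w = (act y ^^ (n - k)) ((act y ^^ k) w)"
        using that funpow_add[of "n - k" k "act y"] by (metis comp_apply le_add_diff_inverse2)
      then show "(act y ^^ k) w \<noteq> 0"
        using nz V.lin_zero[OF V.lin_funpow[OF act_linear_right]] by metis
    qed
    then have "?f ` {..n} \<subseteq> W" by auto
    moreover have "inj_on ?f {..n}"
    proof (rule inj_onI)
      fix j k assume "?f j = ?f k"
      moreover obtain z where "\<beta> z \<noteq> 0" using assms(3) by (auto simp: fun_eq_iff)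
      ultimately show "j = k"
        by (auto simp: fun_eq_iff fun_scale_def dest!: spec[of _ z])
    qed
    ultimately have "Suc n \<le> card W"
      using card_inj_on_le[of ?f "{..n}" W] finite_weights by auto
    then show False using assms(4) by simp
  qed
  show ?thesis
    by (rule lin_eq_on_weight_vectors[of "act y ^^ n" "\<lambda>_. 0"])
      (auto intro: V.lin_funpow act_linear_right V.linI weight weight_dual)
qed

end

section \<open>The root space decomposition\<close>

lemma Nats_choice:
  assumes "\<And>l. l \<in> A \<Longrightarrow> f l \<in> \<nat>"
  obtains c :: "'a \<Rightarrow> nat" where "\<And>l. l \<in> A \<Longrightarrow> f l = of_nat (c l)"
proof -
  have "\<forall>l\<in>A. \<exists>n::nat. f l = of_nat n"
    using assms by (auto elim!: Nats_cases)
  from bchoice[OF this] show ?thesis using that by blast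
qed

context weight_module
begin

lemma wcomp_act_H:
  assumes "z \<in> H" "\<mu> \<in> functionals"
  shows "wcomp \<mu> (act z w) = vscale (\<mu> z) (wcomp \<mu> w)"
proof -
  have "act z w = (\<Sum>\<nu>\<in>W. vscale (\<nu> z) (wcomp \<nu> w))"
    using wspD[OF wcomp_in assms(1)] by (simp add: act_sum_right[symmetric] wcomp_sum flip: wspD[OF wcomp_in assms(1)])
  then have "wcomp \<mu> (act z w) = (if \<mu> \<in> W then vscale (\<mu> z) (wcomp \<mu> w) else 0)"
    by (intro wcomp_eqI) (auto simp: finite_weights assms weight_dual intro: wsp_closed(2) wcomp_in)
  then show ?thesis
    by (simp add: wcomp_outside split: if_splits)
qed

end

context chevalley
begin

lemma bracket_opposite:
  assumes "y \<in> gs \<beta>" "z \<in> gs (- \<beta>)"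
  shows "bracket y z \<in> gs 0"
  unfolding weight_space_def
proof safe
  fix w assume "w \<in> H"
  then have "bracket w y = scale (\<beta> w) y" "bracket w z = scale (- \<beta> w) z"
    using assms by (auto simp: weight_space_def)
  moreover have "bracket w (bracket y z) = bracket (bracket w y) z + bracket y (bracket w z)"
    by (simp add: ad.act_bracket)
  ultimately show "bracket w (bracket y z) = scale (0 w) (bracket y z)"
    by simp
qed

lemma coroot_gs_0: "\<beta> \<in> \<Delta> \<Longrightarrow> coroot \<beta> \<in> gs 0"
proof -
  assume "\<beta> \<in> \<Delta>"
  then have "coroot \<beta> \<in> span {bracket y z | y z. y \<in> gs \<beta> \<and> z \<in> gs (- \<beta>)}"
    using coroots unfolding is_coroot_def by blast
  moreover have "subspace (gs 0)"
    by (auto simp: subspace_def weight_space_def)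
  ultimately show ?thesis
    using bracket_opposite span_minimal[of "{bracket y z | y z. y \<in> gs \<beta> \<and> z \<in> gs (- \<beta>)}" "gs 0"] by blast
qed

text \<open>By the Jacobi identity the coroot centralizes \<open>H\<close>, and \<open>H\<close> is
  its own normalizer.\<close>

lemma coroot_in_H: "\<beta> \<in> \<Delta> \<Longrightarrow> coroot \<beta> \<in> H"
proof (rule H_normalizer)
  fix z assume "\<beta> \<in> \<Delta>" "z \<in> H"
  then have "bracket z (coroot \<beta>) = 0"
    using coroot_gs_0[of \<beta>] by (simp add: weight_space_def)
  then have "bracket (coroot \<beta>) z = 0"
    using bracket_antisym[of "coroot \<beta>" z] by simp
  then show "bracket (coroot \<beta>) z \<in> H"
    by (simp add: subspace_0[OF H_subspace])
qed

lemma root_coroot [simp]: "\<beta> \<in> \<Delta> \<Longrightarrow> \<beta> (coroot \<beta>) = 2"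
  using coroots unfolding is_coroot_def by blast

text \<open>If the root space of -\<beta> were zero, so would be the coroot, on which \<beta> takes
  the value 2.\<close>

lemma minus_root: "\<beta> \<in> \<Delta> \<Longrightarrow> - \<beta> \<in> \<Delta>"
proof -
  assume \<beta>: "\<beta> \<in> \<Delta>"
  have "\<exists>z\<in>gs (- \<beta>). z \<noteq> 0"
  proof (rule ccontr)
    assume "\<not> (\<exists>z\<in>gs (- \<beta>). z \<noteq> 0)"
    then have "{bracket y z | y z. y \<in> gs \<beta> \<and> z \<in> gs (- \<beta>)} \<subseteq> {0}"
      by force
    then have "span {bracket y z | y z. y \<in> gs \<beta> \<and> z \<in> gs (- \<beta>)} \<subseteq> {0}"
      by (rule span_minimal) (rule subspace_single_0)
    then have "coroot \<beta> = 0"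
      using coroots \<beta> unfolding is_coroot_def by blast
    then show False
      using root_coroot[OF \<beta>] functional_0[OF root_dual[OF \<beta>]] by simp
  qed
  then show ?thesis
    using root_dual[OF \<beta>] root_nonzero[OF \<beta>] by (auto simp: roots_def weights_def dual_minus)
qed

sublocale adj: weight_module scale bracket H I \<alpha> coroot x scale bracket
proof (intro weight_module.intro weight_module_axioms.intro)
  have "x ` \<Delta> \<union> h ` I \<subseteq> (\<Union>\<mu>\<in>functionals. gs \<mu>)"
    using x_in root_dual coroot_gs_0[OF simple_root] zero_in_dual[of scale H] by blast
  from span_mono[OF this] show "span (\<Union>\<mu>\<in>functionals. gs \<mu>) = UNIV"
    using basis_span by auto
qed (rule chevalley_axioms ad.lie_module_axioms finite_dim_g)+

lemma finite_roots: "finite \<Delta>"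
  using adj.finite_weights by (simp add: roots_def)

lemma adj_wcomp_x: "\<beta> \<in> \<Delta> \<Longrightarrow> \<mu> \<in> functionals \<Longrightarrow> adj.wcomp \<mu> (x \<beta>) = (if \<mu> = \<beta> then x \<beta> else 0)"
  by (rule adj.wcomp_weight_vector) (auto intro: x_in root_dual)

lemma adj_wcomp_h: "i \<in> I \<Longrightarrow> \<mu> \<in> functionals \<Longrightarrow> adj.wcomp \<mu> (h i) = (if \<mu> = 0 then h i else 0)"
  by (rule adj.wcomp_weight_vector) (auto intro: coroot_gs_0 simple_root)

lemma basis_induct [case_names x h zero add scale]:
  assumes "\<And>\<beta>. \<beta> \<in> \<Delta> \<Longrightarrow> P (x \<beta>)" "\<And>i. i \<in> I \<Longrightarrow> P (h i)"
    and "P 0" "\<And>y z. P y \<Longrightarrow> P z \<Longrightarrow> P (y + z)" "\<And>c y. P y \<Longrightarrow> P (scale c y)"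
  shows "P y"
proof -
  have "y \<in> span (x ` \<Delta> \<union> h ` I)" by (simp add: basis_span)
  then show ?thesis
    by (induction rule: span_induct_alt) (use assms in auto)
qed

text \<open>Root spaces are lines because the projection to weight \<beta> kills every vector of the
  Chevalley basis except \<open>x \<beta>\<close>.\<close>

lemma adj_wcomp_root: "\<beta> \<in> \<Delta> \<Longrightarrow> adj.wcomp \<beta> y \<in> span {x \<beta>}"
  by (induction y rule: basis_induct)
    (simp_all add: adj_wcomp_x adj_wcomp_h root_dual root_nonzero adj.wcomp_simps
      span_base span_add span_scale span_zero)

lemma adj_wcomp_0: "adj.wcomp 0 y \<in> span (h ` I)"
  by (rule basis_induct[where P = "\<lambda>y. adj.wcomp 0 y \<in> span (h ` I)"])
    (simp_all add: adj_wcomp_x adj_wcomp_h adj.wcomp_simps root_nonzero[symmetric]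
      span_base span_add span_scale span_zero)

lemma lower_central_funpow: "y \<in> H \<Longrightarrow> z \<in> H \<Longrightarrow> (bracket y ^^ n) z \<in> lower_central scale bracket H n"
  by (induction n) (auto intro!: span_base)

text \<open>For y in \<open>H\<close>, \<open>bracket y\<close> is nilpotent on \<open>H\<close>,
  but it multiplies the component of weight \<gamma> by \<gamma>(y). So an element of
  \<open>H\<close> has only its component of weight 0, which the \<open>h i\<close> span.\<close>

lemma H_eq_span: "H = span (h ` I)"
proof
  show "span (h ` I) \<subseteq> H"
    by (rule span_minimal) (use H_subspace coroot_in_H simple_root in auto)
  obtain n where n: "lower_central scale bracket H n = {0}"
    using H_nilpotent by blast
  show "H \<subseteq> span (h ` I)"
  proof
    fix z assume z: "z \<in> H"
    have "adj.wcomp \<gamma> z = 0" if \<gamma>: "\<gamma> \<in> functionals" "\<gamma> \<noteq> 0" for \<gamma>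
    proof -
      obtain y where y: "y \<in> H" "\<gamma> y \<noteq> 0"
        using dual_eqI[of \<gamma> scale H 0] \<gamma> by auto
      have "adj.wcomp \<gamma> ((bracket y ^^ k) z) = scale (\<gamma> y ^ k) (adj.wcomp \<gamma> z)" for k
        by (induction k) (simp_all add: adj.wcomp_act_H y \<gamma>)
      moreover have "(bracket y ^^ n) z = 0"
        using lower_central_funpow[OF y(1) z, of n] n by simp
      ultimately have "scale (\<gamma> y ^ n) (adj.wcomp \<gamma> z) = 0"
        using adj.wcomp_simps(3)[OF \<gamma>(1)] by metis
      then show ?thesis using y by simp
    qed
    then have "(\<Sum>\<nu>\<in>adj.W. adj.wcomp \<nu> z) = (\<Sum>\<nu>\<in>adj.W. if \<nu> = 0 then adj.wcomp 0 z else 0)"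
      using adj.weight_dual by (intro sum.cong) auto
    also have "\<dots> \<in> span (h ` I)"
      using adj_wcomp_0 by (simp add: adj.finite_weights span_zero)
    finally show "z \<in> span (h ` I)"
      by (simp add: adj.wcomp_sum)
  qed
qed

lemma h_in_H: "i \<in> I \<Longrightarrow> h i \<in> H"
  by (simp add: coroot_in_H simple_root)

lemma functional_eqI:
  assumes "f \<in> functionals" "k \<in> functionals" "\<And>i. i \<in> I \<Longrightarrow> f (h i) = k (h i)"
  shows "f = k"
proof (rule dual_eqI[OF assms(1,2)])
  fix z assume "z \<in> H"
  then have "z \<in> span (h ` I)" using H_eq_span by simp
  then have "f z = k z \<and> z \<in> H"
    by (induction rule: span_induct_alt)
      (use assms H_subspace h_in_H in \<open>auto simp: functional_add functional_scale subspace_0 subspace_add subspace_scale\<close>)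
  then show "f z = k z" by simp
qed

lemma gs_root: "\<beta> \<in> \<Delta> \<Longrightarrow> y \<in> gs \<beta> \<Longrightarrow> \<exists>c. y = scale c (x \<beta>)"
  using adj_wcomp_root[of \<beta> y] adj.wcomp_weight_vector[of y \<beta> \<beta>] root_dual[of \<beta>]
  by (auto simp: span_singleton)

lemma gs_trivial: "\<mu> \<in> functionals \<Longrightarrow> \<mu> \<notin> \<Delta> \<Longrightarrow> \<mu> \<noteq> 0 \<Longrightarrow> y \<in> gs \<mu> \<Longrightarrow> y = 0"
  by (rule adj.wsp_trivial[of \<mu>]) (auto simp: roots_def)

lemma bracket_H_x: "z \<in> H \<Longrightarrow> \<beta> \<in> \<Delta> \<Longrightarrow> bracket z (x \<beta>) = scale (\<beta> z) (x \<beta>)"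
  using x_in by (auto simp: weight_space_def)

lemma bracket_x_H: "z \<in> H \<Longrightarrow> \<beta> \<in> \<Delta> \<Longrightarrow> bracket (x \<beta>) z = scale (- \<beta> z) (x \<beta>)"
  using bracket_H_x[of z \<beta>] bracket_antisym[of "x \<beta>" z] by simp

lemma adj_act_nilpotent: "\<exists>N. \<forall>n\<ge>N. \<forall>\<beta>\<in>\<Delta>. \<forall>z. (bracket (x \<beta>) ^^ n) z = 0"
  using adj.act_root_nilpotent x_in root_dual root_nonzero by blast

section \<open>Fundamental coweights and heights\<close>

lemma vector_space_fun_scale: "vector_space (fun_scale :: complex \<Rightarrow> ('g \<Rightarrow> complex) \<Rightarrow> _)"
  by unfold_locales (auto simp: fun_scale_def fun_eq_iff algebra_simps)

lemma alpha_independent: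
  assumes "\<And>z. (\<Sum>l\<in>I. c l * \<alpha> l z) = 0" "l \<in> I"
  shows "c l = 0"
proof -
  interpret fs: vector_space "fun_scale :: complex \<Rightarrow> ('g \<Rightarrow> complex) \<Rightarrow> _"
    by (rule vector_space_fun_scale)
  let ?u = "\<lambda>\<beta>. c (the_inv_into I \<alpha> \<beta>)"
  have u: "?u (\<alpha> l) = c l" if "l \<in> I" for l
    using that inj_alpha by (simp add: the_inv_into_f_f)
  have "(\<Sum>\<beta>\<in>\<alpha> ` I. fun_scale (?u \<beta>) \<beta>) = (\<Sum>l\<in>I. fun_scale (c l) (\<alpha> l))"
    by (simp add: sum.reindex[OF inj_alpha] u)
  also have "\<dots> = 0"
  proof
    fix z
    have "(\<Sum>l\<in>A. fun_scale (c l) (\<alpha> l)) z = (\<Sum>l\<in>A. c l * \<alpha> l z)" for A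
      by (induction A rule: infinite_finite_induct) (auto simp: fun_scale_def)
    then show "(\<Sum>l\<in>I. fun_scale (c l) (\<alpha> l)) z = 0 z"
      using assms(1) by simp
  qed
  finally have "?u (\<alpha> l) = 0"
    using simple finite_I assms(2) unfolding simple_roots_def
    by (intro fs.independentD[of "\<alpha> ` I" "\<alpha> ` I" ?u "\<alpha> l"]) auto
  then show ?thesis by (simp add: u assms(2))
qed

lemma functional_expansion:
  assumes "f \<in> functionals"
  shows "\<exists>c. \<forall>z. f z = (\<Sum>l\<in>I. c l * \<alpha> l z)"
proof -
  interpret fs: vector_space "fun_scale :: complex \<Rightarrow> ('g \<Rightarrow> complex) \<Rightarrow> _"
    by (rule vector_space_fun_scale)
  have "f \<in> fs.span (\<alpha> ` I)"
    using assms simple unfolding simple_roots_def by simp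
  then obtain u where "f = (\<Sum>\<beta>\<in>\<alpha> ` I. fun_scale (u \<beta>) \<beta>)"
    using fs.span_finite[of "\<alpha> ` I"] finite_I by auto
  moreover have "(\<Sum>l\<in>A. fun_scale (c l) (\<alpha> l)) z = (\<Sum>l\<in>A. c l * \<alpha> l z)" for A c z
    by (induction A rule: infinite_finite_induct) (auto simp: fun_scale_def)
  ultimately have "\<forall>z. f z = (\<Sum>l\<in>I. u (\<alpha> l) * \<alpha> l z)"
    by (simp add: sum.reindex[OF inj_alpha])
  then show ?thesis by (rule exI[of _ "\<lambda>l. u (\<alpha> l)"])
qed

lemma h_dual_basis: "i \<in> I \<Longrightarrow> \<exists>f\<in>functionals. \<forall>j\<in>I. f (h j) = (if j = i then 1 else 0)"
proof -
  assume i: "i \<in> I"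
  have ind: "independent (h ` I)"
    using basis_independent independent_mono[of "x ` \<Delta> \<union> h ` I" "h ` I"] by blast
  let ?f = "\<lambda>z. if z \<in> H then representation (h ` I) z (h i) else 0"
  have a1: "?f \<in> functionals"
    using ind H_subspace unfolding dual_def
    by (auto simp: representation_add representation_scale H_eq_span span_add span_scale)
  have a2: "?f (h j) = (if j = i then 1 else 0)" if "j \<in> I" for j
  proof -
    have "representation (h ` I) (h j) (h i) = (if h i = h j then 1 else 0)"
      unfolding representation_basis[OF ind imageI[OF that]] ..
    then show ?thesis
      unfolding if_P[OF h_in_H[OF that]] inj_on_eq_iff[OF inj_h i that] eq_commute[of i j] .
  qed
  show ?thesis by (rule bexI[where x = ?f]) (rule ballI, rule a2, assumption, rule a1)
qed

text \<open>If \<open>f i = \<Sum>l. a i l * \<alpha> l\<close> is the basis dual to the \<open>h i\<close>, then the fundamental coweights are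
  \<open>\<Sum>j. a j l * h j\<close>, because a left inverse of the Cartan matrix is also a right inverse.\<close>

lemma coweights_exist: "\<exists>\<omega>. \<forall>l\<in>I. \<omega> l \<in> H \<and> (\<forall>k\<in>I. \<alpha> k (\<omega> l) = (if k = l then 1 else 0))"
proof -
  obtain f where f: "\<And>i. i \<in> I \<Longrightarrow> f i \<in> functionals"
    "\<And>i j. i \<in> I \<Longrightarrow> j \<in> I \<Longrightarrow> f i (h j) = (if j = i then 1 else 0)"
    using h_dual_basis by metis
  then have "\<forall>i\<in>I. \<exists>c. \<forall>z. f i z = (\<Sum>l\<in>I. c l * \<alpha> l z)"
    using functional_expansion by blast
  then obtain a where a: "\<And>i z. i \<in> I \<Longrightarrow> f i z = (\<Sum>l\<in>I. a i l * \<alpha> l z)"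
    by metis
  define \<omega> where "\<omega> l = (\<Sum>j\<in>I. scale (a j l) (h j))" for l
  have "\<alpha> k (\<omega> l) = (if k = l then 1 else 0)" if k: "k \<in> I" and l: "l \<in> I" for k l
  proof -
    let ?d = "\<lambda>l. \<Sum>j\<in>I. \<alpha> k (h j) * a j l"
    \<comment> \<open>The right inverse property comes from uniqueness of coordinates: expand
      \<open>\<alpha> k\<close> in the \<open>f j\<close> and these in the simple roots, and compare
      with \<open>\<alpha> k\<close> itself.\<close>
    have ak: "\<alpha> k = (\<Sum>j\<in>I. fun_scale (\<alpha> k (h j)) (f j))" (is "_ = ?s")
    proof (rule functional_eqI)
      show "\<alpha> k \<in> functionals" using k by (simp add: root_dual simple_root)
      show "?s \<in> functionals"
        using f(1) by (induction I rule: infinite_finite_induct) (auto intro: dual_add dual_fun_scale)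
      fix i assume i: "i \<in> I"
      have "(\<Sum>j\<in>A. fun_scale (\<alpha> k (h j)) (f j)) z = (\<Sum>j\<in>A. \<alpha> k (h j) * f j z)" for A z
        by (induction A rule: infinite_finite_induct) (auto simp: fun_scale_def)
      then show "\<alpha> k (h i) = ?s (h i)"
        using i by (simp add: f(2) finite_I if_distrib[of "\<lambda>t. _ * t"] cong: if_cong)
    qed
    have "(\<Sum>l\<in>I. (?d l - (if l = k then 1 else 0)) * \<alpha> l z) = 0" for z
    proof -
      have "(\<Sum>j\<in>A. fun_scale (\<alpha> k (h j)) (f j)) z = (\<Sum>j\<in>A. \<alpha> k (h j) * f j z)" for A
        by (induction A rule: infinite_finite_induct) (auto simp: fun_scale_def)
      then have "\<alpha> k z = (\<Sum>j\<in>I. \<alpha> k (h j) * (\<Sum>l\<in>I. a j l * \<alpha> l z))"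
        using fun_cong[OF ak, of z] a by simp
      also have "\<dots> = (\<Sum>l\<in>I. ?d l * \<alpha> l z)"
        by (simp add: sum_distrib_left sum_distrib_right mult.assoc) (rule sum.swap)
      finally show ?thesis
        using k by (simp add: left_diff_distrib sum_subtractf finite_I if_distrib[of "\<lambda>t. t * _"] cong: if_cong)
    qed
    then have "?d l - (if l = k then 1 else 0) = 0"
      by (rule alpha_independent[OF _ l])
    moreover have "\<alpha> k (\<omega> l) = ?d l"
      unfolding \<omega>_def using functional_sum[of "\<alpha> k" I h] k h_in_H by (simp add: root_dual simple_root mult.commute)
    ultimately show ?thesis by (auto split: if_splits)
  qed
  moreover have "\<omega> l \<in> H" for l
    unfolding \<omega>_def using H_subspace h_in_H by (auto intro!: subspace_sum subspace_scale)
  ultimately show ?thesis by (intro exI[of _ \<omega>]) simp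
qed

definition \<omega> :: "'i \<Rightarrow> 'g" where
  "\<omega> = (SOME \<omega>. \<forall>l\<in>I. \<omega> l \<in> H \<and> (\<forall>k\<in>I. \<alpha> k (\<omega> l) = (if k = l then 1 else 0)))"

lemma coweight_in_H: "l \<in> I \<Longrightarrow> \<omega> l \<in> H"
  and alpha_coweight: "k \<in> I \<Longrightarrow> l \<in> I \<Longrightarrow> \<alpha> k (\<omega> l) = (if k = l then 1 else 0)"
  using someI_ex[OF coweights_exist] unfolding \<omega>_def[symmetric] by auto

lemma functional_coweights:
  assumes "f \<in> functionals"
  shows "f z = (\<Sum>l\<in>I. f (\<omega> l) * \<alpha> l z)"
proof -
  obtain c where c: "\<And>z. f z = (\<Sum>l\<in>I. c l * \<alpha> l z)"
    using functional_expansion[OF assms] by blast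
  have "f (\<omega> l) = c l" if "l \<in> I" for l
    using that by (simp add: c alpha_coweight finite_I if_distrib[of "\<lambda>t. _ * t"] cong: if_cong)
  then show ?thesis by (simp add: c)
qed

lemma functional_eq_coweights:
  assumes "f \<in> functionals" "k \<in> functionals" "\<And>l. l \<in> I \<Longrightarrow> f (\<omega> l) = k (\<omega> l)"
  shows "f = k"
proof
  show "f z = k z" for z
    using functional_coweights[OF assms(1), of z] functional_coweights[OF assms(2), of z] assms(3) by simp
qed

text \<open>The element \<open>h_0\<close> of the overview: by \<open>alpha_coweight\<close> each
  simple root is 1 on it.\<close>

definition height_elt :: 'g where
  "height_elt = (\<Sum>l\<in>I. \<omega> l)"

lemma height_elt_in_H: "height_elt \<in> H"
  unfolding height_elt_def using H_subspace coweight_in_H by (auto intro!: subspace_sum)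

lemma functional_height_elt: "f \<in> functionals \<Longrightarrow> f height_elt = (\<Sum>l\<in>I. f (\<omega> l))"
  using functional_sum[of f I \<omega> "\<lambda>_. 1"] coweight_in_H by (simp add: height_elt_def)

lemma nonneg_combination_iff:
  assumes "f \<in> functionals"
  shows "f \<in> nonneg_combinations I \<alpha> \<longleftrightarrow> (\<forall>l\<in>I. f (\<omega> l) \<in> \<nat>)"
proof
  assume "f \<in> nonneg_combinations I \<alpha>"
  then obtain c :: "'i \<Rightarrow> nat" where c: "f = (\<lambda>z. \<Sum>i\<in>I. of_nat (c i) * \<alpha> i z)"
    unfolding nonneg_combinations_def by blast
  have "f (\<omega> l) = of_nat (c l)" if "l \<in> I" for l
    using that by (simp add: c alpha_coweight finite_I if_distrib[of "\<lambda>t. _ * t"] cong: if_cong)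
  then show "\<forall>l\<in>I. f (\<omega> l) \<in> \<nat>" by simp
next
  assume "\<forall>l\<in>I. f (\<omega> l) \<in> \<nat>"
  then obtain c :: "'i \<Rightarrow> nat" where c: "\<And>l. l \<in> I \<Longrightarrow> f (\<omega> l) = of_nat (c l)"
    using Nats_choice[of I "\<lambda>l. f (\<omega> l)"] by blast
  have "f = (\<lambda>z. \<Sum>i\<in>I. of_nat (c i) * \<alpha> i z)"
    using functional_coweights[OF assms] c by auto
  then show "f \<in> nonneg_combinations I \<alpha>"
    unfolding nonneg_combinations_def by blast
qed

lemma pos_root_iff: "\<beta> \<in> \<Delta>p \<longleftrightarrow> \<beta> \<in> \<Delta> \<and> (\<forall>l\<in>I. \<beta> (\<omega> l) \<in> \<nat>)"
  using nonneg_combination_iff root_dual by (auto simp: positive_roots_def)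

lemma root_cases: "\<beta> \<in> \<Delta> \<Longrightarrow> \<beta> \<in> \<Delta>p \<or> - \<beta> \<in> \<Delta>p"
  using root_sign minus_root by (auto simp: positive_roots_def)

lemma simple_pos: "i \<in> I \<Longrightarrow> \<alpha> i \<in> \<Delta>p"
  by (auto simp: pos_root_iff simple_root alpha_coweight)

lemma pos_root_nonzero_coeff: "\<beta> \<in> \<Delta> \<Longrightarrow> \<exists>l\<in>I. \<beta> (\<omega> l) \<noteq> 0"
  using functional_eq_coweights[of \<beta> 0] root_dual root_nonzero by auto

lemma pos_neg_exclusive: "\<beta> \<in> \<Delta>p \<Longrightarrow> - \<beta> \<notin> \<Delta>p"
proof
  assume "\<beta> \<in> \<Delta>p" "- \<beta> \<in> \<Delta>p"
  then have b: "\<beta> \<in> \<Delta>" "\<And>l. l \<in> I \<Longrightarrow> \<beta> (\<omega> l) \<in> \<nat>" "\<And>l. l \<in> I \<Longrightarrow> - \<beta> (\<omega> l) \<in> \<nat>"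
    by (auto simp: pos_root_iff)
  obtain l where l: "l \<in> I" "\<beta> (\<omega> l) \<noteq> 0" using pos_root_nonzero_coeff[OF b(1)] by blast
  obtain m n :: nat where "\<beta> (\<omega> l) = of_nat m" "- \<beta> (\<omega> l) = of_nat n"
    using b(2,3)[OF l(1)] by (elim Nats_cases)
  then have "complex_of_nat (m + n) = 0" by (simp add: add_eq_0_iff)
  then have "m = 0" by (simp only: of_nat_eq_0_iff)
  then show False using l \<open>\<beta> (\<omega> l) = of_nat m\<close> by simp
qed

text \<open>Meaningful where the value at \<open>height_elt\<close> is a natural number, as it is
  for positive roots by \<open>pos_root_height\<close>; elsewhere the value is arbitrary.\<close>

definition ht :: "('g \<Rightarrow> complex) \<Rightarrow> nat" where
  "ht \<beta> = (THE n. \<beta> height_elt = of_nat n)"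

lemma height_elt_of_nat: "f height_elt = of_nat n \<Longrightarrow> ht f = n"
  unfolding ht_def by (metis (mono_tags, lifting) of_nat_eq_iff the_equality)

lemma pos_root_height:
  assumes "\<beta> \<in> \<Delta>p"
  shows "\<beta> height_elt = of_nat (ht \<beta>)" "ht \<beta> > 0"
proof -
  have \<beta>: "\<beta> \<in> \<Delta>" "\<And>l. l \<in> I \<Longrightarrow> \<beta> (\<omega> l) \<in> \<nat>"
    using assms by (auto simp: pos_root_iff)
  then obtain c :: "'i \<Rightarrow> nat" where c: "\<And>l. l \<in> I \<Longrightarrow> \<beta> (\<omega> l) = of_nat (c l)"
    using Nats_choice[of I "\<lambda>l. \<beta> (\<omega> l)"] by blast
  have e: "\<beta> height_elt = of_nat (\<Sum>l\<in>I. c l)"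
    using functional_height_elt[OF root_dual[OF \<beta>(1)]] c by simp
  then show "\<beta> height_elt = of_nat (ht \<beta>)"
    unfolding height_elt_of_nat[of \<beta>, OF e] .
  obtain l where "l \<in> I" "c l \<noteq> 0" using pos_root_nonzero_coeff[OF \<beta>(1)] c by force
  then have "(\<Sum>l\<in>I. c l) \<noteq> 0" using finite_I by auto
  then show "ht \<beta> > 0" using height_elt_of_nat[of \<beta>, OF e] by simp
qed

end

section \<open>Root strings\<close>

context weight_module
begin

lemma sl2_relations:
  assumes "\<beta> \<in> \<Delta>"
  shows "act (x \<beta>) (act (x (- \<beta>)) w) = act (x (- \<beta>)) (act (x \<beta>) w) + act (coroot \<beta>) w"
    and "act (coroot \<beta>) (act (x (- \<beta>)) w) = act (x (- \<beta>)) (act (coroot \<beta>) w) - vscale 2 (act (x (- \<beta>)) w)"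
    and "act (coroot \<beta>) (act (x \<beta>) w) = act (x \<beta>) (act (coroot \<beta>) w) + vscale 2 (act (x \<beta>) w)"
proof -
  have "act (x \<beta>) (act (x (- \<beta>)) w) - act (x (- \<beta>)) (act (x \<beta>) w) = act (coroot \<beta>) w"
    using act_bracket[of "x \<beta>" "x (- \<beta>)" w] bracket_x_minus[OF assms] by simp
  then show "act (x \<beta>) (act (x (- \<beta>)) w) = act (x (- \<beta>)) (act (x \<beta>) w) + act (coroot \<beta>) w"
    by (simp add: diff_eq_eq add.commute)
  have "act (coroot \<beta>) (act (x \<beta>) w) - act (x \<beta>) (act (coroot \<beta>) w) = vscale 2 (act (x \<beta>) w)"
    using act_bracket[of "coroot \<beta>" "x \<beta>" w] bracket_H_x[OF coroot_in_H[OF assms] assms]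
    by (simp add: assms)
  then show "act (coroot \<beta>) (act (x \<beta>) w) = act (x \<beta>) (act (coroot \<beta>) w) + vscale 2 (act (x \<beta>) w)"
    by (simp add: diff_eq_eq add.commute)
  have "act (coroot \<beta>) (act (x (- \<beta>)) w) - act (x (- \<beta>)) (act (coroot \<beta>) w) = - vscale 2 (act (x (- \<beta>)) w)"
    using act_bracket[of "coroot \<beta>" "x (- \<beta>)" w] bracket_H_x[OF coroot_in_H[OF assms] minus_root[OF assms]]
    by (simp add: assms)
  then show "act (coroot \<beta>) (act (x (- \<beta>)) w) = act (x (- \<beta>)) (act (coroot \<beta>) w) - vscale 2 (act (x (- \<beta>)) w)"
    by (simp add: diff_eq_eq)
qed

end

context chevalley
begin

lemma finite_multiples:
  assumes "\<beta> \<noteq> 0"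
  shows "finite {k::nat. \<gamma> + fun_scale (of_nat k) \<beta> \<in> \<Delta>}" "finite {k::nat. \<gamma> - fun_scale (of_nat k) \<beta> \<in> \<Delta>}"
proof -
  obtain z where z: "\<beta> z \<noteq> 0" using assms by (auto simp: fun_eq_iff)
  have "inj (\<lambda>k::nat. \<gamma> + fun_scale (of_nat k) \<beta>)" "inj (\<lambda>k::nat. \<gamma> - fun_scale (of_nat k) \<beta>)"
    using z by (auto intro!: injI simp: fun_eq_iff fun_scale_def dest!: spec[of _ z])
  then show "finite {k::nat. \<gamma> + fun_scale (of_nat k) \<beta> \<in> \<Delta>}" "finite {k::nat. \<gamma> - fun_scale (of_nat k) \<beta> \<in> \<Delta>}"
    using finite_vimageI[OF finite_roots] by (auto simp: vimage_def)
qed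

text \<open>Let m \<ge> 2 be the largest multiple. Then \<open>x (m \<beta>)\<close> is a highest
  weight vector, of weight 2m, for the \<open>sl_2\<close> of \<beta>. Lowered m - 1 times it is a
  multiple of \<open>x \<beta>\<close>, hence killed by \<open>bracket (x \<beta>)\<close>. But
  raising it again gives m + 2 times the vector lowered m - 2 times, which is not zero.\<close>

lemma no_proper_multiple:
  assumes \<beta>: "\<beta> \<in> \<Delta>" and k: "k \<ge> 2"
  shows "fun_scale (of_nat k) \<beta> \<notin> \<Delta>"
proof
  assume kr: "fun_scale (of_nat k) \<beta> \<in> \<Delta>"
  let ?S = "{k::nat. fun_scale (of_nat k) \<beta> \<in> \<Delta>}"
  have fin: "finite ?S"
    using finite_multiples(1)[OF root_nonzero[OF \<beta>], of 0] by simp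
  define m where "m = Max ?S"
  have mr: "fun_scale (of_nat m) \<beta> \<in> \<Delta>"
    using Max_in[OF fin] kr unfolding m_def by blast
  have m2: "m \<ge> 2"
    using Max_ge[OF fin, of k] kr k unfolding m_def by simp
  have "fun_scale (of_nat (Suc m)) \<beta> \<notin> \<Delta>"
    using Max_ge[OF fin, of "Suc m"] unfolding m_def by auto
  moreover have "fun_scale (of_nat m) \<beta> + \<beta> = fun_scale (of_nat (Suc m)) \<beta>"
    by (auto simp: fun_scale_def fun_eq_iff algebra_simps)
  ultimately have notroot: "fun_scale (of_nat m) \<beta> + \<beta> \<notin> \<Delta>" by simp
  let ?y = "x (fun_scale (of_nat m) \<beta>)"
  obtain z where z: "\<beta> z \<noteq> 0" using root_nonzero[OF \<beta>] by (auto simp: fun_eq_iff)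
  have nz: "fun_scale (of_nat m) \<beta> + \<beta> \<noteq> 0"
  proof
    assume "fun_scale (of_nat m) \<beta> + \<beta> = 0"
    from fun_cong[OF this, of z] have "(of_nat (Suc m)) * \<beta> z = 0"
      by (simp add: fun_scale_def algebra_simps)
    then show False using z by (simp del: of_nat_Suc)
  qed
  have fnl: "fun_scale (of_nat m) \<beta> + \<beta> \<in> functionals"
    by (intro dual_add dual_fun_scale root_dual \<beta>)
  have ey: "bracket (x \<beta>) ?y = 0"
    by (rule gs_trivial[OF fnl notroot nz]) (rule ad.act_root_space[OF x_in[OF \<beta>] x_in[OF mr]])
  have hy: "bracket (coroot \<beta>) ?y = scale (2 * of_nat m) ?y"
    using bracket_H_x[OF coroot_in_H[OF \<beta>] mr] by (simp add: fun_scale_def \<beta> mult.commute)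
  let ?D = "\<lambda>n. dpow scale (bracket (x (- \<beta>))) n ?y"
  note sl2 = ad.V.sl2_apply_dpow(1)[OF bracket_linear_right bracket_linear_right adj.sl2_relations(1)[OF \<beta>]
      adj.sl2_relations(2)[OF \<beta>] hy]
  have lower: "bracket (x \<beta>) (?D (Suc n)) = scale (2 * of_nat m - of_nat n) (?D n)" for n
    unfolding sl2 ey by (simp add: ad.V.lin_zero[OF ad.V.lin_dpow[OF bracket_linear_right]])
  have nzc: "2 * complex_of_nat m - of_nat n \<noteq> 0" if "n \<le> m" for n
  proof
    assume "2 * complex_of_nat m - of_nat n = 0"
    then have "complex_of_nat (2 * m) = of_nat n" by simp
    then have "2 * m = n" by (simp only: of_nat_eq_iff)
    then show False using that m2 by simp
  qed
  have desc: "?D n \<noteq> 0" if "n \<le> m" for n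
    using that
  proof (induction n)
    case 0
    then show ?case using x_nonzero[OF mr] by simp
  next
    case (Suc n)
    show ?case
    proof
      assume "?D (Suc n) = 0"
      then have "scale (2 * of_nat m - of_nat n) (?D n) = 0"
        using lower[of n] by simp
      then show False using Suc nzc[of n] by simp
    qed
  qed
  obtain j where j: "m = Suc (Suc j)" using m2 by (metis Suc_le_D numeral_2_eq_2 Suc_le_mono)
  have "?D (Suc j) \<in> gs (fun_scale (of_nat m) \<beta> + fun_scale (of_nat (Suc j)) (- \<beta>))"
    by (rule adj.dpow_act_root_space[OF x_in[OF minus_root[OF \<beta>]] x_in[OF mr]])
  also have "fun_scale (of_nat m) \<beta> + fun_scale (of_nat (Suc j)) (- \<beta>) = \<beta>"
    by (auto simp: j fun_scale_def fun_eq_iff algebra_simps)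
  finally obtain c where "?D (Suc j) = scale c (x \<beta>)"
    using gs_root[OF \<beta>] by blast
  then have "scale (2 * of_nat m - of_nat j) (?D j) = 0"
    using lower[of j] by (simp add: bracket_self)
  then show False using desc[of j] nzc[of j] j by simp
qed

text \<open>For p > k both sides speak of the same functional, with p shifted by k; any p \<le> k is
  below the bound anyway. Finiteness of the root system makes the maximum exist.\<close>

lemma GREATEST_string:
  assumes "\<beta> \<in> \<Delta>" "\<gamma> \<in> \<Delta>"
  shows "(GREATEST p::nat. (\<gamma> + fun_scale (of_nat k) \<beta>) - fun_scale (of_nat p) \<beta> \<in> \<Delta>) =
    (GREATEST p::nat. \<gamma> - fun_scale (of_nat p) \<beta> \<in> \<Delta>) + k"
proof -
  let ?P = "\<lambda>p::nat. \<gamma> - fun_scale (of_nat p) \<beta> \<in> \<Delta>"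
  have fin: "finite {p. ?P p}" by (rule finite_multiples(2)[OF root_nonzero[OF assms(1)]])
  have bd: "\<forall>p. ?P p \<longrightarrow> p \<le> Max {p. ?P p}"
    using Max_ge[OF fin] by blast
  have "\<gamma> - fun_scale (of_nat 0) \<beta> = \<gamma>" by (simp add: fun_scale_def fun_eq_iff)
  then have P0: "?P 0" using assms(2) by simp
  have G: "?P (Greatest ?P)" by (rule GreatestI_nat[of ?P, OF P0]) (use bd in blast)
  have Gle: "p \<le> Greatest ?P" if "?P p" for p
    by (rule Greatest_le_nat[of ?P, OF that]) (use bd in blast)
  show ?thesis
  proof (rule Greatest_equality)
    have "(\<gamma> + fun_scale (of_nat k) \<beta>) - fun_scale (of_nat (Greatest ?P + k)) \<beta> = \<gamma> - fun_scale (of_nat (Greatest ?P)) \<beta>"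
      by (auto simp: fun_scale_def fun_eq_iff algebra_simps)
    then show "(\<gamma> + fun_scale (of_nat k) \<beta>) - fun_scale (of_nat (Greatest ?P + k)) \<beta> \<in> \<Delta>"
      using G by (simp only:)
    fix p assume p: "(\<gamma> + fun_scale (of_nat k) \<beta>) - fun_scale (of_nat p) \<beta> \<in> \<Delta>"
    show "p \<le> Greatest ?P + k"
    proof (cases "p \<le> k")
      case False
      then have "(\<gamma> + fun_scale (of_nat k) \<beta>) - fun_scale (of_nat p) \<beta> = \<gamma> - fun_scale (of_nat (p - k)) \<beta>"
        by (auto simp: fun_scale_def fun_eq_iff algebra_simps of_nat_diff)
      then have "p - k \<le> Greatest ?P" using p by (intro Gle) (simp only:)
      then show ?thesis by simp
    qed simp
  qed
qed

text \<open>The structure constants \<open>\<plusminus>(p + 1)\<close> along a string multiply up to factorials times binomial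
  coefficients.\<close>

lemma root_string:
  assumes \<beta>: "\<beta> \<in> \<Delta>" and \<gamma>: "\<gamma> \<in> \<Delta>" and nz: "\<And>k::nat. \<gamma> + fun_scale (of_nat k) \<beta> \<noteq> 0"
  defines "D \<equiv> \<lambda>k. dpow scale (bracket (x \<beta>)) k (x \<gamma>)"
    and "g \<equiv> \<lambda>k::nat. \<gamma> + fun_scale (of_nat k) \<beta>"
    and "p \<equiv> (GREATEST p::nat. \<gamma> - fun_scale (of_nat p) \<beta> \<in> \<Delta>)"
  shows "D k = 0 \<or> (g k \<in> \<Delta> \<and> (\<exists>s\<in>{1,-1}. D k = scale (s * of_nat ((p + k) choose k)) (x (g k))))"
proof (induction k)
  case 0
  have "g 0 = \<gamma>" by (simp add: g_def fun_scale_def fun_eq_iff)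
  then show ?case using \<gamma> by (auto simp: D_def)
next
  case (Suc k)
  have DS: "D (Suc k) = scale (1 / of_nat (Suc k)) (bracket (x \<beta>) (D k))"
    unfolding D_def by (rule ad.V.dpow_Suc[OF bracket_linear_right])
  have gS: "g (Suc k) = g k + \<beta>" "\<beta> + g k = g (Suc k)"
    by (auto simp: g_def fun_scale_def fun_eq_iff algebra_simps)
  consider "D k = 0" | s where "g k \<in> \<Delta>" "s \<in> {1,-1}" "D k = scale (s * of_nat ((p + k) choose k)) (x (g k))"
    using Suc.IH by blast
  then show ?case
  proof cases
    case 1
    then show ?thesis using DS by simp
  next
    case 2
    show ?thesis
    proof (cases "g (Suc k) \<in> \<Delta>")
      case False
      have "bracket (x \<beta>) (x (g k)) = 0"
      proof (rule gs_trivial)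
        show "bracket (x \<beta>) (x (g k)) \<in> gs (g (Suc k))"
          unfolding gS(1) by (rule ad.act_root_space[OF x_in[OF \<beta>] x_in[OF 2(1)]])
        show "g (Suc k) \<in> functionals"
          unfolding gS(1) by (intro dual_add root_dual \<beta> 2(1))
        show "g (Suc k) \<noteq> 0" unfolding g_def by (rule nz)
      qed (rule False)
      then show ?thesis using DS 2(3) by simp
    next
      case True
      have "\<forall>\<beta>\<in>\<Delta>. \<forall>\<gamma>\<in>\<Delta>. \<beta> + \<gamma> \<in> \<Delta> \<longrightarrow>
         (let p = (GREATEST p::nat. \<gamma> - fun_scale (of_nat p) \<beta> \<in> \<Delta>)
          in bracket (x \<beta>) (x \<gamma>) = scale (of_nat (p + 1)) (x (\<beta> + \<gamma>)) \<or>
             bracket (x \<beta>) (x \<gamma>) = scale (- of_nat (p + 1)) (x (\<beta> + \<gamma>)))"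
        using chevalley_basis unfolding chevalley_basis_def Let_def by (elim conjE) assumption
      from this[rule_format, OF \<beta> 2(1)] True gS
      have "bracket (x \<beta>) (x (g k)) = scale (of_nat ((GREATEST p::nat. g k - fun_scale (of_nat p) \<beta> \<in> \<Delta>) + 1)) (x (g (Suc k))) \<or>
         bracket (x \<beta>) (x (g k)) = scale (- of_nat ((GREATEST p::nat. g k - fun_scale (of_nat p) \<beta> \<in> \<Delta>) + 1)) (x (g (Suc k)))"
        by (simp only: Let_def)
      moreover have "(GREATEST p::nat. g k - fun_scale (of_nat p) \<beta> \<in> \<Delta>) = p + k"
        unfolding g_def p_def by (rule GREATEST_string[OF \<beta> \<gamma>])
      ultimately obtain t :: complex where t: "t \<in> {1,-1}" "bracket (x \<beta>) (x (g k)) = scale (t * of_nat (p + k + 1)) (x (g (Suc k)))"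
        by (metis insertCI mult_1 mult_minus1)
      have "Suc k * ((p + Suc k) choose Suc k) = (p + k + 1) * ((p + k) choose k)"
        using Suc_times_binomial_eq[of "p + k" k] by (simp only: add_Suc_right Suc_eq_plus1[symmetric] mult.commute)
      then have "of_nat (Suc k) * complex_of_nat ((p + Suc k) choose Suc k) = of_nat (p + k + 1) * of_nat ((p + k) choose k)"
        unfolding of_nat_mult[symmetric] by (simp only:)
      then have e: "complex_of_nat ((p + k) choose k) * of_nat (p + k + 1) / of_nat (Suc k) = of_nat ((p + Suc k) choose Suc k)"
        by (simp add: field_simps del: of_nat_Suc of_nat_add binomial_Suc_Suc)
      have "D (Suc k) = scale ((1 / of_nat (Suc k)) * (s * of_nat ((p + k) choose k) * (t * of_nat (p + k + 1)))) (x (g (Suc k)))"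
        by (simp add: DS 2(3) t(2))
      also have "(1 / of_nat (Suc k)) * (s * of_nat ((p + k) choose k) * (t * of_nat (p + k + 1))) =
          s * t * (complex_of_nat ((p + k) choose k) * of_nat (p + k + 1) / of_nat (Suc k))"
        by simp
      finally have "D (Suc k) = scale (s * t * of_nat ((p + Suc k) choose Suc k)) (x (g (Suc k)))"
        by (simp only: e)
      moreover have "s * t \<in> {1, -1}" using t(1) 2(2) by auto
      ultimately show ?thesis using True by blast
    qed
  qed
qed

text \<open>Integrality of the binomial coefficients in \<open>root_string\<close> makes the
  exponential an integer combination of root vectors when u is 1 or -1. The set \<open>A\<close>
  records which roots the string can meet.\<close>

lemma root_string_closure:
  assumes \<beta>: "\<beta> \<in> \<Delta>" and \<gamma>: "\<gamma> \<in> \<Delta>" and nz: "\<And>k::nat. \<gamma> + fun_scale (of_nat k) \<beta> \<noteq> 0"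
    and A: "\<And>k::nat. \<gamma> + fun_scale (of_nat k) \<beta> \<in> \<Delta> \<Longrightarrow> \<gamma> + fun_scale (of_nat k) \<beta> \<in> A"
    and u: "u \<in> {1, -1}"
  shows "exp_nilpotent scale (bracket (x \<beta>)) u (x \<gamma>) \<in> group_closure (x ` A)"
proof -
  have mult: "scale (of_nat n) y \<in> group_closure (x ` A)" if "y \<in> group_closure (x ` A)" for n y
    by (induction n) (use that in \<open>simp_all add: scale_left_distrib group_closure_add\<close>)
  have D: "dpow scale (bracket (x \<beta>)) k (x \<gamma>) \<in> group_closure (x ` A)" for k
  proof -
    let ?g = "\<gamma> + fun_scale (of_nat k) \<beta>"
    have "\<exists>n::nat. dpow scale (bracket (x \<beta>)) k (x \<gamma>) = 0 \<or> (?g \<in> \<Delta> \<and>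
      (dpow scale (bracket (x \<beta>)) k (x \<gamma>) = scale (of_nat n) (x ?g) \<or>
       dpow scale (bracket (x \<beta>)) k (x \<gamma>) = scale (- of_nat n) (x ?g)))"
      using root_string[OF \<beta> \<gamma> nz, of k] by auto
    then obtain n :: nat where n: "dpow scale (bracket (x \<beta>)) k (x \<gamma>) = 0 \<or> (?g \<in> \<Delta> \<and>
      (dpow scale (bracket (x \<beta>)) k (x \<gamma>) = scale (of_nat n) (x ?g) \<or>
       dpow scale (bracket (x \<beta>)) k (x \<gamma>) = scale (- of_nat n) (x ?g)))"
      by blast
    have "x ?g \<in> group_closure (x ` A)" if "?g \<in> \<Delta>"
      using A[OF that] by (intro group_closure.base) simp
    then show ?thesis using n mult[of "x ?g" n] by auto
  qed
  obtain N where N: "\<forall>n\<ge>N. \<forall>\<beta>\<in>\<Delta>. \<forall>z. (bracket (x \<beta>) ^^ n) z = 0"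
    using adj_act_nilpotent by blast
  have "exp_nilpotent scale (bracket (x \<beta>)) u (x \<gamma>) = (\<Sum>n<N. scale (u ^ n) (dpow scale (bracket (x \<beta>)) n (x \<gamma>)))"
    by (rule ad.V.exp_nilpotent_finite[OF bracket_linear_right]) (use N \<beta> in simp)
  moreover have "scale (u ^ n) (dpow scale (bracket (x \<beta>)) n (x \<gamma>)) \<in> group_closure (x ` A)" for n
  proof -
    have "u ^ n = 1 \<or> u ^ n = -1" using u by (cases "even n") auto
    then show ?thesis using D[of n] by auto
  qed
  moreover have "(\<Sum>n<M. t n) \<in> group_closure S" if "\<And>n. t n \<in> group_closure S" for t :: "nat \<Rightarrow> 'g" and M S
    by (induction M) (auto intro: group_closure_add that)
  ultimately show ?thesis by simp
qed

end

section \<open>Simple reflections\<close>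

context weight_module
begin

text \<open>The group element \<chi> of \<beta> at a complex parameter; \<open>root_elt_eq\<close>
  identifies it with \<open>root_elt\<close> at rational ones.\<close>

definition texp :: "('g \<Rightarrow> complex) \<Rightarrow> complex \<Rightarrow> 'v \<Rightarrow> 'v" where
  "texp \<beta> u = exp_nilpotent vscale (act (x \<beta>)) u"

text \<open>\<open>exp_act\<close> wants one exponent that serves for the module and for the adjoint
  module.\<close>

lemma nilpotent_bound: "\<exists>N. \<forall>\<beta>\<in>\<Delta>. (\<forall>w. (act (x \<beta>) ^^ N) w = 0) \<and> (\<forall>z. (bracket (x \<beta>) ^^ N) z = 0)"
proof -
  obtain M where M: "\<forall>n\<ge>M. \<forall>\<beta>\<in>\<Delta>. \<forall>z. (bracket (x \<beta>) ^^ n) z = 0"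
    using adj_act_nilpotent by blast
  have "(act (x \<beta>) ^^ max M (card W)) w = 0" if "\<beta> \<in> \<Delta>" for \<beta> w
    by (rule act_root_nilpotent[OF x_in root_dual root_nonzero]) (use that in simp_all)
  then show ?thesis
    using M by (intro exI[of _ "max M (card W)"]) simp
qed

lemma lin_texp: "\<beta> \<in> \<Delta> \<Longrightarrow> V.lin (texp \<beta> u)"
  using nilpotent_bound V.lin_exp[OF act_linear_right] unfolding texp_def by blast

lemma texp_add: "\<beta> \<in> \<Delta> \<Longrightarrow> texp \<beta> u (texp \<beta> t w) = texp \<beta> (u + t) w"
  using nilpotent_bound V.exp_nilpotent_add[OF act_linear_right] unfolding texp_def by blast

lemma texp_0: "\<beta> \<in> \<Delta> \<Longrightarrow> texp \<beta> 0 w = w"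
  using nilpotent_bound V.exp_nilpotent_0[OF act_linear_right] unfolding texp_def by blast

lemma texp_act: "\<beta> \<in> \<Delta> \<Longrightarrow> texp \<beta> u (act z w) = act (exp_nilpotent scale (bracket (x \<beta>)) u z) (texp \<beta> u w)"
  using nilpotent_bound exp_act unfolding texp_def by blast

lemma texp_sum:
  assumes "\<beta> \<in> \<Delta>"
  obtains N where "\<And>u w. texp \<beta> u w = (\<Sum>n<N. vscale (u ^ n) (xdp \<beta> n w))"
  using nilpotent_bound V.exp_nilpotent_eq_sum[OF act_linear_right] assms unfolding texp_def by blast

text \<open>For u = 1 the standard lift of a reflection to the group. Negating u gives the inverse,
  so u = 1 and u = -1 are treated together.\<close>

definition refl :: "('g \<Rightarrow> complex) \<Rightarrow> complex \<Rightarrow> 'v \<Rightarrow> 'v" where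
  "refl \<beta> u w = texp \<beta> u (texp (- \<beta>) (- u) (texp \<beta> u w))"

end

context chevalley
begin

lemma adj_texp_eq: "adj.texp \<beta> u = exp_nilpotent scale (bracket (x \<beta>)) u"
  by (simp add: adj.texp_def)

end

context weight_module
begin

lemma lin_refl: "\<beta> \<in> \<Delta> \<Longrightarrow> V.lin (refl \<beta> u)"
  unfolding refl_def by (rule V.linI) (simp_all add: V.lin_simps[OF lin_texp] minus_root)

lemma refl_inverse: "\<beta> \<in> \<Delta> \<Longrightarrow> refl \<beta> u (refl \<beta> (- u) w) = w"
  by (simp add: refl_def texp_add texp_0 minus_root)

lemma refl_act: "\<beta> \<in> \<Delta> \<Longrightarrow> refl \<beta> u (act z w) = act (adj.refl \<beta> u z) (refl \<beta> u w)"
  by (simp add: refl_def adj.refl_def texp_act minus_root adj_texp_eq)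

end

section \<open>Reflections on the Cartan subalgebra and on root vectors\<close>

context chevalley
begin

lemma exp_x_H:
  assumes "z \<in> H" "\<beta> \<in> \<Delta>"
  shows "adj.texp \<beta> u z = z - scale (u * \<beta> z) (x \<beta>)"
proof -
  have "adj.texp \<beta> u z = (\<Sum>n<2. scale (u ^ n) (dpow scale (bracket (x \<beta>)) n z))"
    unfolding adj_texp_eq
    by (rule ad.V.exp_nilpotent_finite[OF bracket_linear_right])
      (use assms in \<open>simp add: numeral_2_eq_2 bracket_x_H bracket_self\<close>)
  also have "\<dots> = z - scale (u * \<beta> z) (x \<beta>)"
    using assms by (simp add: numeral_2_eq_2 bracket_x_H)
  finally show ?thesis .
qed

lemma exp_x_x: "\<beta> \<in> \<Delta> \<Longrightarrow> adj.texp \<beta> u (x \<beta>) = x \<beta>"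
  unfolding adj_texp_eq
  by (subst ad.V.exp_nilpotent_finite[OF bracket_linear_right, where K = 1]) (simp_all add: bracket_self)

lemma exp_x_minus:
  assumes "\<beta> \<in> \<Delta>"
  shows "adj.texp (- \<beta>) u (x \<beta>) = x \<beta> - scale u (coroot \<beta>) - scale (u\<^sup>2) (x (- \<beta>))"
proof -
  let ?D = "dpow scale (bracket (x (- \<beta>)))"
  have 1: "bracket (x (- \<beta>)) (x \<beta>) = - coroot \<beta>"
    using bracket_antisym[of "x (- \<beta>)" "x \<beta>"] bracket_x_minus[OF assms] by simp
  have 2: "bracket (x (- \<beta>)) (coroot \<beta>) = scale 2 (x (- \<beta>))"
    using bracket_x_H[OF coroot_in_H[OF assms] minus_root[OF assms]] assms by simp
  have "adj.texp (- \<beta>) u (x \<beta>) = (\<Sum>n<3. scale (u ^ n) (?D n (x \<beta>)))"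
    unfolding adj_texp_eq
    by (rule ad.V.exp_nilpotent_finite[OF bracket_linear_right])
      (simp add: numeral_3_eq_3 1 2 bracket_self)
  also have "\<dots> = x \<beta> - scale u (coroot \<beta>) - scale (u\<^sup>2) (x (- \<beta>))"
    by (simp add: numeral_3_eq_3 dpow_def 1 2 power2_eq_square)
  finally show ?thesis .
qed

text \<open>A computation with three exponentials in the span of z, the coroot,
  \<open>x \<beta>\<close> and \<open>x (- \<beta>)\<close>; since u^2 = 1 the multiples of both
  root vectors cancel.\<close>

lemma refl_H:
  assumes z: "z \<in> H" and \<beta>: "\<beta> \<in> \<Delta>" and u: "u\<^sup>2 = 1"
  shows "adj.refl \<beta> u z = z - scale (\<beta> z) (coroot \<beta>)"
proof -
  have uu: "u * u = 1" "u * (u * t) = t" for t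
    using u by (simp_all add: power2_eq_square flip: mult.assoc)
  note E = ad.V.lin_simps[OF adj.lin_texp]
  have "adj.texp \<beta> u z = z - scale (u * \<beta> z) (x \<beta>)"
    by (rule exp_x_H[OF z \<beta>])
  moreover have "adj.texp (- \<beta>) (- u) (z - scale (u * \<beta> z) (x \<beta>)) =
      z - scale (u * \<beta> z) (x (- \<beta>)) - scale (u * \<beta> z) (x \<beta> + scale u (coroot \<beta>) - x (- \<beta>))"
    using z \<beta> u by (simp add: E minus_root exp_x_H exp_x_minus)
  moreover have "\<dots> = z - scale (u * \<beta> z) (x \<beta>) - scale (\<beta> z) (coroot \<beta>)"
    by (simp add: scale_right_distrib scale_right_diff_distrib uu mult.assoc mult.commute[of "\<beta> z"] algebra_simps)
  moreover have "adj.texp \<beta> u (z - scale (u * \<beta> z) (x \<beta>) - scale (\<beta> z) (coroot \<beta>)) =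
     z - scale (\<beta> z) (coroot \<beta>)"
  proof -
    have "\<beta> z * (u * 2) = u * \<beta> z + u * \<beta> z" by (simp add: algebra_simps)
    then have "scale (\<beta> z * (u * 2)) (x \<beta>) = scale (u * \<beta> z) (x \<beta>) + scale (u * \<beta> z) (x \<beta>)"
      by (simp only: scale_left_distrib)
    then show ?thesis
      using z \<beta> coroot_in_H[OF \<beta>] by (simp add: E exp_x_H exp_x_x scale_right_diff_distrib)
  qed
  ultimately show ?thesis
    by (simp add: adj.refl_def)
qed

abbreviation sref :: "'i \<Rightarrow> ('g \<Rightarrow> complex) \<Rightarrow> 'g \<Rightarrow> complex" where
  "sref i \<beta> \<equiv> \<beta> - fun_scale (\<beta> (h i)) (\<alpha> i)"

lemma sref_functional: "i \<in> I \<Longrightarrow> \<beta> \<in> functionals \<Longrightarrow> sref i \<beta> \<in> functionals"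
  using dual_diff[OF _ dual_fun_scale[OF root_dual[OF simple_root]]] .

lemma alpha_h [simp]: "i \<in> I \<Longrightarrow> \<alpha> i (h i) = 2"
  by (simp add: simple_root)

lemma sref_sref: "i \<in> I \<Longrightarrow> sref i (sref i \<beta>) = \<beta>"
  by (auto simp: fun_scale_def fun_eq_iff algebra_simps)

text \<open>Let \<open>?z\<close> be the reflection of z in \<open>H\<close>, which
  \<open>adj.refl\<close> carries back to z. Conjugating the eigenvalue equation for
  \<open>?z\<close> gives one for z, with eigenvalue \<beta>(\<open>?z\<close>), the value of
  \<open>sref i \<beta>\<close> at z.\<close>

lemma refl_gs:
  assumes i: "i \<in> I" and \<beta>: "\<beta> \<in> functionals" and y: "y \<in> gs \<beta>" and u: "u\<^sup>2 = 1"
  shows "adj.refl (\<alpha> i) u y \<in> gs (sref i \<beta>)"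
  unfolding weight_space_def
proof safe
  fix z assume z: "z \<in> H"
  let ?z = "z - scale (\<alpha> i z) (h i)"
  have hs: "scale c (h i) \<in> H" for c using H_subspace h_in_H[OF i] by (rule subspace_scale)
  have zH: "?z \<in> H"
    using H_subspace z hs by (intro subspace_diff)
  have fd: "f ?z = f z - \<alpha> i z * f (h i)" if "f \<in> functionals" for f
  proof -
    have "?z = z + scale (- \<alpha> i z) (h i)" by simp
    then show ?thesis
      by (simp only: functional_add[OF that z hs] functional_scale[OF that h_in_H[OF i]]) simp
  qed
  have "\<alpha> i ?z = - \<alpha> i z"
    using fd[of "\<alpha> i"] i by (simp add: root_dual simple_root)
  then have rz: "adj.refl (\<alpha> i) u ?z = z"
    using refl_H[OF zH simple_root[OF i] u] by simp
  have "bracket z (adj.refl (\<alpha> i) u y) = adj.refl (\<alpha> i) u (bracket ?z y)"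
    using adj.refl_act[OF simple_root[OF i], of u ?z y] rz by simp
  also have "bracket ?z y = scale (\<beta> ?z) y"
    by (rule adj.wspD[OF y zH])
  also have "adj.refl (\<alpha> i) u (scale (\<beta> ?z) y) = scale (\<beta> ?z) (adj.refl (\<alpha> i) u y)"
    by (rule ad.V.lin_scale[OF adj.lin_refl[OF simple_root[OF i]]])
  also have "\<beta> ?z = sref i \<beta> z"
    using fd[OF \<beta>] by (simp add: fun_scale_def mult.commute)
  finally show "bracket z (adj.refl (\<alpha> i) u y) = scale (sref i \<beta> z) (adj.refl (\<alpha> i) u y)" .
qed

text \<open>Evaluation at \<open>\<omega> i\<close> shows that, up to sign, the factor is a natural
  number; it is not 0, and \<open>no_proper_multiple\<close> excludes 2 and more.\<close>

lemma multiple_of_simple: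
  assumes i: "i \<in> I" and \<beta>: "\<beta> \<in> \<Delta>" and m: "\<beta> = fun_scale c (\<alpha> i)"
  shows "\<beta> = \<alpha> i \<or> \<beta> = - \<alpha> i"
proof -
  have pos: "\<beta> = \<alpha> i" if \<beta>: "\<beta> \<in> \<Delta>p" and m: "\<beta> = fun_scale c (\<alpha> i)" for \<beta> c
  proof -
    have "\<beta> (\<omega> i) \<in> \<nat>" "\<beta> (\<omega> i) = c"
      using \<beta> i m by (auto simp: pos_root_iff fun_scale_def alpha_coweight)
    then obtain n :: nat where n: "c = of_nat n" by (auto elim: Nats_cases)
    have "n \<noteq> 0"
    proof
      assume "n = 0"
      then have "\<beta> = 0" by (simp add: m n fun_scale_def fun_eq_iff)
      then show False using root_nonzero pos_root[OF \<beta>] by blast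
    qed
    moreover have "\<not> n \<ge> 2"
      using no_proper_multiple[OF simple_root[OF i], of n] pos_root[OF \<beta>] m n by auto
    ultimately have "n = 1" by simp
    then show ?thesis by (simp add: m n fun_scale_def)
  qed
  show ?thesis
    using root_cases[OF \<beta>]
  proof
    assume "- \<beta> \<in> \<Delta>p"
    moreover have "- \<beta> = fun_scale (- c) (\<alpha> i)" by (simp add: m fun_scale_def fun_eq_iff)
    ultimately have "- \<beta> = \<alpha> i" by (rule pos)
    then have "\<beta> = - \<alpha> i" by (metis minus_minus)
    then show ?thesis ..
  qed (use pos[OF _ m] in blast)
qed

text \<open>A string in direction \<open>\<alpha> i\<close> or \<open>- \<alpha> i\<close> that
  starts at any other root \<gamma> avoids 0, \<open>\<alpha> i\<close> and
  \<open>- \<alpha> i\<close>: otherwise \<gamma> would be a multiple of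
  \<open>\<alpha> i\<close>.\<close>

lemma group_closure_exp:
  assumes i: "i \<in> I" and y: "y \<in> group_closure (x ` (\<Delta> - {\<alpha> i, - \<alpha> i}))"
    and b: "b = \<alpha> i \<or> b = - \<alpha> i" and u: "u \<in> {1, -1}"
  shows "adj.texp b u y \<in> group_closure (x ` (\<Delta> - {\<alpha> i, - \<alpha> i}))"
proof -
  have bR: "b \<in> \<Delta>" using b i simple_root minus_root by blast
  show ?thesis using y
  proof (induction rule: group_closure.induct)
    case (base s)
    show ?case
    proof (cases "s = 0")
      case True
      then show ?thesis by (simp add: ad.V.lin_zero[OF adj.lin_texp[OF bR]])
    next
      case False
      then obtain \<gamma> where \<gamma>: "\<gamma> \<in> \<Delta>" "\<gamma> \<noteq> \<alpha> i" "\<gamma> \<noteq> - \<alpha> i" "s = x \<gamma>" using base by blast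
      have mult: "\<gamma> = fun_scale c (\<alpha> i) \<Longrightarrow> False" for c
        using multiple_of_simple[OF i \<gamma>(1)] \<gamma> by blast
      have mult': "\<exists>c. \<gamma> = fun_scale c (\<alpha> i)" if eq: "\<gamma> + fun_scale (of_nat k) b = fun_scale d (\<alpha> i)" for k d
      proof -
        have "\<gamma> z = d * \<alpha> i z - of_nat k * b z" for z
          using fun_cong[OF eq, of z] by (simp add: fun_scale_def algebra_simps)
        then have "\<gamma> = fun_scale (if b = \<alpha> i then d - of_nat k else d + of_nat k) (\<alpha> i)"
          using b by (auto simp: fun_scale_def fun_eq_iff algebra_simps)
        then show ?thesis by blast
      qed
      show ?thesis
        unfolding \<gamma>(4) adj_texp_eq
      proof (rule root_string_closure[OF bR \<gamma>(1) _ _ u])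
        fix k :: nat
        show "\<gamma> + fun_scale (of_nat k) b \<noteq> 0"
        proof
          assume "\<gamma> + fun_scale (of_nat k) b = 0"
          then have "\<gamma> + fun_scale (of_nat k) b = fun_scale 0 (\<alpha> i)" by (simp add: fun_scale_def fun_eq_iff)
          then show False using mult mult' by blast
        qed
        have "\<gamma> + fun_scale (of_nat k) b \<noteq> \<alpha> i"
        proof
          assume "\<gamma> + fun_scale (of_nat k) b = \<alpha> i"
          then have "\<gamma> + fun_scale (of_nat k) b = fun_scale 1 (\<alpha> i)" by (simp add: fun_scale_def)
          then show False using mult mult' by blast
        qed
        moreover have "\<gamma> + fun_scale (of_nat k) b \<noteq> - \<alpha> i"
        proof
          assume "\<gamma> + fun_scale (of_nat k) b = - \<alpha> i"
          then have "\<gamma> + fun_scale (of_nat k) b = fun_scale (-1) (\<alpha> i)" by (simp add: fun_scale_def fun_eq_iff)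
          then show False using mult mult' by blast
        qed
        ultimately show "\<gamma> + fun_scale (of_nat k) b \<in> \<Delta> - {\<alpha> i, - \<alpha> i}"
          if "\<gamma> + fun_scale (of_nat k) b \<in> \<Delta>"
          using that by blast
      qed
    qed
  next
    case (diff s t)
    then show ?case by (simp add: ad.V.lin_diff[OF adj.lin_texp[OF bR]] group_closure.diff)
  qed
qed

lemma wcomp_group_closure:
  assumes "A \<subseteq> \<Delta>" "y \<in> group_closure (x ` A)" "\<beta> \<in> \<Delta>"
  shows "\<exists>n::int. adj.wcomp \<beta> y = scale (of_int n) (x \<beta>)"
  using assms(2)
proof (induction rule: group_closure.induct)
  case (base s)
  show ?case
  proof (cases "s = 0")
    case True
    then show ?thesis
      by (intro exI[of _ 0]) (simp add: adj.wcomp_simps root_dual[OF assms(3)])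
  next
    case False
    then obtain \<gamma> where \<gamma>: "\<gamma> \<in> \<Delta>" "s = x \<gamma>" using base assms(1) by blast
    then show ?thesis
      by (intro exI[of _ "if \<beta> = \<gamma> then 1 else 0"]) (simp add: adj_wcomp_x root_dual[OF assms(3)])
  qed
next
  case (diff s t)
  then obtain m n where "adj.wcomp \<beta> s = scale (of_int m) (x \<beta>)" "adj.wcomp \<beta> t = scale (of_int n) (x \<beta>)"
    by blast
  then show ?case
    by (intro exI[of _ "m - n"]) (simp add: adj.wcomp_simps root_dual[OF assms(3)] scale_left_diff_distrib)
qed

text \<open>The image lies in the line of the reflected root by \<open>refl_gs\<close> and in the
  integer span of the root vectors by \<open>group_closure_exp\<close>. It is not zero, so the
  reflected functional is a root.\<close>

lemma refl_x_integral:
  assumes i: "i \<in> I" and \<beta>: "\<beta> \<in> \<Delta>" "\<beta> \<noteq> \<alpha> i" "\<beta> \<noteq> - \<alpha> i" and u: "u \<in> {1,-1}"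
  shows "sref i \<beta> \<in> \<Delta>" "\<exists>n::int. adj.refl (\<alpha> i) u (x \<beta>) = scale (of_int n) (x (sref i \<beta>))"
proof -
  let ?A = "\<Delta> - {\<alpha> i, - \<alpha> i}"
  let ?y = "adj.refl (\<alpha> i) u (x \<beta>)"
  have u2: "u\<^sup>2 = 1" and u': "- u \<in> {1,-1}" using u by auto
  have in_gs: "?y \<in> gs (sref i \<beta>)"
    by (rule refl_gs[OF i root_dual[OF \<beta>(1)] x_in[OF \<beta>(1)] u2])
  have "x \<beta> = adj.refl (\<alpha> i) (- u) ?y"
    using adj.refl_inverse[OF simple_root[OF i], of "- u" "x \<beta>"] by simp
  then have nz: "?y \<noteq> 0"
    using x_nonzero[OF \<beta>(1)] ad.V.lin_zero[OF adj.lin_refl[OF simple_root[OF i]]] by metis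
  have "sref i \<beta> \<noteq> 0"
  proof
    assume "sref i \<beta> = 0"
    then have "\<beta> = fun_scale (\<beta> (h i)) (\<alpha> i)" by simp
    from multiple_of_simple[OF i \<beta>(1) this] \<beta> show False by blast
  qed
  then show s: "sref i \<beta> \<in> \<Delta>"
    using gs_trivial[OF sref_functional[OF i root_dual[OF \<beta>(1)]] _ _ in_gs] nz by blast
  have "x \<beta> \<in> group_closure (x ` ?A)"
    using \<beta> by (intro group_closure.base) blast
  then have cl: "?y \<in> group_closure (x ` ?A)"
    unfolding adj.refl_def by (intro group_closure_exp[OF i]) (use u u' in auto)
  have "adj.wcomp (sref i \<beta>) ?y = ?y"
    using adj.wcomp_weight_vector[OF in_gs root_dual[OF s] root_dual[OF s]] by simp
  with wcomp_group_closure[OF _ cl s]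
  show "\<exists>n::int. ?y = scale (of_int n) (x (sref i \<beta>))" by auto
qed

text \<open>\<open>refl_x_integral\<close> for u = 1 at \<beta> and for u = -1 at the reflected root
  gives integers m and n; the two maps are inverse to each other, so mn = 1.\<close>

lemma refl_x:
  assumes i: "i \<in> I" and \<beta>: "\<beta> \<in> \<Delta>" "\<beta> \<noteq> \<alpha> i" "\<beta> \<noteq> - \<alpha> i"
  shows "\<exists>s\<in>{1,-1}. adj.refl (\<alpha> i) 1 (x \<beta>) = scale s (x (sref i \<beta>))"
proof -
  let ?s = "sref i \<beta>"
  have s: "?s \<in> \<Delta>" by (rule refl_x_integral(1)[OF i \<beta>, of 1]) simp
  have s2: "?s \<noteq> \<alpha> i" "?s \<noteq> - \<alpha> i"
  proof -
    have "\<beta> = fun_scale (\<beta> (h i) + 1) (\<alpha> i)" if "?s = \<alpha> i"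
    proof
      show "\<beta> z = fun_scale (\<beta> (h i) + 1) (\<alpha> i) z" for z
        using fun_cong[OF that, of z] by (simp add: fun_scale_def algebra_simps)
    qed
    then show "?s \<noteq> \<alpha> i" using multiple_of_simple[OF i \<beta>(1)] \<beta> by blast
    have "\<beta> = fun_scale (\<beta> (h i) - 1) (\<alpha> i)" if "?s = - \<alpha> i"
    proof
      show "\<beta> z = fun_scale (\<beta> (h i) - 1) (\<alpha> i) z" for z
        using fun_cong[OF that, of z] by (simp add: fun_scale_def algebra_simps)
    qed
    then show "?s \<noteq> - \<alpha> i" using multiple_of_simple[OF i \<beta>(1)] \<beta> by blast
  qed
  obtain m :: int where m: "adj.refl (\<alpha> i) 1 (x \<beta>) = scale (of_int m) (x ?s)"
    using refl_x_integral(2)[OF i \<beta>, of 1] by auto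
  obtain n :: int where n: "adj.refl (\<alpha> i) (- 1) (x ?s) = scale (of_int n) (x \<beta>)"
    using refl_x_integral(2)[OF i s s2, of "-1"] unfolding sref_sref[OF i] by auto
  have "x \<beta> = adj.refl (\<alpha> i) (- 1) (adj.refl (\<alpha> i) 1 (x \<beta>))"
    using adj.refl_inverse[OF simple_root[OF i], of "- 1" "x \<beta>"] by simp
  also have "\<dots> = scale (of_int (m * n)) (x \<beta>)"
    by (simp add: m n ad.V.lin_scale[OF adj.lin_refl[OF simple_root[OF i]]])
  finally have "scale (of_int (m * n) - 1) (x \<beta>) = 0"
    by (simp add: scale_left_diff_distrib)
  then have "complex_of_int (m * n) = 1"
    using x_nonzero[OF \<beta>(1)] by simp
  then have "m * n = 1" by (simp only: of_int_eq_1_iff)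
  then have "m = 1 \<or> m = -1"
    using zmult_eq_1_iff by blast
  then show ?thesis using m by auto
qed

section \<open>Cartan integers and induction over positive roots\<close>

lemma sref_root: "i \<in> I \<Longrightarrow> \<beta> \<in> \<Delta> \<Longrightarrow> sref i \<beta> \<in> \<Delta>"
proof -
  assume i: "i \<in> I" and \<beta>: "\<beta> \<in> \<Delta>"
  consider "\<beta> = \<alpha> i" | "\<beta> = - \<alpha> i" | "\<beta> \<noteq> \<alpha> i" "\<beta> \<noteq> - \<alpha> i" by blast
  then show ?thesis
  proof cases
    case 1
    have "sref i \<beta> = - \<alpha> i" using i by (auto simp: 1 fun_scale_def fun_eq_iff)
    then show ?thesis using minus_root[OF simple_root[OF i]] by simp
  next
    case 2
    have "sref i \<beta> = \<alpha> i" using i by (auto simp: 2 fun_scale_def fun_eq_iff)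
    then show ?thesis using simple_root[OF i] by simp
  next
    case 3
    then show ?thesis by (intro refl_x_integral(1)[OF i \<beta>, of 1]) simp_all
  qed
qed

lemma root_coeff_int: "\<beta> \<in> \<Delta> \<Longrightarrow> l \<in> I \<Longrightarrow> \<beta> (\<omega> l) \<in> \<int>"
proof -
  assume \<beta>: "\<beta> \<in> \<Delta>" and l: "l \<in> I"
  from root_cases[OF \<beta>] show ?thesis
  proof
    assume "\<beta> \<in> \<Delta>p"
    then show ?thesis using l Nats_subset_Ints by (auto simp: pos_root_iff)
  next
    assume "- \<beta> \<in> \<Delta>p"
    then have "- \<beta> (\<omega> l) \<in> \<int>" using l Nats_subset_Ints by (auto simp: pos_root_iff)
    then show ?thesis by (simp only: minus_in_Ints_iff)
  qed
qed

text \<open>A root and its reflection both have integral coordinates in the simple roots, and their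
  coordinates at i differ by \<beta>(\<open>h i\<close>).\<close>

lemma root_h_int: "\<beta> \<in> \<Delta> \<Longrightarrow> i \<in> I \<Longrightarrow> \<beta> (h i) \<in> \<int>"
proof -
  assume \<beta>: "\<beta> \<in> \<Delta>" and i: "i \<in> I"
  have "sref i \<beta> (\<omega> i) = \<beta> (\<omega> i) - \<beta> (h i)"
    using i by (simp add: fun_scale_def alpha_coweight)
  then have "\<beta> (h i) = \<beta> (\<omega> i) - sref i \<beta> (\<omega> i)" by simp
  then show ?thesis
    using root_coeff_int[OF \<beta> i] root_coeff_int[OF sref_root[OF i \<beta>] i] by (metis Ints_diff)
qed

text \<open>The form \<open>\<Sum>\<gamma>. \<gamma>(y) \<gamma>(z)\<close> is invariant under reflections; hence \<open>\<alpha> i\<close> is a positive multiple of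
  the pairing with \<open>h i\<close>, and a root pairing nonpositively with all the \<open>h i\<close> would have a
  nonpositive square.\<close>

lemma pos_root_pairing:
  assumes \<beta>: "\<beta> \<in> \<Delta>p"
  shows "\<exists>i\<in>I. \<exists>n::nat. n > 0 \<and> \<beta> (h i) = of_nat n"
proof (rule ccontr)
  assume no: "\<not> ?thesis"
  have \<beta>R: "\<beta> \<in> \<Delta>" using \<beta> by (rule pos_root)
  define B where "B y z = (\<Sum>\<gamma>\<in>\<Delta>. \<gamma> y * \<gamma> z)" for y z
  have inv: "2 * B z (h i) = \<alpha> i z * B (h i) (h i)" if i: "i \<in> I" for i z
  proof -
    have bij: "bij_betw (sref i) \<Delta> \<Delta>"
      by (rule bij_betwI[where g = "sref i"]) (use i sref_root sref_sref in \<open>auto simp only: Pi_iff\<close>)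
    have "B z (h i) = (\<Sum>\<gamma>\<in>\<Delta>. sref i \<gamma> z * sref i \<gamma> (h i))"
      unfolding B_def by (rule sum.reindex_bij_betw[OF bij, symmetric, of "\<lambda>\<gamma>. \<gamma> z * \<gamma> (h i)"])
    also have "\<dots> = (\<Sum>\<gamma>\<in>\<Delta>. \<alpha> i z * (\<gamma> (h i) * \<gamma> (h i)) - \<gamma> z * \<gamma> (h i))"
      by (rule sum.cong) (use i in \<open>simp_all add: fun_scale_def algebra_simps\<close>)
    also have "\<dots> = \<alpha> i z * B (h i) (h i) - B z (h i)"
      by (simp add: B_def sum_subtractf sum_distrib_left)
    finally show ?thesis by simp
  qed
  define r where "r \<gamma> i = Re (\<gamma> (h i))" for \<gamma> i
  have r: "\<gamma> (h i) = of_real (r \<gamma> i)" if "\<gamma> \<in> \<Delta>" "i \<in> I" for \<gamma> i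
    using root_h_int[OF that] unfolding r_def by (auto elim!: Ints_cases)
  define N where "N i = (\<Sum>\<gamma>\<in>\<Delta>. (r \<gamma> i)\<^sup>2)" for i
  have BN: "B (h i) (h i) = of_real (N i)" if "i \<in> I" for i
    unfolding B_def N_def of_real_sum by (rule sum.cong) (simp_all add: r that power2_eq_square)
  have N: "N i > 0" if "i \<in> I" for i
  proof -
    have "(r (\<alpha> i) i)\<^sup>2 \<le> N i"
      unfolding N_def by (rule member_le_sum) (simp_all add: simple_root that finite_roots)
    moreover have "r (\<alpha> i) i = 2" using that by (simp add: r_def)
    ultimately show ?thesis by simp
  qed
  have "\<And>l. l \<in> I \<Longrightarrow> \<beta> (\<omega> l) \<in> \<nat>" using \<beta> by (simp add: pos_root_iff)
  then obtain c :: "'i \<Rightarrow> nat" where c: "\<And>l. l \<in> I \<Longrightarrow> \<beta> (\<omega> l) = of_nat (c l)"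
    using Nats_choice[of I "\<lambda>l. \<beta> (\<omega> l)"] by blast
  \<comment> \<open>By \<open>inv\<close>, \<open>\<alpha> l\<close> is 2 / \<open>N l\<close> times
    the pairing with \<open>h l\<close>. So the \<open>d l\<close> are the coefficients of an
    element y, the sum of the \<open>d l\<close> times \<open>h l\<close>, with \<beta> =
    \<open>B\<close> (-, y).\<close>
  define d where "d l = 2 * real (c l) / N l" for l
  have d0: "d l \<ge> 0" if "l \<in> I" for l using N[OF that] by (simp add: d_def)
  define t where "t \<gamma> = (\<Sum>l\<in>I. d l * r \<gamma> l)" for \<gamma>
  have bz: "\<beta> z = (\<Sum>\<gamma>\<in>\<Delta>. of_real (t \<gamma>) * \<gamma> z)" for z
  proof -
    have "\<beta> z = (\<Sum>l\<in>I. of_real (d l) * B z (h l))"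
      unfolding functional_coweights[OF root_dual[OF \<beta>R], of z]
    proof (rule sum.cong)
      fix l assume l: "l \<in> I"
      have "\<alpha> l z = 2 * B z (h l) / of_real (N l)"
        using inv[OF l, of z] BN[OF l] N[OF l] by (simp add: field_simps)
      then show "\<beta> (\<omega> l) * \<alpha> l z = of_real (d l) * B z (h l)"
        using c[OF l] by (simp add: d_def)
    qed simp
    also have "\<dots> = (\<Sum>l\<in>I. \<Sum>\<gamma>\<in>\<Delta>. of_real (d l * r \<gamma> l) * \<gamma> z)"
      by (rule sum.cong) (simp_all add: B_def sum_distrib_left r mult_ac)
    also have "\<dots> = (\<Sum>\<gamma>\<in>\<Delta>. of_real (t \<gamma>) * \<gamma> z)"
      by (subst sum.swap) (simp add: t_def sum_distrib_right)
    finally show ?thesis .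
  qed
  have rle: "r \<beta> l \<le> 0" if l: "l \<in> I" for l
  proof (rule ccontr)
    assume "\<not> r \<beta> l \<le> 0"
    obtain k :: int where k: "\<beta> (h l) = of_int k" using root_h_int[OF \<beta>R l] by (auto elim: Ints_cases)
    then have "k > 0" using \<open>\<not> r \<beta> l \<le> 0\<close> by (simp add: r_def)
    then have "\<beta> (h l) = of_nat (nat k)" "nat k > 0" using k by simp_all
    then show False using no l by blast
  qed
  \<comment> \<open>For this y, \<open>t \<gamma>\<close> is \<gamma>(y). Both sides are thus
    \<open>B\<close> y y: the left by definition, the right as \<beta>(y).\<close>
  have "(\<Sum>\<gamma>\<in>\<Delta>. (t \<gamma>)\<^sup>2) = (\<Sum>l\<in>I. d l * r \<beta> l)"
  proof -
    have rb: "r \<beta> l = (\<Sum>\<gamma>\<in>\<Delta>. t \<gamma> * r \<gamma> l)" if "l \<in> I" for l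
    proof -
      have "complex_of_real (r \<beta> l) = (\<Sum>\<gamma>\<in>\<Delta>. of_real (t \<gamma> * r \<gamma> l))"
        using bz[of "h l"] r[OF \<beta>R that] r that by simp
      then show ?thesis unfolding of_real_sum[symmetric] by (simp only: of_real_eq_iff)
    qed
    have "(\<Sum>l\<in>I. d l * r \<beta> l) = (\<Sum>l\<in>I. \<Sum>\<gamma>\<in>\<Delta>. t \<gamma> * (d l * r \<gamma> l))"
      by (rule sum.cong) (simp_all add: rb sum_distrib_left mult_ac)
    also have "\<dots> = (\<Sum>\<gamma>\<in>\<Delta>. t \<gamma> * t \<gamma>)"
      by (subst sum.swap) (simp add: t_def sum_distrib_left)
    finally show ?thesis by (simp add: power2_eq_square)
  qed
  also have "\<dots> \<le> 0"
    by (rule sum_nonpos) (simp add: d0 rle mult_nonneg_nonpos)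
  finally have "(\<Sum>\<gamma>\<in>\<Delta>. (t \<gamma>)\<^sup>2) = 0"
    using sum_nonneg[of \<Delta> "\<lambda>\<gamma>. (t \<gamma>)\<^sup>2"] by simp
  then have "t \<gamma> = 0" if "\<gamma> \<in> \<Delta>" for \<gamma>
    using that finite_roots by (simp add: sum_nonneg_eq_0_iff)
  then have "\<beta> z = 0" for z using bz[of z] by simp
  then have "\<beta> = 0" by (simp add: fun_eq_iff)
  then show False using root_nonzero[OF \<beta>R] by simp
qed

text \<open>The reflection changes only the coefficient of \<open>\<alpha> i\<close>. As \<beta> is
  not a multiple of \<open>\<alpha> i\<close>, some other positive coefficient survives and decides
  the sign.\<close>

lemma sref_positive:
  assumes i: "i \<in> I" and \<beta>: "\<beta> \<in> \<Delta>p" "\<beta> \<noteq> \<alpha> i"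
  shows "sref i \<beta> \<in> \<Delta>p"
proof -
  have \<beta>R: "\<beta> \<in> \<Delta>" using \<beta>(1) by (rule pos_root)
  have co: "sref i \<beta> (\<omega> l) = \<beta> (\<omega> l)" if "l \<in> I" "l \<noteq> i" for l
    using that i by (simp add: fun_scale_def alpha_coweight)
  have "\<exists>l\<in>I. l \<noteq> i \<and> \<beta> (\<omega> l) \<noteq> 0"
  proof (rule ccontr)
    assume no: "\<not> ?thesis"
    have "\<beta> = fun_scale (\<beta> (\<omega> i)) (\<alpha> i)"
    proof (rule functional_eq_coweights)
      show "\<beta> (\<omega> l) = fun_scale (\<beta> (\<omega> i)) (\<alpha> i) (\<omega> l)" if "l \<in> I" for l
        using that no i by (auto simp: fun_scale_def alpha_coweight)
    qed (intro root_dual \<beta>R dual_fun_scale simple_root i)+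
    from multiple_of_simple[OF i \<beta>R this] have "\<beta> = - \<alpha> i" using \<beta>(2) by blast
    then show False using pos_neg_exclusive[OF simple_pos[OF i]] \<beta>(1) by simp
  qed
  then obtain l where l: "l \<in> I" "l \<noteq> i" "\<beta> (\<omega> l) \<noteq> 0" by blast
  have "- sref i \<beta> \<notin> \<Delta>p"
  proof
    assume "- sref i \<beta> \<in> \<Delta>p"
    then have "(- sref i \<beta>) (\<omega> l) \<in> \<nat>" using l(1) by (simp only: pos_root_iff)
    then have "- \<beta> (\<omega> l) \<in> \<nat>" using co[OF l(1,2)] by simp
    moreover have "\<beta> (\<omega> l) \<in> \<nat>" using \<beta>(1) l(1) by (simp add: pos_root_iff)
    ultimately obtain m n :: nat where mn: "- \<beta> (\<omega> l) = of_nat m" "\<beta> (\<omega> l) = of_nat n"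
      by (elim Nats_cases)
    have "complex_of_nat m + of_nat n = - \<beta> (\<omega> l) + \<beta> (\<omega> l)" by (simp only: mn(1)[symmetric] mn(2)[symmetric])
    then have "complex_of_nat (m + n) = 0" by simp
    then have "n = 0" by (simp only: of_nat_eq_0_iff)
    then show False using l(3) mn(2) by simp
  qed
  then show ?thesis using root_cases[OF sref_root[OF i \<beta>R]] by blast
qed

text \<open>Every positive root is brought to a simple one through positive roots:
  \<open>pos_root_pairing\<close> supplies an i with \<beta>(\<open>h i\<close>) > 0, and reflecting
  in it lowers the height.\<close>

lemma positive_root_induct [consumes 1, case_names simple reflect]:
  assumes "\<beta> \<in> \<Delta>p"
    and simple: "\<And>i. i \<in> I \<Longrightarrow> P (\<alpha> i)"
    and reflect: "\<And>i \<gamma>. i \<in> I \<Longrightarrow> \<gamma> \<in> \<Delta>p \<Longrightarrow> \<gamma> \<noteq> \<alpha> i \<Longrightarrow> P (sref i \<gamma>) \<Longrightarrow> P \<gamma>"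
  shows "P \<beta>"
  using assms(1)
proof (induction "ht \<beta>" arbitrary: \<beta> rule: less_induct)
  case less
  obtain i n where i: "i \<in> I" "n > 0" "\<beta> (h i) = of_nat n"
    using pos_root_pairing[OF less.prems] by blast
  show ?case
  proof (cases "\<beta> = \<alpha> i")
    case True
    then show ?thesis using simple[OF i(1)] by simp
  next
    case False
    have sp: "sref i \<beta> \<in> \<Delta>p" by (rule sref_positive[OF i(1) less.prems False])
    have "\<alpha> i height_elt = 1"
      using functional_height_elt[OF root_dual[OF simple_root[OF i(1)]]] i(1) finite_I
      by (simp add: alpha_coweight)
    then have "sref i \<beta> height_elt = of_nat (ht \<beta>) - of_nat n"
      unfolding pos_root_height(1)[OF less.prems, symmetric] i(3)[symmetric] by (simp add: fun_scale_def)
    then have "complex_of_nat (ht (sref i \<beta>)) + of_nat n = of_nat (ht \<beta>)"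
      unfolding pos_root_height(1)[OF sp] by (simp only: diff_add_cancel)
    then have "ht (sref i \<beta>) + n = ht \<beta>"
      unfolding of_nat_add[symmetric] by (simp only: of_nat_eq_iff)
    then show ?thesis
      using less.hyps[OF _ sp] i reflect[OF i(1) less.prems False] by simp
  qed
qed

end

section \<open>The action of the enveloping algebra\<close>

lemma poly_mapping_single_induct:
  assumes "P 0" "\<And>a b f. P f \<Longrightarrow> P (Poly_Mapping.single a b + f)"
  shows "P (f :: 'a \<Rightarrow>\<^sub>0 'b::monoid_add)"
proof (induction f rule: update_induct)
  case (update f a b)
  have "Poly_Mapping.update a b f = Poly_Mapping.single a b + f"
    by (rule poly_mapping_eqI)
      (use update in \<open>auto simp: lookup_add lookup_single lookup_update in_keys_iff when_def\<close>)
  then show ?case using assms(2)[OF update(3)] by simp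
qed (rule assms(1))

lemma ring_free_ring: "ring (free_ring :: 'g free_algebra ring)"
proof -
  have "\<exists>y. a + y = 0" "\<exists>y. y + a = 0 \<and> a + y = 0" for a :: "'g free_algebra"
    by (auto intro: exI[of _ "- a"])
  then show ?thesis
    unfolding ring_of_type_algebra_def by unfold_locales (auto simp: algebra_simps Units_def)
qed

lemma free_ring_simps [simp]:
  "carrier free_ring = UNIV" "a \<otimes>\<^bsub>free_ring\<^esub> b = a * b" "a \<oplus>\<^bsub>free_ring\<^esub> b = a + b"
  "\<one>\<^bsub>free_ring\<^esub> = 1" "\<zero>\<^bsub>free_ring\<^esub> = 0"
  by (simp_all add: ring_of_type_algebra_def)

lemma free_ring_a_inv [simp]: "\<ominus>\<^bsub>free_ring\<^esub> (a :: 'g free_algebra) = - a"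
proof -
  interpret ring "free_ring :: 'g free_algebra ring" by (rule ring_free_ring)
  have "- a \<oplus>\<^bsub>free_ring\<^esub> a = \<zero>\<^bsub>free_ring\<^esub>" by simp
  from minus_equality[OF this] show ?thesis by simp
qed

context lie_module
begin

abbreviation "uact \<equiv> free_act vscale act"
abbreviation "cls \<equiv> envelope_class scale bracket"
abbreviation "Ug \<equiv> envelope scale bracket"

lemma lin_foldr_act: "V.lin (\<lambda>w. foldr act l w)"
  by (induction l) (auto intro!: V.linI simp: V.lin_simps)

lemma free_act_eq_sum:
  assumes "finite A" "Poly_Mapping.keys f \<subseteq> A"
  shows "uact f w = (\<Sum>u\<in>A. vscale (Poly_Mapping.lookup f u) (foldr act (letters u) w))"
  unfolding free_act_def by (rule sum.mono_neutral_left) (use assms in \<open>auto simp: in_keys_iff\<close>)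

lemma free_act_single: "uact (Poly_Mapping.single u c) w = vscale c (foldr act (letters u) w)"
  by (subst free_act_eq_sum[where A = "{u}"]) auto

lemma free_act_add: "uact (f + k) w = uact f w + uact k w"
proof -
  let ?A = "Poly_Mapping.keys f \<union> Poly_Mapping.keys k"
  have "uact (f + k) w = (\<Sum>u\<in>?A. vscale (Poly_Mapping.lookup (f + k) u) (foldr act (letters u) w))"
    by (rule free_act_eq_sum) (simp, rule Poly_Mapping.keys_add)
  also have "\<dots> = uact f w + uact k w"
    by (simp add: lookup_add V.scale_left_distrib sum.distrib free_act_eq_sum[of ?A])
  finally show ?thesis .
qed

lemma free_act_zero [simp]: "uact 0 w = 0"
  by (simp add: free_act_def)

lemma free_act_minus: "uact (- f) w = - uact f w"
  using free_act_add[of f "- f" w] by (simp add: add_eq_0_iff)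

lemma free_act_diff: "uact (f - k) w = uact f w - uact k w"
  using free_act_add[of f "- k" w] by (simp add: free_act_minus)

lemma lin_free_act: "V.lin (uact f)"
proof (induction f rule: poly_mapping_single_induct)
  case (2 a b f)
  then show ?case
    using V.lin_simps[OF lin_foldr_act]
    by (intro V.linI) (simp_all add: free_act_add free_act_single V.lin_simps V.scale_right_distrib mult.commute)
qed (auto intro: V.linI)

lemma free_act_mult: "uact (f * k) w = uact f (uact k w)"
proof (induction f rule: poly_mapping_single_induct)
  case (2 a b f)
  have "uact (Poly_Mapping.single a b * k) w = vscale b (foldr act (letters a) (uact k w))"
  proof (induction k rule: poly_mapping_single_induct)
    case 1
    then show ?case by (simp add: V.lin_zero[OF lin_foldr_act])
  next
    case (2 c d k)
    then show ?case
      by (simp add: distrib_left free_act_add mult_single free_act_single plus_word_def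
          V.lin_simps[OF lin_foldr_act] V.scale_right_distrib)
  qed
  then show ?case using 2 by (simp add: distrib_right free_act_add free_act_single)
qed simp

lemma free_act_gen [simp]: "uact (gen y) w = act y w"
  by (simp add: gen_def free_act_single)

lemma free_act_scalar [simp]: "uact (scalar c) w = vscale c w"
  by (simp add: scalar_def free_act_single zero_word_def)

lemma free_act_one [simp]: "uact 1 w = w"
  using free_act_scalar[of 1 w] by (simp add: scalar_def)

lemma free_act_of_nat [simp]: "uact (of_nat n) w = vscale (of_nat n) w"
  by (induction n) (simp_all add: free_act_add V.scale_left_distrib)

lemma free_act_power: "uact (f ^ n) w = (uact f ^^ n) w"
  by (induction n) (simp_all add: free_act_mult)

lemma free_act_divided_power: "uact (divided_power y n) w = dpow vscale (act y) n w"
proof -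
  have "uact (gen y) = act y" by (rule ext) simp
  then show ?thesis by (simp add: divided_power_def free_act_mult free_act_power dpow_def)
qed

lemma free_act_binomial:
  assumes "act y w = vscale m w"
  shows "uact (binomial_elt y n) w = vscale (m gchoose n) w"
proof -
  have "uact (prod_list (map (\<lambda>k. gen y - of_nat k) l)) w = vscale (\<Prod>k\<leftarrow>l. m - of_nat k) w" for l
  proof (induction l)
    case (Cons a l)
    then show ?case using assms
      by (simp add: free_act_mult free_act_diff V.lin_scale[OF lin_free_act] V.scale_left_diff_distrib[symmetric] mult.commute)
  qed simp
  moreover have "(\<Prod>k\<leftarrow>[0..<n]. m - of_nat k) = (\<Prod>k=0..<n. m - of_nat k)"
    using prod.distinct_set_conv_list[of "[0..<n]" "\<lambda>k. m - of_nat k"] by simp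
  ultimately show ?thesis
    by (simp add: binomial_elt_def free_act_mult gbinomial_prod_rev)
qed

lemma ideal_envelope_ideal: "ideal (envelope_ideal scale bracket) free_ring"
  unfolding envelope_ideal_def by (rule ring.genideal_ideal[OF ring_free_ring]) simp

text \<open>The elements that act as zero form an ideal, and it contains the defining relations
  because V is a Lie module.\<close>

lemma envelope_ideal_acts_trivially:
  assumes "f \<in> envelope_ideal scale bracket"
  shows "uact f w = 0"
proof -
  let ?N = "{f. \<forall>w. uact f w = 0}"
  interpret R: ring "free_ring :: 'g free_algebra ring" by (rule ring_free_ring)
  have "ideal ?N free_ring"
  proof (rule idealI[OF ring_free_ring])
    show "subgroup ?N (add_monoid free_ring)"
    proof (rule R.add.subgroupI)
      fix a assume "a \<in> ?N"
      then show "\<ominus>\<^bsub>free_ring\<^esub> a \<in> ?N" by (simp add: free_act_minus)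
    qed (auto simp: free_act_add intro: exI[of _ 0])
  qed (auto simp: free_act_mult V.lin_zero[OF lin_free_act])
  then have "envelope_ideal scale bracket \<subseteq> ?N"
    unfolding envelope_ideal_def
    by (rule R.genideal_minimal) (auto simp: free_act_add free_act_diff free_act_mult act_bracket)
  then show ?thesis using assms by blast
qed

lemma envelope_act_class: "envelope_act vscale act (cls f) w = uact f w"
proof -
  let ?J = "envelope_ideal scale bracket"
  have C: "cls f = {j + f | j. j \<in> ?J}"
    by (auto simp: envelope_class_def a_r_coset_def')
  have "0 \<in> ?J" using additive_subgroup.zero_closed[OF ideal.axioms(1)[OF ideal_envelope_ideal]] by simp
  then have "0 + f \<in> cls f" unfolding C by blast
  then have f: "f \<in> cls f" by simp
  have eq: "uact k w = uact f w" if k: "k \<in> cls f" for k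
  proof -
    obtain j where "j \<in> ?J" "k = j + f" using k unfolding C by blast
    then show ?thesis by (simp add: free_act_add envelope_ideal_acts_trivially)
  qed
  show ?thesis
    unfolding envelope_act_def
  proof (rule the_equality)
    show "\<forall>k\<in>cls f. uact k w = uact f w"
      by (intro ballI eq)
    show "t = uact f w" if "\<forall>k\<in>cls f. uact k w = t" for t
      using bspec[OF that f] by simp
  qed
qed

lemma ring_hom_envelope_class: "cls \<in> ring_hom free_ring (envelope scale bracket)"
proof -
  interpret J: ideal "envelope_ideal scale bracket" free_ring by (rule ideal_envelope_ideal)
  have "cls = (+>\<^bsub>free_ring\<^esub>) (envelope_ideal scale bracket)"
    by (rule ext) (simp add: envelope_class_def)
  then show ?thesis unfolding envelope_def by (simp add: J.rcos_ring_hom)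
qed

lemma envelope_class_simps:
  "cls f \<otimes>\<^bsub>Ug\<^esub> cls k = cls (f * k)"
  "cls f \<oplus>\<^bsub>Ug\<^esub> cls k = cls (f + k)"
  "\<one>\<^bsub>Ug\<^esub> = cls 1"
  "\<ominus>\<^bsub>Ug\<^esub> cls f = cls (- f)"
proof -
  note hom = ring_hom_envelope_class
  show "cls f \<otimes>\<^bsub>Ug\<^esub> cls k = cls (f * k)"
    "cls f \<oplus>\<^bsub>Ug\<^esub> cls k = cls (f + k)"
    "\<one>\<^bsub>Ug\<^esub> = cls 1"
    using ring_hom_mult[OF hom, of f k] ring_hom_add[OF hom, of f k] ring_hom_one[OF hom] by simp_all
  interpret J: ideal "envelope_ideal scale bracket" free_ring by (rule ideal_envelope_ideal)
  interpret R: ring "free_ring :: 'g free_algebra ring" by (rule ring_free_ring)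
  interpret E: ring "envelope scale bracket" unfolding envelope_def by (rule J.quotient_is_ring)
  interpret h: ring_hom_ring free_ring "envelope scale bracket" "cls"
    by (rule ring_hom_ringI2[OF ring_free_ring E.ring_axioms hom])
  show "\<ominus>\<^bsub>Ug\<^esub> cls f = cls (- f)"
    using h.hom_a_inv[of f] by simp
qed

end

section \<open>The admissible lattice\<close>

lemma group_closure_additive_image:
  assumes "\<And>a b. f (a - b) = f a - f b" "\<And>s. s \<in> S \<Longrightarrow> f s \<in> group_closure T" "a \<in> group_closure S"
  shows "f a \<in> group_closure T"
  using assms(3)
proof (induction rule: group_closure.induct)
  case (base s)
  have "f 0 = 0" using assms(1)[of 0 0] by simp
  then show ?case using base assms(2) by auto
next
  case (diff s t)
  then show ?case by (simp add: assms(1) group_closure.diff)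
qed

lemma group_closure_sum: "(\<And>i. i \<in> A \<Longrightarrow> t i \<in> group_closure S) \<Longrightarrow> sum t A \<in> group_closure S"
  by (induction A rule: infinite_finite_induct) (auto intro: group_closure_add)

lemma (in complex_vector_space) group_closure_int_scale:
  "w \<in> group_closure S \<Longrightarrow> scale (of_int n) w \<in> group_closure S"
proof -
  assume w: "w \<in> group_closure S"
  have nat: "scale (of_nat k) w \<in> group_closure S" for k
    by (induction k) (simp_all add: w scale_left_distrib group_closure_add)
  show ?thesis
    by (cases n) (use nat in \<open>simp_all del: of_nat_Suc\<close>)
qed

text \<open>The upper entry m + a - b of the commutation formula can be negative; Pascal's rule, run
  downwards from 0, covers that case.\<close>

lemma gbinomial_of_int_Ints: "(of_int m :: complex) gchoose k \<in> \<int>"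
proof (induction k arbitrary: m)
  case (Suc k)
  have up: "(of_int (int n) :: complex) gchoose Suc k \<in> \<int>" for n
    by (simp add: binomial_gbinomial[symmetric])
  have step: "(of_int (j + 1) :: complex) gchoose Suc k = (of_int j gchoose k) + (of_int j gchoose Suc k)" for j
    using gbinomial_Suc_Suc[of "of_int j :: complex" k] by simp
  have down: "(of_int (- int n) :: complex) gchoose Suc k \<in> \<int>" for n
  proof (induction n)
    case (Suc n)
    have "(of_int (- int (Suc n)) :: complex) gchoose Suc k =
        (of_int (- int n) gchoose Suc k) - (of_int (- int (Suc n)) gchoose k)"
      using step[of "- int (Suc n)"] by simp
    then show ?case using Suc \<open>\<And>m. (of_int m :: complex) gchoose k \<in> \<int>\<close> by (metis Ints_diff)
  qed simp
  show ?case by (cases m rule: int_cases2) (use up down in \<open>metis\<close>)+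
qed simp

text \<open>\<open>weights_integral\<close> is the form in which the hypothesis on the weight
  lattice enters: every weight of V lies in P.\<close>

locale highest_weight_module = weight_module scale bracket H I \<alpha> coroot x vscale act
  for scale :: "complex \<Rightarrow> 'g::ab_group_add \<Rightarrow> 'g" and bracket and H :: "'g set" and I :: "'i set"
    and \<alpha> coroot x and vscale :: "complex \<Rightarrow> 'v::ab_group_add \<Rightarrow> 'v" and act +
  fixes \<Lambda> :: "'g \<Rightarrow> complex" and v :: 'v
  assumes irreducible: "irreducible_action vscale act"
    and faithful: "faithful_action act"
    and highest: "highest_weight_vector scale bracket H I \<alpha> vscale act \<Lambda> v"
    and weights_integral: "\<And>\<mu> i. \<mu> \<in> weights scale vscale act H \<Longrightarrow> i \<in> I \<Longrightarrow> \<mu> (coroot (\<alpha> i)) \<in> \<int>"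
begin

lemma Lambda_functional: "\<Lambda> \<in> functionals"
  and v_nonzero: "v \<noteq> 0"
  and v_weight: "v \<in> wsp \<Lambda>"
  using highest unfolding highest_weight_vector_def by blast+

lemma pos_kills_v: "\<beta> \<in> \<Delta>p \<Longrightarrow> act (x \<beta>) v = 0"
  using highest x_in[OF pos_root] unfolding highest_weight_vector_def by blast

inductive_set monomials :: "'v set" where
  base: "v \<in> monomials"
| step: "w \<in> monomials \<Longrightarrow> i \<in> I \<Longrightarrow> xdp (- \<alpha> i) n w \<in> monomials"

definition lattice :: "'v set" where
  "lattice = group_closure monomials"

lemma lattice_closed:
  shows lattice_0: "0 \<in> lattice"
    and lattice_add: "a \<in> lattice \<Longrightarrow> b \<in> lattice \<Longrightarrow> a + b \<in> lattice"
    and lattice_diff: "a \<in> lattice \<Longrightarrow> b \<in> lattice \<Longrightarrow> a - b \<in> lattice"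
    and lattice_minus: "a \<in> lattice \<Longrightarrow> - a \<in> lattice"
    and lattice_sum: "(\<And>i. i \<in> A \<Longrightarrow> t i \<in> lattice) \<Longrightarrow> sum t A \<in> lattice"
    and lattice_int_scale: "a \<in> lattice \<Longrightarrow> k \<in> \<int> \<Longrightarrow> vscale k a \<in> lattice"
    and v_lattice: "v \<in> lattice"
  unfolding lattice_def
  by (auto intro: group_closure_add group_closure.diff group_closure_sum V.group_closure_int_scale
      group_closure.base monomials.base elim!: Ints_cases)

lemma lattice_image:
  assumes "V.lin f" "\<And>w. w \<in> monomials \<Longrightarrow> f w \<in> lattice" "w \<in> lattice"
  shows "f w \<in> lattice"
  using group_closure_additive_image[of f monomials monomials w] assms
  unfolding lattice_def by (simp add: V.lin_diff)

text \<open>k is the total number of lowering steps. The clause on k = 0 identifies the monomials of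
  weight \<Lambda>: a factor of order 0 is the identity, so they all equal \<open>v\<close>.\<close>

lemma monomial_weight:
  assumes "w \<in> monomials"
  shows "\<exists>\<mu>\<in>functionals. w \<in> wsp \<mu> \<and> (\<exists>k::nat. \<mu> height_elt = \<Lambda> height_elt - of_nat k \<and> (k = 0 \<longrightarrow> w = v))"
  using assms
proof (induction rule: monomials.induct)
  case base
  show ?case
    by (rule bexI[where x = \<Lambda>]) (auto simp: v_weight Lambda_functional intro: exI[of _ 0])
next
  case (step w i n)
  then obtain \<mu> k where \<mu>: "\<mu> \<in> functionals" "w \<in> wsp \<mu>" "\<mu> height_elt = \<Lambda> height_elt - of_nat k" "k = 0 \<Longrightarrow> w = v"
    by blast
  let ?\<nu> = "\<mu> + fun_scale (of_nat n) (- \<alpha> i)"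
  have a: "\<alpha> i height_elt = 1"
    using functional_height_elt[OF root_dual[OF simple_root[OF step(2)]]] step(2) finite_I
    by (simp add: alpha_coweight)
  show ?case
  proof (rule bexI[where x = ?\<nu>], intro conjI)
    show "?\<nu> \<in> functionals"
      by (rule dual_add[OF \<mu>(1) dual_fun_scale[OF root_dual[OF minus_root[OF simple_root[OF step(2)]]]]])
    show "xdp (- \<alpha> i) n w \<in> wsp ?\<nu>"
      by (rule dpow_act_root_space[OF x_in[OF minus_root[OF simple_root[OF step(2)]]] \<mu>(2)])
    show "\<exists>k::nat. ?\<nu> height_elt = \<Lambda> height_elt - of_nat k \<and> (k = 0 \<longrightarrow> xdp (- \<alpha> i) n w = v)"
      by (rule exI[of _ "k + n"]) (use \<mu>(3,4) a in \<open>auto simp: fun_scale_def\<close>)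
  qed
qed

lemma dpow_minus_simple_lattice:
  "i \<in> I \<Longrightarrow> w \<in> lattice \<Longrightarrow> xdp (- \<alpha> i) n w \<in> lattice"
proof (rule lattice_image[OF lin_dpow_act])
  fix w assume "i \<in> I" "w \<in> monomials"
  then show "xdp (- \<alpha> i) n w \<in> lattice"
    unfolding lattice_def by (intro group_closure.base) (simp add: monomials.step)
qed

text \<open>\<open>\<alpha> i\<close> - \<open>\<alpha> j\<close> has coefficients of both signs,
  hence is not a root, and the bracket of the two root vectors vanishes.\<close>

lemma simple_minus_commute:
  assumes "i \<in> I" "j \<in> I" "i \<noteq> j"
  shows "act (x (\<alpha> i)) (act (x (- \<alpha> j)) w) = act (x (- \<alpha> j)) (act (x (\<alpha> i)) w)"
proof -
  let ?d = "- \<alpha> j + \<alpha> i"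
  have ci: "?d (\<omega> i) = 1" "?d (\<omega> j) = - 1" "(- ?d) (\<omega> i) = - 1"
    using assms by (simp_all add: alpha_coweight)
  have neg: "- 1 \<notin> (\<nat> :: complex set)"
  proof
    assume "- 1 \<in> (\<nat> :: complex set)"
    then obtain n :: nat where "(- 1 :: complex) = of_nat n" by (rule Nats_cases)
    then have "complex_of_nat (Suc n) = 0" by (simp add: add_eq_0_iff)
    then show False by (simp only: of_nat_eq_0_iff)
  qed
  have notroot: "?d \<notin> \<Delta>"
  proof
    assume "?d \<in> \<Delta>"
    from root_cases[OF this] show False
      using ci neg assms unfolding pos_root_iff by metis
  qed
  have nz: "?d \<noteq> 0"
  proof
    assume "?d = 0"
    then have "?d (\<omega> i) = 0" by simp
    then show False using ci(1) by simp
  qed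
  have "bracket (x (\<alpha> i)) (x (- \<alpha> j)) = 0"
  proof (rule gs_trivial[OF _ notroot nz])
    show "?d \<in> functionals"
      by (rule dual_add[OF root_dual[OF minus_root[OF simple_root[OF assms(2)]]] root_dual[OF simple_root[OF assms(1)]]])
    show "bracket (x (\<alpha> i)) (x (- \<alpha> j)) \<in> gs ?d"
      by (rule ad.act_root_space[OF x_in[OF simple_root[OF assms(1)]] x_in[OF minus_root[OF simple_root[OF assms(2)]]]])
  qed
  then show ?thesis using act_bracket[of "x (\<alpha> i)" "x (- \<alpha> j)" w] by simp
qed

lemma dpow_simple_monomial:
  assumes "w \<in> monomials" "i \<in> I"
  shows "xdp (\<alpha> i) n w \<in> lattice"
  using assms(1)
proof (induction arbitrary: n rule: monomials.induct)
  case base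
  show ?case
  proof (cases n)
    case (Suc m)
    have "(act (x (\<alpha> i)) ^^ Suc m) v = 0"
      using pos_kills_v[OF simple_pos[OF assms(2)]] V.lin_zero[OF V.lin_funpow[OF act_linear_right]]
      by (simp add: funpow_swap1)
    then show ?thesis by (simp add: Suc dpow_def lattice_0 del: funpow.simps)
  qed (simp add: v_lattice)
next
  case (step w j b)
  let ?e = "act (x (\<alpha> i))" and ?f = "act (x (- \<alpha> j))"
  show ?case
  proof (cases "i = j")
    case False
    have "?e (dpow vscale ?f b w) = dpow vscale ?f b (?e w)" for w
      using V.dpow_conj[OF act_linear_right, of "x (\<alpha> i)" ?f 1 ?f b w] act_linear_right
      by (simp add: simple_minus_commute[OF assms(2) step(2) False])
    then have "dpow vscale ?e n (dpow vscale ?f b w) = dpow vscale ?f b (dpow vscale ?e n w)"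
      using V.dpow_conj[OF lin_dpow_act, of "x (- \<alpha> j)" b ?e 1 ?e n w] act_linear_right
      by simp
    then show ?thesis using dpow_minus_simple_lattice[OF step(2) step.IH] by simp
  next
    case True
    obtain \<mu> where \<mu>: "\<mu> \<in> functionals" "w \<in> wsp \<mu>" using monomial_weight[OF step(1)] by blast
    \<comment> \<open>A monomial may vanish, and then its \<mu> need not be a weight;
      \<open>weights_integral\<close> applies only when w is nonzero.\<close>
    show ?thesis
    proof (cases "w = 0")
      case True
      then show ?thesis by (simp add: V.lin_zero[OF lin_dpow_act] lattice_0)
    next
      case False
      then have "\<mu> (h i) \<in> \<int>" using weightI[OF \<mu>] weights_integral assms(2) by blast
      then obtain m where m: "\<mu> (h i) = of_int m" by (rule Ints_cases)
      have hw: "act (h i) w = vscale (of_int m) w"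
        using wspD[OF \<mu>(2) h_in_H[OF assms(2)]] m by simp
      have "dpow vscale ?e n (dpow vscale ?f b w) =
        (\<Sum>k\<le>n. vscale ((of_int m + of_nat n - of_nat b) gchoose k)
          (if k \<le> b then dpow vscale ?f (b - k) (dpow vscale ?e (n - k) w) else 0))"
        unfolding \<open>i = j\<close>[symmetric]
        by (rule V.sl2_dpow_dpow[OF act_linear_right act_linear_right sl2_relations[OF simple_root[OF assms(2)]] hw])
      also have "\<dots> \<in> lattice"
      proof (rule lattice_sum)
        fix k
        have "complex_of_int m + of_nat n - of_nat b = of_int (m + int n - int b)" by simp
        then have "(complex_of_int m + of_nat n - of_nat b) gchoose k \<in> \<int>"
          using gbinomial_of_int_Ints by metis
        then show "vscale ((of_int m + of_nat n - of_nat b) gchoose k)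
          (if k \<le> b then dpow vscale ?f (b - k) (dpow vscale ?e (n - k) w) else 0) \<in> lattice"
          using dpow_minus_simple_lattice[OF step(2) step.IH] by (intro lattice_int_scale) (auto simp: lattice_0)
      qed
      finally show ?thesis .
    qed
  qed
qed

lemma dpow_simple_lattice: "i \<in> I \<Longrightarrow> w \<in> lattice \<Longrightarrow> xdp (\<alpha> i) n w \<in> lattice"
  by (rule lattice_image[OF lin_dpow_act]) (rule dpow_simple_monomial)

lemma texp_lattice:
  assumes "\<beta> \<in> \<Delta>" "\<And>n w. w \<in> lattice \<Longrightarrow> xdp \<beta> n w \<in> lattice" "u \<in> \<int>" "w \<in> lattice"
  shows "texp \<beta> u w \<in> lattice"
proof -
  obtain N where "\<And>u w. texp \<beta> u w = (\<Sum>n<N. vscale (u ^ n) (xdp \<beta> n w))"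
    using texp_sum[OF assms(1)] by blast
  then show ?thesis
    using assms by (simp add: lattice_sum lattice_int_scale Ints_power)
qed

lemma refl_lattice:
  assumes "i \<in> I" "w \<in> lattice" "u \<in> \<int>"
  shows "refl (\<alpha> i) u w \<in> lattice"
proof -
  have "texp (\<alpha> i) k w \<in> lattice" "texp (- \<alpha> i) k w \<in> lattice" if "k \<in> \<int>" "w \<in> lattice" for k w
    using texp_lattice[OF simple_root[OF assms(1)] dpow_simple_lattice[OF assms(1)]]
      texp_lattice[OF minus_root[OF simple_root[OF assms(1)]] dpow_minus_simple_lattice[OF assms(1)]] that by blast+
  then show ?thesis using assms by (simp add: refl_def)
qed

text \<open>\<open>refl (\<alpha> i) 1\<close> turns \<open>x \<gamma>\<close> into plus or minus
  the vector of the reflected root, and both it and its inverse preserve the lattice.\<close>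

lemma dpow_sref_lattice:
  assumes i: "i \<in> I" and \<gamma>: "\<gamma> \<in> \<Delta>" "\<gamma> \<noteq> \<alpha> i" "\<gamma> \<noteq> - \<alpha> i"
    and stable: "\<And>n w. w \<in> lattice \<Longrightarrow> xdp (sref i \<gamma>) n w \<in> lattice"
    and w: "w \<in> lattice"
  shows "xdp \<gamma> n w \<in> lattice"
proof -
  obtain s where s: "s \<in> {1,-1}" "adj.refl (\<alpha> i) 1 (x \<gamma>) = scale s (x (sref i \<gamma>))"
    using refl_x[OF i \<gamma>] by blast
  let ?r = "refl (\<alpha> i)"
  have "?r 1 (xdp \<gamma> n w) = vscale (s ^ n) (xdp (sref i \<gamma>) n (?r 1 w))"
  proof (rule V.dpow_conj[OF lin_refl[OF simple_root[OF i]] _ act_linear_right])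
    show "?r 1 (act (x \<gamma>) w) = vscale s (act (x (sref i \<gamma>)) (?r 1 w))" for w
      unfolding refl_act[OF simple_root[OF i]] s(2) by simp
  qed
  moreover have "s ^ n \<in> \<int>" using s(1) by auto
  ultimately have "?r 1 (xdp \<gamma> n w) \<in> lattice"
    using stable[OF refl_lattice[OF i w]] by (simp add: lattice_int_scale)
  then have "?r (- 1) (?r 1 (xdp \<gamma> n w)) \<in> lattice"
    by (rule refl_lattice[OF i]) simp_all
  then show ?thesis
    using refl_inverse[OF simple_root[OF i], of "- 1"] by simp
qed

text \<open>\<beta> and -\<beta> are carried along together, since the induction sees positive roots
  only while reflections commute with negation.\<close>

lemma dpow_pos_lattice:
  assumes "\<beta> \<in> \<Delta>p"
  shows "\<forall>n. \<forall>w\<in>lattice. xdp \<beta> n w \<in> lattice \<and> xdp (- \<beta>) n w \<in> lattice"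
proof (rule positive_root_induct[where P = "\<lambda>\<beta>. \<forall>n. \<forall>w\<in>lattice.
      xdp \<beta> n w \<in> lattice \<and> xdp (- \<beta>) n w \<in> lattice", OF assms])
  fix i assume "i \<in> I"
  then show "\<forall>n. \<forall>w\<in>lattice. xdp (\<alpha> i) n w \<in> lattice \<and>
      xdp (- \<alpha> i) n w \<in> lattice"
    by (simp add: dpow_simple_lattice dpow_minus_simple_lattice)
next
  fix i \<gamma>
  assume reflect: "i \<in> I" "\<gamma> \<in> \<Delta>p" "\<gamma> \<noteq> \<alpha> i"
    "\<forall>n. \<forall>w\<in>lattice. xdp (sref i \<gamma>) n w \<in> lattice \<and>
      xdp (- sref i \<gamma>) n w \<in> lattice"
  have \<gamma>: "\<gamma> \<in> \<Delta>" "\<gamma> \<noteq> \<alpha> i" "\<gamma> \<noteq> - \<alpha> i"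
    using reflect(3) pos_root[OF reflect(2)] pos_neg_exclusive[OF simple_pos[OF reflect(1)]] reflect(2) by blast+
  have m: "- \<gamma> \<in> \<Delta>" "- \<gamma> \<noteq> \<alpha> i" "- \<gamma> \<noteq> - \<alpha> i"
    using minus_root[OF \<gamma>(1)] \<gamma>(2,3) by (metis minus_minus)+
  have ms: "- sref i \<gamma> = sref i (- \<gamma>)"
    by (auto simp: fun_scale_def fun_eq_iff)
  show "\<forall>n. \<forall>w\<in>lattice. xdp \<gamma> n w \<in> lattice \<and>
      xdp (- \<gamma>) n w \<in> lattice"
  proof (intro allI ballI conjI)
    fix n w assume w: "w \<in> lattice"
    show "xdp \<gamma> n w \<in> lattice"
      by (rule dpow_sref_lattice[OF reflect(1) \<gamma> _ w]) (use reflect(4) in blast)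
    show "xdp (- \<gamma>) n w \<in> lattice"
      by (rule dpow_sref_lattice[OF reflect(1) m _ w]) (use reflect(4) in \<open>simp only: ms[symmetric]\<close>)
  qed
qed

lemma dpow_lattice: "\<beta> \<in> \<Delta> \<Longrightarrow> w \<in> lattice \<Longrightarrow> xdp \<beta> n w \<in> lattice"
  using root_cases[of \<beta>] dpow_pos_lattice[of \<beta>] dpow_pos_lattice[of "- \<beta>"] by auto

lemma act_lattice: "\<beta> \<in> \<Delta> \<Longrightarrow> w \<in> lattice \<Longrightarrow> act (x \<beta>) w \<in> lattice"
  using dpow_lattice[of \<beta> w 1] by simp

text \<open>The generating monomials are weight vectors.\<close>

lemma wcomp_lattice: "w \<in> lattice \<Longrightarrow> \<mu> \<in> functionals \<Longrightarrow> wcomp \<mu> w \<in> lattice"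
proof (rule lattice_image[OF lin_wcomp])
  fix w assume \<mu>: "\<mu> \<in> functionals" and w: "w \<in> monomials"
  obtain \<nu> where "\<nu> \<in> functionals" "w \<in> wsp \<nu>" using monomial_weight[OF w] by blast
  then have "wcomp \<mu> w = (if \<mu> = \<nu> then w else 0)" using wcomp_weight_vector \<mu> by blast
  moreover have "w \<in> lattice" unfolding lattice_def using w by (intro group_closure.base) simp
  ultimately show "wcomp \<mu> w \<in> lattice" by (simp add: lattice_0)
qed

lemma binomial_lattice:
  assumes "i \<in> I" "w \<in> lattice"
  shows "uact (binomial_elt (h i) n) w \<in> lattice"
proof -
  have "uact (binomial_elt (h i) n) (wcomp \<mu> w) \<in> lattice" if \<mu>: "\<mu> \<in> W" for \<mu>
  proof -
    obtain m where m: "\<mu> (h i) = of_int m" using weights_integral[OF \<mu> assms(1)] by (rule Ints_cases)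
    have "act (h i) (wcomp \<mu> w) = vscale (of_int m) (wcomp \<mu> w)"
      using wspD[OF wcomp_in h_in_H[OF assms(1)]] m by simp
    from free_act_binomial[OF this] show ?thesis
      using wcomp_lattice[OF assms(2) weight_dual[OF \<mu>]] gbinomial_of_int_Ints by (simp add: lattice_int_scale)
  qed
  then have "uact (binomial_elt (h i) n) (\<Sum>\<mu>\<in>W. wcomp \<mu> w) \<in> lattice"
    unfolding V.lin_sum[OF lin_free_act] by (rule lattice_sum)
  then show ?thesis by (simp add: wcomp_sum)
qed

text \<open>A monomial of weight \<Lambda> has k = 0 in \<open>monomial_weight\<close>, so it is
  \<open>v\<close>. The integer found here is the coordinate by which integrality is tested
  later.\<close>

lemma wcomp_Lambda_lattice:
  assumes "w \<in> lattice"
  shows "\<exists>n::int. wcomp \<Lambda> w = vscale (of_int n) v"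
proof -
  have "wcomp \<Lambda> w \<in> group_closure {v}"
  proof (rule group_closure_additive_image[of "wcomp \<Lambda>" monomials])
    fix w assume w: "w \<in> monomials"
    then obtain \<mu> k where \<mu>: "\<mu> \<in> functionals" "w \<in> wsp \<mu>" "\<mu> height_elt = \<Lambda> height_elt - of_nat k" "k = 0 \<Longrightarrow> w = v"
      using monomial_weight by blast
    have "wcomp \<Lambda> w = (if \<Lambda> = \<mu> then w else 0)"
      by (rule wcomp_weight_vector[OF \<mu>(2,1) Lambda_functional])
    moreover have "w = v" if "\<Lambda> = \<mu>" using \<mu>(3,4) that by simp
    ultimately show "wcomp \<Lambda> w \<in> group_closure {v}"
      by (auto intro: group_closure.base)
  qed (use assms in \<open>simp_all add: lattice_def wcomp_simps Lambda_functional\<close>)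
  then show ?thesis
  proof (induction rule: group_closure.induct)
    case (base s)
    then show ?case by (auto intro: exI[of _ 0] exI[of _ 1])
  next
    case (diff s t)
    then obtain m n where "s = vscale (of_int m) v" "t = vscale (of_int n) v" by blast
    then show ?case by (intro exI[of _ "m - n"]) (simp add: V.scale_left_diff_distrib)
  qed
qed

section \<open>The Kostant form and the lattice\<close>

abbreviation "Kf \<equiv> kostant_form scale bracket H I h x"

text \<open>Elements of the form are cosets, so the induction carries a representative that
  preserves the whole lattice; knowing only its value at \<open>v\<close> would not pass through
  products.\<close>

lemma kostant_form_acts:
  assumes "u \<in> Kf"
  shows "\<exists>f. u = cls f \<and> (\<forall>w\<in>lattice. uact f w \<in> lattice)"
  using assms unfolding kostant_form_def
proof (induction rule: generate_ring.induct)
  case one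
  show ?case by (rule exI[of _ 1]) (simp add: envelope_class_simps)
next
  case (incl u)
  then consider \<beta> m where "\<beta> \<in> \<Delta>" "u = cls (divided_power (x \<beta>) m)" | i m where "i \<in> I" "u = cls (binomial_elt (h i) m)"
    by blast
  then show ?case
  proof cases
    case 1
    then show ?thesis
      by (intro exI[of _ "divided_power (x \<beta>) m"]) (simp add: free_act_divided_power dpow_lattice)
  next
    case 2
    then show ?thesis
      by (intro exI[of _ "binomial_elt (h i) m"]) (simp add: binomial_lattice)
  qed
next
  case (a_inv u)
  then obtain f where "u = cls f" "\<forall>w\<in>lattice. uact f w \<in> lattice" by blast
  then show ?case
    by (intro exI[of _ "- f"]) (simp add: envelope_class_simps free_act_minus lattice_minus)
next
  case (eng_add u u')
  then obtain f f' where "u = cls f" "\<forall>w\<in>lattice. uact f w \<in> lattice"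
    "u' = cls f'" "\<forall>w\<in>lattice. uact f' w \<in> lattice" by blast
  then show ?case
    by (intro exI[of _ "f + f'"]) (simp add: envelope_class_simps free_act_add lattice_add)
next
  case (eng_mult u u')
  then obtain f f' where "u = cls f" "\<forall>w\<in>lattice. uact f w \<in> lattice"
    "u' = cls f'" "\<forall>w\<in>lattice. uact f' w \<in> lattice" by blast
  then show ?case
    by (intro exI[of _ "f * f'"]) (simp add: envelope_class_simps free_act_mult)
qed

abbreviation "V_Z \<equiv> lattice_Z scale bracket H I h x vscale act v"

lemma lattice_Z_I: "cls f \<in> Kf \<Longrightarrow> uact f v \<in> V_Z"
  unfolding lattice_Z_def using envelope_act_class[of f v, symmetric] by blast

lemma lattice_Z_E:
  assumes "w \<in> V_Z"
  obtains f where "cls f \<in> Kf" "w = uact f v" "w \<in> lattice"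
proof -
  obtain u where u: "u \<in> Kf" "w = envelope_act vscale act u v" using assms unfolding lattice_Z_def by blast
  obtain f where "u = cls f" "\<forall>w\<in>lattice. uact f w \<in> lattice" using kostant_form_acts[OF u(1)] by blast
  then show thesis using that[of f] u v_lattice by (simp add: envelope_act_class)
qed

lemma Kf_closed:
  shows Kf_one: "cls 1 \<in> Kf"
    and Kf_diff: "cls f \<in> Kf \<Longrightarrow> cls k \<in> Kf \<Longrightarrow> cls (f - k) \<in> Kf"
    and Kf_mult: "cls f \<in> Kf \<Longrightarrow> cls k \<in> Kf \<Longrightarrow> cls (f * k) \<in> Kf"
    and Kf_divided_power: "\<beta> \<in> \<Delta> \<Longrightarrow> cls (divided_power (x \<beta>) n) \<in> Kf"
proof -
  show "cls 1 \<in> Kf"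
    unfolding kostant_form_def envelope_class_simps(3)[symmetric] by (rule generate_ring.one)
  show "cls (f * k) \<in> Kf" if "cls f \<in> Kf" "cls k \<in> Kf" for f k
    using that unfolding kostant_form_def envelope_class_simps(1)[symmetric] by (rule generate_ring.eng_mult)
  show "cls (f - k) \<in> Kf" if "cls f \<in> Kf" "cls k \<in> Kf" for f k
  proof -
    have "cls f \<oplus>\<^bsub>Ug\<^esub> (\<ominus>\<^bsub>Ug\<^esub> cls k) \<in> Kf"
      using that unfolding kostant_form_def by (intro generate_ring.eng_add generate_ring.a_inv)
    then show ?thesis by (simp add: envelope_class_simps)
  qed
  show "cls (divided_power (x \<beta>) n) \<in> Kf" if "\<beta> \<in> \<Delta>"
    unfolding kostant_form_def by (rule generate_ring.incl) (use that in blast)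
qed

theorem lattice_Z_eq_lattice: "V_Z = lattice"
proof
  show "V_Z \<subseteq> lattice"
  proof
    fix w assume "w \<in> V_Z"
    then show "w \<in> lattice" by (rule lattice_Z_E)
  qed
  have mon: "w \<in> V_Z" if "w \<in> monomials" for w
    using that
  proof (induction rule: monomials.induct)
    case base
    show ?case using lattice_Z_I[OF Kf_one] by simp
  next
    case (step w i n)
    obtain f where "cls f \<in> Kf" "w = uact f v" by (rule lattice_Z_E[OF step.IH])
    then show ?case
      using lattice_Z_I[OF Kf_mult[OF Kf_divided_power[OF minus_root[OF simple_root[OF step(2)]], of n]], of f]
      by (simp add: free_act_mult free_act_divided_power)
  qed
  show "lattice \<subseteq> V_Z"
  proof
    fix w assume "w \<in> lattice"
    then show "w \<in> V_Z" unfolding lattice_def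
    proof (induction rule: group_closure.induct)
      case (base s)
      \<comment> \<open>\<open>group_closure.base\<close> also admits 0, which is reached as the
        action of 1 - 1.\<close>
      have "cls (1 - 1) \<in> Kf" by (rule Kf_diff[OF Kf_one Kf_one])
      from lattice_Z_I[OF this] show ?case using base mon by auto
    next
      case (diff s t)
      obtain f where f: "cls f \<in> Kf" "s = uact f v" by (rule lattice_Z_E[OF diff.IH(1)])
      obtain k where k: "cls k \<in> Kf" "t = uact k v" by (rule lattice_Z_E[OF diff.IH(2)])
      show ?case using lattice_Z_I[OF Kf_diff[OF f(1) k(1)]] f(2) k(2) by (simp add: free_act_diff)
    qed
  qed
qed

end

section \<open>Integrality of multiples of root vectors\<close>

text \<open>Write z = a / b in lowest terms: every power of b divides n, so b = 1. The case k = 1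
  already makes z rational.\<close>

lemma Ints_of_bounded_denominators:
  fixes z :: "'a::field_char_0"
  assumes n: "n \<noteq> (0::int)" and pow: "\<And>k::nat. z ^ k * of_int n \<in> \<int>"
  shows "z \<in> \<int>"
proof -
  obtain p where "z * of_int n = of_int p" using pow[of 1] by (auto elim: Ints_cases)
  then have "z = of_int p / of_int n" using n by (simp add: field_simps)
  then have "z \<in> \<rat>" by simp
  then obtain a b :: int where ab: "b > 0" "coprime a b" "z = of_int a / of_int b"
    by (rule Rats_cases')
  have dvd: "b ^ k dvd n" for k
  proof -
    obtain q where "z ^ k * of_int n = of_int q" using pow[of k] by (auto elim: Ints_cases)
    then have "(of_int (a ^ k * n) :: 'a) = of_int (q * b ^ k)"
      using ab(1) by (simp add: ab(3) field_simps)
    then have "a ^ k * n = q * b ^ k" by (simp only: of_int_eq_iff)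
    then have "b ^ k dvd a ^ k * n" by simp
    moreover have "coprime (b ^ k) (a ^ k)" using ab(2) by (simp add: coprime_commute)
    ultimately show ?thesis by (simp add: coprime_dvd_mult_right_iff)
  qed
  have "b = 1"
  proof (rule ccontr)
    assume "b \<noteq> 1"
    then have b2: "b \<ge> 2" using ab(1) by simp
    have "\<bar>n\<bar> < 2 ^ nat \<bar>n\<bar>"
    proof -
      have "nat \<bar>n\<bar> < 2 ^ nat \<bar>n\<bar>" by (rule less_exp)
      then have "int (nat \<bar>n\<bar>) < int (2 ^ nat \<bar>n\<bar>)" by (simp only: of_nat_less_iff)
      then show ?thesis by simp
    qed
    also have "(2::int) ^ nat \<bar>n\<bar> \<le> b ^ nat \<bar>n\<bar>" using b2 by (intro power_mono) auto
    also have "\<dots> \<le> \<bar>n\<bar>" using dvd_imp_le_int[OF n dvd[of "nat \<bar>n\<bar>"]] ab(1) by simp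
    finally show False by simp
  qed
  then show ?thesis using ab(3) by simp
qed

text \<open>The square of the denominator divides 2, which is squarefree.\<close>

lemma Ints_of_twice_square:
  fixes c :: "'a::field_char_0"
  assumes "c \<in> \<rat>" "2 * c\<^sup>2 \<in> \<int>"
  shows "c \<in> \<int>"
proof -
  obtain a b :: int where ab: "b > 0" "coprime a b" "c = of_int a / of_int b"
    using assms(1) by (rule Rats_cases')
  obtain m where m: "2 * c\<^sup>2 = of_int m" using assms(2) by (auto elim: Ints_cases)
  then have "(of_int (a\<^sup>2 * 2) :: 'a) = of_int (m * b\<^sup>2)"
    using ab(1) by (simp add: ab(3) field_simps)
  then have "a\<^sup>2 * 2 = m * b\<^sup>2" by (simp only: of_int_eq_iff)
  then have "b\<^sup>2 dvd a\<^sup>2 * 2" by simp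
  moreover have "coprime (b\<^sup>2) (a\<^sup>2)" using ab(2) by (simp add: coprime_commute)
  ultimately have "b\<^sup>2 dvd 2" by (simp add: coprime_dvd_mult_right_iff)
  then have "b\<^sup>2 \<le> 2" by (rule zdvd_imp_le) simp
  have "b = 1"
  proof (rule ccontr)
    assume "b \<noteq> 1"
    then have "2 * 2 \<le> b * b" using ab(1) by (intro mult_mono) auto
    then show False using \<open>b\<^sup>2 \<le> 2\<close> by (simp add: power2_eq_square)
  qed
  then show ?thesis using ab(3) by simp
qed

context highest_weight_module
begin

text \<open>Words in root vectors preserve the lattice, and they detect submodules because each
  \<open>h i\<close> is a commutator of root vectors. A new factor is applied first, which makes the
  subspace in \<open>xops_reach_highest\<close> stable by construction.\<close>

inductive_set xops :: "('v \<Rightarrow> 'v) set" where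
  id: "(\<lambda>w. w) \<in> xops"
| comp: "f \<in> xops \<Longrightarrow> \<beta> \<in> \<Delta> \<Longrightarrow> (\<lambda>w. f (act (x \<beta>) w)) \<in> xops"

lemma xops_props:
  assumes "f \<in> xops"
  shows lin_xops: "V.lin f" and xops_lattice: "w \<in> lattice \<Longrightarrow> f w \<in> lattice"
proof -
  have "V.lin f \<and> (\<forall>w\<in>lattice. f w \<in> lattice)"
    using assms
  proof (induction rule: xops.induct)
    case id
    then show ?case by (auto intro: V.linI)
  next
    case (comp f \<beta>)
    then show ?case by (auto intro!: V.linI simp: V.lin_simps act_lattice)
  qed
  then show "V.lin f" "w \<in> lattice \<Longrightarrow> f w \<in> lattice" by auto
qed

lemma irreducible_submodule:
  assumes "V.subspace N" "\<And>\<beta> w. \<beta> \<in> \<Delta> \<Longrightarrow> w \<in> N \<Longrightarrow> act (x \<beta>) w \<in> N"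
  shows "N = {0} \<or> N = UNIV"
proof -
  have "\<forall>w\<in>N. act y w \<in> N" for y
  proof (rule basis_induct[where P = "\<lambda>y. \<forall>w\<in>N. act y w \<in> N"])
    fix i assume i: "i \<in> I"
    have "act (h i) w = act (x (\<alpha> i)) (act (x (- \<alpha> i)) w) - act (x (- \<alpha> i)) (act (x (\<alpha> i)) w)" for w
      using sl2_relations(1)[OF simple_root[OF i], of w] by simp
    then show "\<forall>w\<in>N. act (h i) w \<in> N"
      using assms simple_root[OF i] minus_root[OF simple_root[OF i]] V.subspace_diff[OF assms(1)] by simp
  qed (simp_all add: assms V.subspace_0[OF assms(1)] V.subspace_add[OF assms(1)] V.subspace_scale[OF assms(1)])
  then show ?thesis
    using irreducible assms(1) unfolding irreducible_action_def by blast
qed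

text \<open>The vectors that every word sends to something without \<Lambda>-component form a
  submodule. It misses \<open>v\<close>, so by irreducibility it is zero.\<close>

lemma xops_reach_highest:
  assumes "w \<noteq> 0"
  shows "\<exists>f\<in>xops. wcomp \<Lambda> (f w) \<noteq> 0"
proof (rule ccontr)
  assume no: "\<not> ?thesis"
  let ?N = "{w. \<forall>f\<in>xops. wcomp \<Lambda> (f w) = 0}"
  have "?N = {0} \<or> ?N = UNIV"
  proof (rule irreducible_submodule)
    show "V.subspace ?N"
    proof (rule V.subspaceI)
      show "0 \<in> ?N"
        by (simp add: V.lin_zero[OF lin_xops] wcomp_simps(3)[OF Lambda_functional])
      fix a b c assume a: "a \<in> ?N"
      have "wcomp \<Lambda> (f (vscale c a)) = 0" if f: "f \<in> xops" for f
        using a f by (simp add: V.lin_scale[OF lin_xops[OF f]] wcomp_simps(2)[OF Lambda_functional])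
      then show "vscale c a \<in> ?N" by blast
      assume b: "b \<in> ?N"
      have "wcomp \<Lambda> (f (a + b)) = 0" if f: "f \<in> xops" for f
        using a b f by (simp add: V.lin_add[OF lin_xops[OF f]] wcomp_simps(1)[OF Lambda_functional])
      then show "a + b \<in> ?N" by blast
    qed
    fix \<beta> w assume \<beta>: "\<beta> \<in> \<Delta>" and w: "w \<in> ?N"
    have "wcomp \<Lambda> (f (act (x \<beta>) w)) = 0" if f: "f \<in> xops" for f
      by (rule bspec[OF CollectD[OF w] xops.comp[OF f \<beta>]])
    then show "act (x \<beta>) w \<in> ?N" by blast
  qed
  moreover have "v \<notin> ?N"
  proof
    assume "v \<in> ?N"
    from bspec[OF CollectD[OF this] xops.id] have "wcomp \<Lambda> v = 0" .
    then show False
      using wcomp_weight_vector[OF v_weight Lambda_functional Lambda_functional] v_nonzero by simp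
  qed
  moreover have "w \<in> ?N" using no by blast
  ultimately show False using assms by blast
qed

text \<open>A word takes w to a vector with \<Lambda>-component n \<open>v\<close>, where n is
  nonzero. If c w is in the lattice, then c n \<open>v\<close> is an integer multiple of
  \<open>v\<close>; so n bounds the denominators of all such c at once.\<close>

lemma xops_lattice_coefficient:
  assumes "w \<in> lattice" "w \<noteq> 0"
  obtains f n where "f \<in> xops" "n \<noteq> (0::int)"
    "\<And>c. vscale c w \<in> lattice \<Longrightarrow> c * of_int n \<in> \<int>"
proof -
  obtain f where f: "f \<in> xops" "wcomp \<Lambda> (f w) \<noteq> 0" using xops_reach_highest[OF assms(2)] by blast
  obtain n :: int where n: "wcomp \<Lambda> (f w) = vscale (of_int n) v"
    using wcomp_Lambda_lattice[OF xops_lattice[OF f(1) assms(1)]] by blast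
  have "n \<noteq> 0" using f(2) n by auto
  moreover have "c * of_int n \<in> \<int>" if c: "vscale c w \<in> lattice" for c
  proof -
    obtain m :: int where m: "wcomp \<Lambda> (f (vscale c w)) = vscale (of_int m) v"
      using wcomp_Lambda_lattice[OF xops_lattice[OF f(1) c]] by blast
    have "wcomp \<Lambda> (f (vscale c w)) = vscale (c * of_int n) v"
      by (simp add: V.lin_scale[OF lin_xops[OF f(1)]] wcomp_simps[OF Lambda_functional] n)
    then have "c * of_int n = of_int m" using m v_nonzero by simp
    then show ?thesis by simp
  qed
  ultimately show thesis using that f(1) by blast
qed

lemma lattice_spans: "V.span lattice = UNIV"
proof -
  have "V.span lattice = {0} \<or> V.span lattice = UNIV"
  proof (rule irreducible_submodule)
    show "act (x \<beta>) w \<in> V.span lattice" if "\<beta> \<in> \<Delta>" "w \<in> V.span lattice" for \<beta> w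
      using that(2)
      by (induction rule: V.span_induct_alt)
        (simp_all add: V.span_zero V.span_add V.span_scale V.span_base act_lattice that(1))
  qed simp
  moreover have "v \<in> V.span lattice" by (rule V.span_base[OF v_lattice])
  ultimately show ?thesis using v_nonzero by blast
qed

text \<open>If \<open>c x\<^sub>\<beta>\<close> preserves the lattice, then so do \<open>c x\<^sub>-\<^sub>\<beta>\<close>, up to sign half the square of \<open>ad x\<^sub>-\<^sub>\<beta>\<close> applied to
  \<open>c x\<^sub>\<beta>\<close>, and \<open>c\<^sup>2 h\<^sub>\<beta>\<close>. Evaluating the latter on weights that differ by \<open>\<beta>\<close> gives \<open>2 c\<^sup>2 \<in> \<int>\<close>.\<close>

theorem root_vector_multiple_integral:
  assumes \<beta>: "\<beta> \<in> \<Delta>" and c: "\<And>w. w \<in> lattice \<Longrightarrow> vscale c (act (x \<beta>) w) \<in> lattice"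
  shows "c \<in> \<int>"
proof -
  define y where "y = x (- \<beta>)"
  let ?e = "act (x \<beta>)" and ?f = "act y" and ?h = "act (coroot \<beta>)"
  have m: "- \<beta> \<in> \<Delta>" by (rule minus_root[OF \<beta>])
  have f: "vscale c (?f w) \<in> lattice" if w: "w \<in> lattice" for w
  proof -
    let ?d = "dpow vscale ?f 2"
    have 1: "bracket y (x \<beta>) = - coroot \<beta>"
      using bracket_antisym[of "x (- \<beta>)" "x \<beta>"] bracket_x_minus[OF \<beta>] by (simp add: y_def)
    have 2: "bracket y (coroot \<beta>) = scale 2 y"
      using bracket_x_H[OF coroot_in_H[OF \<beta>] m] \<beta> by (simp add: y_def)
    \<comment> \<open>The Leibniz rule of order 2: \<open>bracket y\<close> takes
      \<open>x \<beta>\<close> to minus the coroot, and half its square takes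
      \<open>x \<beta>\<close> to -y.\<close>
    have "?d (?e w) = ?e (?d w) - ?h (?f w) - ?f w"
      using dpow_act[of y 2 "x \<beta>" w]
      by (simp add: numeral_2_eq_2 dpow_def[of scale] 1 2)
    then have "?f w = ?e (?d w) - ?h (?f w) - ?d (?e w)" by simp
    \<comment> \<open>With \<open>?h\<close> written as a commutator every term contains
      \<open>?e\<close> exactly once, so the factor c can be attached to it.\<close>
    also have "?h (?f w) = ?e (?f (?f w)) - ?f (?e (?f w))"
      using sl2_relations(1)[OF \<beta>, folded y_def, of "?f w"] by simp
    finally have ff: "?f w = ?e (?d w) - (?e (?f (?f w)) - ?f (?e (?f w))) - ?d (?e w)" .
    have "vscale c (?f w) = vscale c (?e (?d w)) - (vscale c (?e (?f (?f w))) - ?f (vscale c (?e (?f w)))) - ?d (vscale c (?e w))"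
      using arg_cong[OF ff, of "vscale c"]
      by (simp only: V.scale_right_diff_distrib act_right(2) V.lin_scale[OF lin_dpow_act])
    also have "\<dots> \<in> lattice"
      by (intro lattice_diff c dpow_lattice[OF m, folded y_def] act_lattice[OF m, folded y_def] w)
    finally show ?thesis .
  qed
  have hc: "vscale (c\<^sup>2) (?h w) \<in> lattice" if w: "w \<in> lattice" for w
  proof -
    have "vscale (c\<^sup>2) (?h w) = vscale c (?e (vscale c (?f w))) - vscale c (?f (vscale c (?e w)))"
      using sl2_relations(1)[OF \<beta>, folded y_def, of w] by (simp add: V.scale_right_distrib power2_eq_square)
    also have "\<dots> \<in> lattice" by (intro lattice_diff c f w)
    finally show ?thesis .
  qed
  \<comment> \<open>Iterating \<open>hc\<close> multiplies w by all powers of the eigenvalue without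
    leaving the lattice, so their denominators are bounded.\<close>
  have eigen: "c\<^sup>2 * \<mu> (coroot \<beta>) \<in> \<int>" if \<mu>: "w \<in> wsp \<mu>" and w: "w \<in> lattice" "w \<noteq> 0" for w \<mu>
  proof -
    let ?z = "c\<^sup>2 * \<mu> (coroot \<beta>)"
    have "vscale (?z ^ k) w \<in> lattice" for k
    proof (induction k)
      case (Suc k)
      have "vscale (?z ^ Suc k) w = vscale (c\<^sup>2) (?h (vscale (?z ^ k) w))"
        using wspD[OF \<mu> coroot_in_H[OF \<beta>]] by (simp add: mult_ac)
      then show ?case using hc[OF Suc] by simp
    qed (simp add: w)
    moreover obtain g n where "g \<in> xops" "n \<noteq> (0::int)" "\<And>c. vscale c w \<in> lattice \<Longrightarrow> c * of_int n \<in> \<int>"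
      using xops_lattice_coefficient[OF w] by blast
    ultimately show ?thesis using Ints_of_bounded_denominators[of n ?z] by blast
  qed
  have "\<exists>w\<in>lattice. ?e w \<noteq> 0"
  proof (rule ccontr)
    assume "\<not> ?thesis"
    then have z: "?e w = 0" if "w \<in> lattice" for w using that by blast
    have l0: "V.lin (\<lambda>_. 0)" by (rule V.linI) simp_all
    have "?e w = 0" for w
      by (rule V.lin_eq_on_span[OF act_linear_right l0, of lattice]) (simp_all add: z lattice_spans)
    then show False using faithful x_nonzero[OF \<beta>] unfolding faithful_action_def by blast
  qed
  then obtain w where w: "w \<in> lattice" "?e w \<noteq> 0" by blast
  have "\<exists>\<mu>\<in>W. ?e (wcomp \<mu> w) \<noteq> 0"
  proof (rule ccontr)
    assume "\<not> ?thesis"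
    then have "?e (\<Sum>\<mu>\<in>W. wcomp \<mu> w) = 0" unfolding act_sum_right by (simp add: sum.neutral)
    then show False using w(2) by (simp add: wcomp_sum)
  qed
  then obtain \<mu> where \<mu>: "\<mu> \<in> W" "?e (wcomp \<mu> w) \<noteq> 0" by blast
  define w0 where "w0 = wcomp \<mu> w"
  have w0: "w0 \<in> wsp \<mu>" "w0 \<in> lattice" "?e w0 \<noteq> 0"
    using \<mu> wcomp_in wcomp_lattice[OF w(1) weight_dual] by (simp_all add: w0_def)
  then have nz: "w0 \<noteq> 0" by auto
  have w1: "?e w0 \<in> wsp (\<mu> + \<beta>)" "?e w0 \<in> lattice"
    using act_root_space[OF x_in[OF \<beta>] w0(1)] act_lattice[OF \<beta> w0(2)] by auto
  have "c\<^sup>2 * (\<mu> + \<beta>) (coroot \<beta>) - c\<^sup>2 * \<mu> (coroot \<beta>) \<in> \<int>"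
    by (rule Ints_diff[OF eigen[OF w1 w0(3)] eigen[OF w0(1,2) nz]])
  then have "2 * c\<^sup>2 \<in> \<int>" using \<beta> by (simp add: algebra_simps)
  \<comment> \<open>Integrality of 2c^2 alone would allow an irrational c, such as the square root
    of 1/2.\<close>
  moreover have "c \<in> \<rat>"
  proof -
    obtain g n where "g \<in> xops" "n \<noteq> (0::int)" "\<And>c. vscale c (?e w0) \<in> lattice \<Longrightarrow> c * of_int n \<in> \<int>"
      using xops_lattice_coefficient[OF w1(2) w0(3)] by blast
    then have "c * of_int n \<in> \<int>" using c[OF w0(2)] by blast
    then obtain k where "c * of_int n = of_int k" by (rule Ints_cases)
    then have "c = of_int k / of_int n" using \<open>n \<noteq> 0\<close> by (simp add: field_simps)
    then show ?thesis by simp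
  qed
  ultimately show ?thesis by (rule Ints_of_twice_square[rotated])
qed

section \<open>The integral group stabilizes the lattice\<close>

lemma root_elt_eq: "root_elt vscale act x \<beta> u = texp \<beta> (of_rat u)"
  by (simp add: root_elt_def texp_def)

lemma texp_Bij: "\<beta> \<in> \<Delta> \<Longrightarrow> texp \<beta> u \<in> Bij UNIV"
proof -
  assume \<beta>: "\<beta> \<in> \<Delta>"
  have "bij (texp \<beta> u)"
    by (rule o_bij[of "texp \<beta> (- u)"]) (simp_all add: fun_eq_iff texp_add[OF \<beta>] texp_0[OF \<beta>])
  then show ?thesis by (simp add: Bij_def)
qed

lemma inv_texp: "\<beta> \<in> \<Delta> \<Longrightarrow> inv\<^bsub>BijGroup UNIV\<^esub> (texp \<beta> u) = texp \<beta> (- u)"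
proof -
  assume \<beta>: "\<beta> \<in> \<Delta>"
  have "inv_into UNIV (texp \<beta> u) = texp \<beta> (- u)"
    by (rule inv_unique_comp) (simp_all add: fun_eq_iff texp_add[OF \<beta>] texp_0[OF \<beta>])
  then show ?thesis using inv_BijGroup[OF texp_Bij[OF \<beta>, of u]] by (simp add: restrict_UNIV)
qed

lemma texp_lattice_int: "\<beta> \<in> \<Delta> \<Longrightarrow> u \<in> \<int> \<Longrightarrow> w \<in> lattice \<Longrightarrow> texp \<beta> u w \<in> lattice"
  by (rule texp_lattice) (simp_all add: dpow_lattice)

lemma texp_lattice_eq: "\<beta> \<in> \<Delta> \<Longrightarrow> u \<in> \<int> \<Longrightarrow> texp \<beta> u ` lattice = lattice"
proof
  assume \<beta>: "\<beta> \<in> \<Delta>" and u: "u \<in> \<int>"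
  show "texp \<beta> u ` lattice \<subseteq> lattice" using texp_lattice_int[OF \<beta> u] by blast
  show "lattice \<subseteq> texp \<beta> u ` lattice"
  proof
    fix w assume w: "w \<in> lattice"
    have "w = texp \<beta> u (texp \<beta> (- u) w)" by (simp add: texp_add[OF \<beta>] texp_0[OF \<beta>])
    moreover have "texp \<beta> (- u) w \<in> lattice" using texp_lattice_int[OF \<beta> _ w, of "- u"] u by simp
    ultimately show "w \<in> texp \<beta> u ` lattice" by blast
  qed
qed

text \<open>A closed form of \<open>h i\<close> at -1, which \<open>torus_elt\<close> gives by a
  definite description. The floor of the real part merely reads \<mu>(\<open>h i\<close>) as an
  integer.\<close>

definition sign_elt :: "'i \<Rightarrow> 'v \<Rightarrow> 'v" where
  "sign_elt i w = (\<Sum>\<mu>\<in>W. vscale ((- 1) powi \<lfloor>Re (\<mu> (h i))\<rfloor>) (wcomp \<mu> w))"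

lemma lin_sign_elt: "V.lin (sign_elt i)"
  unfolding sign_elt_def
  by (rule V.linI)
    (simp_all add: wcomp_simps weight_dual V.scale_right_distrib sum.distrib V.scale_sum_right mult.commute)

lemma sign_elt_weight_vector:
  assumes "\<mu> \<in> W" "w \<in> wsp \<mu>"
  shows "sign_elt i w = vscale ((- 1) powi \<lfloor>Re (\<mu> (h i))\<rfloor>) w"
proof -
  have "sign_elt i w = (\<Sum>\<nu>\<in>W. if \<nu> = \<mu> then vscale ((- 1) powi \<lfloor>Re (\<mu> (h i))\<rfloor>) w else 0)"
    unfolding sign_elt_def
    by (rule sum.cong) (simp_all add: wcomp_weight_vector[OF assms(2) weight_dual[OF assms(1)] weight_dual])
  then show ?thesis using assms(1) by (simp add: finite_weights)
qed

lemma torus_elt_minus_one: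
  assumes i: "i \<in> I"
  shows "torus_elt scale H vscale act (h i) (- 1) = sign_elt i"
  unfolding torus_elt_def
proof (rule the_equality, intro conjI ballI allI impI)
  show "V.lin (sign_elt i)" by (rule lin_sign_elt)
  fix \<mu> m w assume "\<mu> \<in> W" "\<mu> (h i) = of_int m" "w \<in> wsp \<mu>"
  then show "sign_elt i w = vscale (of_rat (- 1) powi m) w" by (simp add: sign_elt_weight_vector of_rat_minus)
next
  fix f assume f: "V.lin f \<and> (\<forall>\<mu>\<in>W. \<forall>m::int. \<mu> (h i) = of_int m \<longrightarrow>
           (\<forall>w\<in>wsp \<mu>. f w = vscale (of_rat (- 1) powi m) w))"
  show "f = sign_elt i"
  proof
    show "f w = sign_elt i w" for w
    proof (rule lin_eq_on_weight_vectors[OF conjunct1[OF f] lin_sign_elt])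
      fix \<mu> w assume a: "\<mu> \<in> W" "w \<in> wsp \<mu>"
      obtain m where m: "\<mu> (h i) = of_int m" using weights_integral[OF a(1) i] by (rule Ints_cases)
      then have "f w = vscale (of_rat (- 1) powi m) w" using f a by blast
      then show "f w = sign_elt i w" using m by (simp add: sign_elt_weight_vector[OF a] of_rat_minus)
    qed
  qed
qed

lemma sign_elt_involution: "sign_elt i (sign_elt i w) = w"
proof (rule lin_eq_on_weight_vectors[of "\<lambda>w. sign_elt i (sign_elt i w)" "\<lambda>w. w"])
  show "V.lin (\<lambda>w. sign_elt i (sign_elt i w))" "V.lin (\<lambda>w. w)"
    by (auto intro!: V.linI simp: V.lin_simps[OF lin_sign_elt])
  fix \<mu> w assume a: "\<mu> \<in> W" "w \<in> wsp \<mu>"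
  show "sign_elt i (sign_elt i w) = w"
    by (simp add: sign_elt_weight_vector[OF a] V.lin_scale[OF lin_sign_elt] power_int_mult_distrib[symmetric])
qed

lemma sign_elt_lattice: "w \<in> lattice \<Longrightarrow> sign_elt i w \<in> lattice"
  unfolding sign_elt_def
proof (rule lattice_sum)
  fix \<mu> assume "w \<in> lattice" "\<mu> \<in> W"
  then have "wcomp \<mu> w \<in> lattice" by (simp add: wcomp_lattice weight_dual)
  moreover have "(- 1 :: complex) powi m \<in> \<int>" for m
    by (cases "even m") (simp_all add: power_int_minus_left)
  ultimately show "vscale ((- 1) powi \<lfloor>Re (\<mu> (h i))\<rfloor>) (wcomp \<mu> w) \<in> lattice" by (rule lattice_int_scale)
qed

lemma sign_elt_Bij: "sign_elt i \<in> Bij UNIV"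
  and sign_elt_inv: "inv\<^bsub>BijGroup UNIV\<^esub> (sign_elt i) = sign_elt i"
  and sign_elt_lattice_eq: "sign_elt i ` lattice = lattice"
proof -
  have "bij (sign_elt i)"
    by (rule o_bij[of "sign_elt i"]) (simp_all add: fun_eq_iff sign_elt_involution)
  then show B: "sign_elt i \<in> Bij UNIV" by (simp add: Bij_def)
  have "inv_into UNIV (sign_elt i) = sign_elt i"
    by (rule inv_unique_comp) (simp_all add: fun_eq_iff sign_elt_involution)
  then show "inv\<^bsub>BijGroup UNIV\<^esub> (sign_elt i) = sign_elt i" using inv_BijGroup[OF B] by (simp add: restrict_UNIV)
  show "sign_elt i ` lattice = lattice"
  proof
    show "sign_elt i ` lattice \<subseteq> lattice" using sign_elt_lattice by blast
    show "lattice \<subseteq> sign_elt i ` lattice"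
    proof
      fix w assume "w \<in> lattice"
      then have "sign_elt i w \<in> lattice" by (rule sign_elt_lattice)
      then show "w \<in> sign_elt i ` lattice" using sign_elt_involution[of i w] by (metis imageI)
    qed
  qed
qed

lemma BijGroup_UNIV_simps:
  "carrier (BijGroup UNIV) = Bij UNIV" "\<one>\<^bsub>BijGroup UNIV\<^esub> = (\<lambda>w. w)"
  "g \<in> Bij UNIV \<Longrightarrow> f \<in> Bij UNIV \<Longrightarrow> g \<otimes>\<^bsub>BijGroup UNIV\<^esub> f = (\<lambda>w. g (f w))"
  by (simp_all add: BijGroup_def compose_def restrict_UNIV)

abbreviation "G_Z \<equiv> chevalley_Z scale bracket H I h x vscale act"
abbreviation "G_Q \<equiv> chevalley_Q scale bracket H I h x vscale act"
abbreviation "U_Q \<equiv> unipotent_Q scale bracket H I \<alpha> x vscale act"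

lemma G_Z_generators:
  assumes "g \<in> {root_elt vscale act x \<beta> u | \<beta> u. \<beta> \<in> \<Delta> \<and> u \<in> \<int>} \<union>
      {torus_elt scale H vscale act (h i) (- 1) | i. i \<in> I}"
  shows "(\<exists>\<beta>\<in>\<Delta>. \<exists>u\<in>\<int>. g = texp \<beta> u) \<or> (\<exists>i\<in>I. g = sign_elt i)"
proof -
  from assms consider \<beta> u where "\<beta> \<in> \<Delta>" "u \<in> \<int>" "g = root_elt vscale act x \<beta> u"
    | i where "i \<in> I" "g = torus_elt scale H vscale act (h i) (- 1)"
    by blast
  then show ?thesis
  proof cases
    case 1
    have "(of_rat u :: complex) \<in> \<int>" using 1(2) by (auto elim!: Ints_cases)
    then show ?thesis using 1 root_elt_eq by blast
  next
    case 2
    then show ?thesis using torus_elt_minus_one by blast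
  qed
qed

lemma G_Z_generators_Bij:
  assumes "(\<exists>\<beta>\<in>\<Delta>. \<exists>u\<in>\<int>. g = texp \<beta> u) \<or> (\<exists>i\<in>I. g = sign_elt i)"
  shows "g \<in> Bij UNIV" "g ` lattice = lattice" "inv\<^bsub>BijGroup UNIV\<^esub> g \<in> Bij UNIV"
    "(inv\<^bsub>BijGroup UNIV\<^esub> g) ` lattice = lattice"
  using assms
  by (elim disjE bexE; simp add: texp_Bij texp_lattice_eq inv_texp sign_elt_inv sign_elt_Bij sign_elt_lattice_eq)+

lemma G_Z_Bij: "G_Z \<subseteq> Bij UNIV"
proof -
  have "G_Z \<subseteq> carrier (BijGroup UNIV)"
    unfolding chevalley_Z_def
  proof (rule group.generate_incl[OF group_BijGroup], rule subsetI)
    fix g assume "g \<in> {root_elt vscale act x \<beta> u | \<beta> u. \<beta> \<in> \<Delta> \<and> u \<in> \<int>} \<union>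
      {torus_elt scale H vscale act (h i) (- 1) | i. i \<in> I}"
    from G_Z_generators_Bij(1)[OF G_Z_generators[OF this]] show "g \<in> carrier (BijGroup UNIV)"
      by (simp only: BijGroup_UNIV_simps)
  qed
  then show ?thesis by (simp only: BijGroup_UNIV_simps)
qed

lemma G_Z_stabilizes: "g \<in> G_Z \<Longrightarrow> g ` lattice = lattice"
proof -
  assume g: "g \<in> G_Z"
  have "g \<in> Bij UNIV \<and> g ` lattice = lattice"
    using g unfolding chevalley_Z_def
  proof (induction rule: generate.induct)
    case one
    have "(\<lambda>w. w) \<in> Bij UNIV" by (simp add: Bij_def bij_betw_def)
    then show ?case by (simp add: BijGroup_UNIV_simps)
  next
    case (incl g)
    show ?case using G_Z_generators_Bij(1,2)[OF G_Z_generators[OF incl]] by (rule conjI)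
  next
    case (inv g)
    show ?case using G_Z_generators_Bij(3,4)[OF G_Z_generators[OF inv]] by (rule conjI)
  next
    case (eng g f)
    have "(\<lambda>w. g (f w)) \<in> Bij UNIV"
      using compose_Bij[of g UNIV f] eng.IH by (simp add: compose_def restrict_UNIV)
    moreover have "(\<lambda>w. g (f w)) ` lattice = g ` (f ` lattice)" by (simp add: image_image)
    ultimately show ?case using eng.IH by (simp add: BijGroup_UNIV_simps)
  qed
  then show ?thesis ..
qed

lemma texp_in_G_Z: "\<beta> \<in> \<Delta> \<Longrightarrow> n \<in> \<int> \<Longrightarrow> texp \<beta> n \<in> G_Z"
proof -
  assume \<beta>: "\<beta> \<in> \<Delta>" and n: "n \<in> \<int>"
  then obtain m where "n = of_int m" by (elim Ints_cases)
  then have "texp \<beta> n = root_elt vscale act x \<beta> (of_int m)" by (simp add: root_elt_eq)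
  then show ?thesis
    unfolding chevalley_Z_def using \<beta> by (intro generate.incl) (use Ints_of_int in blast)
qed

lemma G_Z_mult: "g \<in> G_Z \<Longrightarrow> f \<in> G_Z \<Longrightarrow> (\<lambda>w. g (f w)) \<in> G_Z"
proof -
  assume g: "g \<in> G_Z" and f: "f \<in> G_Z"
  have "g \<otimes>\<^bsub>BijGroup UNIV\<^esub> f \<in> G_Z"
    using g f unfolding chevalley_Z_def by (rule generate.eng)
  then show ?thesis
    by (simp only: BijGroup_UNIV_simps(3)[OF subsetD[OF G_Z_Bij g] subsetD[OF G_Z_Bij f]])
qed

lemma G_Z_subset_G_Q: "G_Z \<subseteq> G_Q"
  unfolding chevalley_Z_def chevalley_Q_def
proof (rule group.mono_generate[OF group_BijGroup], rule Un_mono)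
  show "{torus_elt scale H vscale act (h i) (- 1) | i. i \<in> I} \<subseteq> {torus_elt scale H vscale act (h i) t | i t. i \<in> I \<and> t \<noteq> 0}"
  proof
    fix g assume "g \<in> {torus_elt scale H vscale act (h i) (- 1) | i. i \<in> I}"
    then obtain i where "i \<in> I" "g = torus_elt scale H vscale act (h i) (- 1)" by blast
    moreover have "(- 1 :: rat) \<noteq> 0" by simp
    ultimately show "g \<in> {torus_elt scale H vscale act (h i) t | i t. i \<in> I \<and> t \<noteq> 0}" by blast
  qed
qed blast

end

section \<open>The unipotent group\<close>

context chevalley
begin

text \<open>Stated for any set \<open>T\<close> closed under adding \<beta>: it is applied to all
  positive roots and, in the final induction, to the roots that remain after removing
  \<beta>.\<close>

lemma bracket_positive_span:
  assumes \<beta>: "\<beta> \<in> \<Delta>p" and T: "T \<subseteq> \<Delta>p" "\<And>\<gamma>. \<gamma> \<in> T \<Longrightarrow> \<gamma> + \<beta> \<in> \<Delta> \<Longrightarrow> \<gamma> + \<beta> \<in> T"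
    and y: "y \<in> span (x ` T)"
  shows "bracket (x \<beta>) y \<in> span (x ` T)"
  using y
proof (induction rule: span_induct_alt)
  case base
  then show ?case by (simp add: span_zero)
next
  case (step c b y)
  then obtain \<gamma> where \<gamma>: "\<gamma> \<in> T" "b = x \<gamma>" by blast
  have gR: "\<gamma> \<in> \<Delta>p" using \<gamma>(1) T(1) by blast
  have br: "bracket (x \<beta>) (x \<gamma>) \<in> gs (\<gamma> + \<beta>)"
    by (rule ad.act_root_space[OF x_in[OF pos_root[OF \<beta>]] x_in[OF pos_root[OF gR]]])
  have "bracket (x \<beta>) (x \<gamma>) \<in> span (x ` T)"
  proof (cases "\<gamma> + \<beta> \<in> \<Delta>")
    case True
    obtain c where "bracket (x \<beta>) (x \<gamma>) = scale c (x (\<gamma> + \<beta>))" using gs_root[OF True br] by blast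
    then show ?thesis using T(2)[OF \<gamma>(1) True] by (simp add: span_scale span_base)
  next
    case False
    have "\<gamma> + \<beta> \<noteq> 0"
    proof
      assume "\<gamma> + \<beta> = 0"
      then have "\<gamma> = - \<beta>" by (rule eq_neg_iff_add_eq_0[THEN iffD2])
      then show False using pos_neg_exclusive[OF \<beta>] gR by simp
    qed
    then have "bracket (x \<beta>) (x \<gamma>) = 0"
      by (rule gs_trivial[OF dual_add[OF root_dual[OF pos_root[OF gR]] root_dual[OF pos_root[OF \<beta>]]] False _ br])
    then show ?thesis by (simp add: span_zero)
  qed
  then show ?case using step.IH \<gamma>(2) by (simp add: span_add span_scale)
qed

lemma texp_positive_span:
  assumes "\<beta> \<in> \<Delta>p" "T \<subseteq> \<Delta>p" "\<And>\<gamma>. \<gamma> \<in> T \<Longrightarrow> \<gamma> + \<beta> \<in> \<Delta> \<Longrightarrow> \<gamma> + \<beta> \<in> T" "y \<in> span (x ` T)"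
  shows "adj.texp \<beta> u y \<in> span (x ` T)"
proof -
  have "(bracket (x \<beta>) ^^ n) y \<in> span (x ` T)" for n
    by (induction n) (simp_all add: assms(4) bracket_positive_span[OF assms(1-3)])
  then have "dpow scale (bracket (x \<beta>)) n y \<in> span (x ` T)" for n
    by (simp add: dpow_def span_scale)
  moreover obtain N where "\<And>u w. adj.texp \<beta> u w = (\<Sum>n<N. scale (u ^ n) (dpow scale (bracket (x \<beta>)) n w))"
    using adj.texp_sum[OF pos_root[OF assms(1)]] by blast
  ultimately show ?thesis by (simp add: span_sum span_scale)
qed

lemma pos_root_sum:
  assumes "\<gamma> \<in> \<Delta>p" "\<beta> \<in> \<Delta>p" "\<gamma> + \<beta> \<in> \<Delta>"
  shows "\<gamma> + \<beta> \<in> \<Delta>p" "ht (\<gamma> + \<beta>) = ht \<gamma> + ht \<beta>"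
proof -
  show "\<gamma> + \<beta> \<in> \<Delta>p" using assms by (auto simp: pos_root_iff)
  show "ht (\<gamma> + \<beta>) = ht \<gamma> + ht \<beta>"
    by (rule height_elt_of_nat) (simp add: pos_root_height(1)[OF assms(1)] pos_root_height(1)[OF assms(2)])
qed

text \<open>The sum of the weight spaces is a submodule, and it contains the nonzero vector
  \<open>v\<close>.\<close>

lemma weight_spaces_span_irreducible:
  assumes "lie_module scale bracket vscale act" "irreducible_action vscale act"
    and v: "\<Lambda> \<in> functionals" "v \<in> weight_space vscale act H \<Lambda>" "v \<noteq> 0"
  shows "module.span vscale (\<Union>\<mu>\<in>functionals. weight_space vscale act H \<mu>) = UNIV"
proof -
  interpret M: lie_module scale bracket vscale act by fact
  let ?B = "\<Union>\<mu>\<in>functionals. weight_space vscale act H \<mu>"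
  have stable: "\<forall>w\<in>M.V.span ?B. act y w \<in> M.V.span ?B" for y
  proof (rule basis_induct[where P = "\<lambda>y. \<forall>w\<in>M.V.span ?B. act y w \<in> M.V.span ?B"])
    fix \<beta> assume \<beta>: "\<beta> \<in> \<Delta>"
    show "\<forall>w\<in>M.V.span ?B. act (x \<beta>) w \<in> M.V.span ?B"
    proof
      fix w assume "w \<in> M.V.span ?B"
      then show "act (x \<beta>) w \<in> M.V.span ?B"
      proof (induction rule: M.V.span_induct_alt)
        case (step c b w)
        then obtain \<mu> where \<mu>: "\<mu> \<in> functionals" "b \<in> weight_space vscale act H \<mu>" by blast
        have "act (x \<beta>) b \<in> ?B"
          using M.act_root_space[OF x_in[OF \<beta>] \<mu>(2)] dual_add[OF \<mu>(1) root_dual[OF \<beta>]] by blast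
        then show ?case using step.IH by (simp add: M.V.span_add M.V.span_scale M.V.span_base)
      qed (simp add: M.V.span_zero)
    qed
  next
    fix i assume i: "i \<in> I"
    show "\<forall>w\<in>M.V.span ?B. act (h i) w \<in> M.V.span ?B"
    proof
      fix w assume "w \<in> M.V.span ?B"
      then show "act (h i) w \<in> M.V.span ?B"
      proof (induction rule: M.V.span_induct_alt)
        case (step c b w)
        then obtain \<mu> where \<mu>: "\<mu> \<in> functionals" "b \<in> weight_space vscale act H \<mu>" by blast
        have "act (h i) b = vscale (\<mu> (h i)) b" using \<mu>(2) h_in_H[OF i] by (simp add: weight_space_def)
        then show ?case using step by (simp add: M.V.span_add M.V.span_scale M.V.span_base)
      qed (simp add: M.V.span_zero)
    qed
  qed (simp_all add: M.V.span_zero M.V.span_add M.V.span_scale)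
  then have "M.V.span ?B = {0} \<or> M.V.span ?B = UNIV"
    using assms(2) M.V.subspace_span[of ?B] unfolding irreducible_action_def by blast
  moreover have "v \<in> M.V.span ?B" using v(1,2) by (intro M.V.span_base) blast
  ultimately show ?thesis using v(3) by blast
qed

end

section \<open>Height filtration and conjugates of the height element\<close>

context highest_weight_module
begin

text \<open>Heights of weights of V are complex numbers that need not be integers, so "higher than
  r" is expressed by a positive natural difference.\<close>

definition above :: "complex \<Rightarrow> 'v set" where
  "above r = {w. \<forall>\<nu>\<in>functionals. wcomp \<nu> w \<noteq> 0 \<longrightarrow> (\<exists>k::nat. k > 0 \<and> \<nu> height_elt = r + of_nat k)}"

lemma aboveD: "w \<in> above r \<Longrightarrow> \<nu> \<in> functionals \<Longrightarrow> wcomp \<nu> w \<noteq> 0 \<Longrightarrow> \<exists>k::nat. k > 0 \<and> \<nu> height_elt = r + of_nat k"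
  by (simp add: above_def)

lemma above_0: "0 \<in> above r"
  by (simp add: above_def wcomp_simps)

lemma above_add: "a \<in> above r \<Longrightarrow> b \<in> above r \<Longrightarrow> a + b \<in> above r"
  unfolding above_def mem_Collect_eq
proof (intro ballI impI)
  fix \<nu> assume ab: "\<forall>\<nu>\<in>functionals. wcomp \<nu> a \<noteq> 0 \<longrightarrow> (\<exists>k::nat. k > 0 \<and> \<nu> height_elt = r + of_nat k)"
    "\<forall>\<nu>\<in>functionals. wcomp \<nu> b \<noteq> 0 \<longrightarrow> (\<exists>k::nat. k > 0 \<and> \<nu> height_elt = r + of_nat k)"
    and \<nu>: "\<nu> \<in> functionals" "wcomp \<nu> (a + b) \<noteq> 0"
  have "wcomp \<nu> a \<noteq> 0 \<or> wcomp \<nu> b \<noteq> 0" using \<nu> by (auto simp: wcomp_simps(1)[OF \<nu>(1)])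
  then show "\<exists>k::nat. k > 0 \<and> \<nu> height_elt = r + of_nat k"
    using bspec[OF ab(1) \<nu>(1)] bspec[OF ab(2) \<nu>(1)] by argo
qed

lemma above_sum: "(\<And>i. i \<in> A \<Longrightarrow> t i \<in> above r) \<Longrightarrow> sum t A \<in> above r"
  by (induction A rule: infinite_finite_induct) (simp_all add: above_0 above_add)

lemma above_weight_vector:
  assumes "w \<in> wsp \<mu>" "\<mu> \<in> functionals" "\<mu> height_elt = r + of_nat k" "k > 0"
  shows "w \<in> above r"
  unfolding above_def mem_Collect_eq
proof (intro ballI impI)
  fix \<nu> assume "\<nu> \<in> functionals" "wcomp \<nu> w \<noteq> 0"
  then have "\<nu> = \<mu>" using wcomp_weight_vector[OF assms(1,2)] by (metis (full_types))
  then show "\<exists>k::nat. k > 0 \<and> \<nu> height_elt = r + of_nat k" using assms(3,4) by blast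
qed

lemma above_mono: "w \<in> above (r + of_nat k) \<Longrightarrow> w \<in> above r"
  unfolding above_def mem_Collect_eq
proof (intro ballI impI)
  fix \<nu> assume a: "\<forall>\<nu>\<in>functionals. wcomp \<nu> w \<noteq> 0 \<longrightarrow> (\<exists>j::nat. j > 0 \<and> \<nu> height_elt = r + of_nat k + of_nat j)"
    and \<nu>: "\<nu> \<in> functionals" "wcomp \<nu> w \<noteq> 0"
  obtain j :: nat where "j > 0" "\<nu> height_elt = r + of_nat k + of_nat j" using bspec[OF a \<nu>(1)] \<nu>(2) by blast
  then show "\<exists>j::nat. j > 0 \<and> \<nu> height_elt = r + of_nat j"
    by (intro exI[of _ "k + j"]) simp
qed

text \<open>Identity on the graded pieces of the height filtration, a property that passes to
  composites.\<close>

definition unipotent :: "('v \<Rightarrow> 'v) \<Rightarrow> bool" where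
  "unipotent g \<longleftrightarrow> V.lin g \<and> (\<forall>\<mu>\<in>functionals. \<forall>w\<in>wsp \<mu>. g w - w \<in> above (\<mu> height_elt))"

lemma unipotent_lin: "unipotent g \<Longrightarrow> V.lin g"
  and unipotentD: "unipotent g \<Longrightarrow> \<mu> \<in> functionals \<Longrightarrow> w \<in> wsp \<mu> \<Longrightarrow> g w - w \<in> above (\<mu> height_elt)"
  by (simp_all add: unipotent_def)

lemma unipotent_above:
  assumes g: "unipotent g" and w: "w \<in> above r"
  shows "g w \<in> above r"
proof -
  have "g (wcomp \<mu> w) \<in> above r" if \<mu>: "\<mu> \<in> W" for \<mu>
  proof (cases "wcomp \<mu> w = 0")
    case True
    then show ?thesis by (simp add: V.lin_zero[OF unipotent_lin[OF g]] above_0)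
  next
    case False
    then obtain k :: nat where k: "k > 0" "\<mu> height_elt = r + of_nat k"
      using aboveD[OF w weight_dual[OF \<mu>]] by blast
    have "g (wcomp \<mu> w) - wcomp \<mu> w \<in> above (r + of_nat k)"
      using unipotentD[OF g weight_dual[OF \<mu>] wcomp_in] k(2) by simp
    then have "g (wcomp \<mu> w) - wcomp \<mu> w \<in> above r" by (rule above_mono)
    moreover have "wcomp \<mu> w \<in> above r"
      by (rule above_weight_vector[OF wcomp_in weight_dual[OF \<mu>] k(2,1)])
    ultimately have "g (wcomp \<mu> w) - wcomp \<mu> w + wcomp \<mu> w \<in> above r" by (rule above_add)
    then show ?thesis by simp
  qed
  then have "(\<Sum>\<mu>\<in>W. g (wcomp \<mu> w)) \<in> above r" by (rule above_sum)
  then show ?thesis by (simp only: V.lin_sum[OF unipotent_lin[OF g], symmetric] wcomp_sum)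
qed

lemma unipotent_comp:
  assumes f: "unipotent f" and g: "unipotent g"
  shows "unipotent (\<lambda>w. f (g w))"
  unfolding unipotent_def
proof (intro conjI ballI)
  show "V.lin (\<lambda>w. f (g w))"
    by (rule V.linI)
      (simp_all add: V.lin_simps(1,2)[OF unipotent_lin[OF f]] V.lin_simps(1,2)[OF unipotent_lin[OF g]])
  fix \<mu> w assume \<mu>: "\<mu> \<in> functionals" "w \<in> wsp \<mu>"
  have "f (g w) - w = f (g w - w) + (f w - w)"
    by (simp add: V.lin_diff[OF unipotent_lin[OF f]])
  then show "f (g w) - w \<in> above (\<mu> height_elt)"
    using above_add[OF unipotent_above[OF f unipotentD[OF g \<mu>]] unipotentD[OF f \<mu>]] by (simp only:)
qed

lemma unipotent_id: "unipotent (\<lambda>w. w)"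
  unfolding unipotent_def by (auto intro: V.linI simp: above_0)

lemma unipotent_texp:
  assumes \<beta>: "\<beta> \<in> \<Delta>p"
  shows "unipotent (texp \<beta> u)"
  unfolding unipotent_def
proof (intro conjI ballI)
  have bR: "\<beta> \<in> \<Delta>" by (rule pos_root[OF \<beta>])
  show "V.lin (texp \<beta> u)" by (rule lin_texp[OF bR])
  fix \<mu> w assume \<mu>: "\<mu> \<in> functionals" "w \<in> wsp \<mu>"
  let ?D = "xdp \<beta>"
  obtain M where "\<forall>\<beta>\<in>\<Delta>. (\<forall>w. (act (x \<beta>) ^^ M) w = 0) \<and> (\<forall>z. (bracket (x \<beta>) ^^ M) z = 0)"
    using nilpotent_bound by blast
  then have M: "(act (x \<beta>) ^^ M) w = 0" for w using bR by blast
  have MS: "(act (x \<beta>) ^^ Suc M) w = 0" for w using M by simp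
  have "texp \<beta> u w = (\<Sum>n<Suc M. vscale (u ^ n) (?D n w))"
    unfolding texp_def by (rule V.exp_nilpotent_eq_sum[OF act_linear_right MS])
  then have e: "texp \<beta> u w - w = (\<Sum>n<M. vscale (u ^ Suc n) (?D (Suc n) w))"
    by (simp add: sum.lessThan_Suc_shift del: sum.lessThan_Suc)
  show "texp \<beta> u w - w \<in> above (\<mu> height_elt)"
    unfolding e
  proof (rule above_sum)
    fix n
    let ?\<nu> = "\<mu> + fun_scale (of_nat (Suc n)) \<beta>"
    show "vscale (u ^ Suc n) (?D (Suc n) w) \<in> above (\<mu> height_elt)"
    proof (rule above_weight_vector)
      show "vscale (u ^ Suc n) (?D (Suc n) w) \<in> wsp ?\<nu>"
        by (rule wsp_closed(2)[OF dpow_act_root_space[OF x_in[OF bR] \<mu>(2)]])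
      show "?\<nu> \<in> functionals" by (rule dual_add[OF \<mu>(1) dual_fun_scale[OF root_dual[OF bR]]])
      show "?\<nu> height_elt = \<mu> height_elt + of_nat (Suc n * ht \<beta>)"
        unfolding of_nat_mult using pos_root_height(1)[OF \<beta>] by (simp add: fun_scale_def del: of_nat_Suc)
      show "Suc n * ht \<beta> > 0" using pos_root_height(2)[OF \<beta>] by simp
    qed
  qed
qed

text \<open>Conjugation by a unipotent element moves the height element \<open>h\<^sub>0\<close> to \<open>h\<^sub>0 + y\<close> with \<open>y\<close> in the
  nilradical.\<close>

abbreviation "nilradical \<equiv> span (x ` \<Delta>p)"

text \<open>The equation \<open>g h_0 g^-1 = h_0 + y\<close>, multiplied out so that no inverse
  appears.\<close>

definition shifts :: "('v \<Rightarrow> 'v) \<Rightarrow> 'g \<Rightarrow> bool" where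
  "shifts g y \<longleftrightarrow> (\<forall>w. g (act height_elt w) = act (height_elt + y) (g w))"

lemma shiftsD: "shifts g y \<Longrightarrow> g (act height_elt w) = act height_elt (g w) + act y (g w)"
  by (simp add: shifts_def)

text \<open>By \<open>exp_x_H\<close> the height element contributes -u
  \<beta>(\<open>height_elt\<close>) \<open>x \<beta>\<close>; this is the origin of the divisor
  \<open>ht \<beta>\<close> in the overview.\<close>

lemma texp_shift:
  assumes \<beta>: "\<beta> \<in> \<Delta>p" and g: "shifts g y"
  shows "shifts (\<lambda>w. texp \<beta> u (g w)) (adj.texp \<beta> u y - scale (u * of_nat (ht \<beta>)) (x \<beta>))"
  unfolding shifts_def
proof
  fix w
  have bR: "\<beta> \<in> \<Delta>" by (rule pos_root[OF \<beta>])
  have "texp \<beta> u (g (act height_elt w)) = act (adj.texp \<beta> u (height_elt + y)) (texp \<beta> u (g w))"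
    using spec[OF g[unfolded shifts_def], of w] texp_act[OF bR, of u "height_elt + y" "g w"]
    by (simp only: adj_texp_eq)
  also have "adj.texp \<beta> u (height_elt + y) = height_elt + (adj.texp \<beta> u y - scale (u * of_nat (ht \<beta>)) (x \<beta>))"
    using exp_x_H[OF height_elt_in_H bR, of u] pos_root_height(1)[OF \<beta>]
    by (simp add: ad.V.lin_add[OF adj.lin_texp[OF bR]])
  finally show "texp \<beta> u (g (act height_elt w)) =
    act (height_elt + (adj.texp \<beta> u y - scale (u * of_nat (ht \<beta>)) (x \<beta>))) (texp \<beta> u (g w))" .
qed

text \<open>The last clause serves the induction: in the composite of f and g, the shift of g is
  conjugated by f and must stay in the nilradical.\<close>

lemma U_Q_properties:
  assumes "g \<in> U_Q"
  shows "g \<in> Bij UNIV \<and> unipotent g \<and> (\<exists>y\<in>nilradical. shifts g y) \<and>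
    (\<forall>z\<in>nilradical. \<exists>z'\<in>nilradical. \<forall>w. g (act z w) = act z' (g w))" (is "?P g")
proof -
  have nil: "adj.texp \<beta> u y \<in> nilradical" if "\<beta> \<in> \<Delta>p" "y \<in> nilradical" for \<beta> u y
    by (rule texp_positive_span[OF that(1) order_refl _ that(2)]) (rule pos_root_sum(1)[OF _ that(1)])
  have idB: "(\<lambda>w. w) \<in> Bij UNIV" by (simp add: Bij_def bij_betw_def)
  have sid: "shifts (\<lambda>w. w) 0" by (simp add: shifts_def)
  have gen: "?P (texp \<beta> u)" if \<beta>: "\<beta> \<in> \<Delta>p" for \<beta> u
  proof (intro conjI ballI)
    have bR: "\<beta> \<in> \<Delta>" by (rule pos_root[OF \<beta>])
    show "texp \<beta> u \<in> Bij UNIV" by (rule texp_Bij[OF bR])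
    show "unipotent (texp \<beta> u)" by (rule unipotent_texp[OF \<beta>])
    have "adj.texp \<beta> u 0 - scale (u * of_nat (ht \<beta>)) (x \<beta>) \<in> nilradical"
      by (rule span_diff[OF nil[OF \<beta> span_zero] span_scale[OF span_base[OF imageI[OF \<beta>]]]])
    then show "\<exists>y\<in>nilradical. shifts (texp \<beta> u) y" using texp_shift[OF \<beta> sid, of u] by blast
    fix z assume "z \<in> nilradical"
    from nil[OF \<beta> this, of u] texp_act[OF bR, of u z]
    show "\<exists>z'\<in>nilradical. \<forall>w. texp \<beta> u (act z w) = act z' (texp \<beta> u w)"
      unfolding adj_texp_eq by blast
  qed
  show ?thesis
    using assms unfolding unipotent_Q_def
  proof (induction rule: generate.induct)
    case one
    show ?case unfolding BijGroup_UNIV_simps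
      using idB unipotent_id sid span_zero by blast
  next
    case (incl g)
    then obtain \<beta> u where \<beta>: "\<beta> \<in> \<Delta>p" and ge: "g = root_elt vscale act x \<beta> u" by blast
    show ?case unfolding ge root_elt_eq by (rule gen[OF \<beta>])
  next
    case (inv g)
    then obtain \<beta> u where \<beta>: "\<beta> \<in> \<Delta>p" and ge: "g = root_elt vscale act x \<beta> u" by blast
    show ?case unfolding ge root_elt_eq inv_texp[OF pos_root[OF \<beta>]] by (rule gen[OF \<beta>])
  next
    case (eng f g)
    have B: "f \<in> Bij UNIV" "g \<in> Bij UNIV" using eng.IH by blast+
    show ?case unfolding BijGroup_UNIV_simps(3)[OF B]
    proof (intro conjI ballI)
      show "(\<lambda>w. f (g w)) \<in> Bij UNIV"
        using compose_Bij[OF B] by (simp add: compose_def restrict_UNIV)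
      show "unipotent (\<lambda>w. f (g w))" by (rule unipotent_comp) (use eng.IH in blast)+
      obtain y where y: "y \<in> nilradical" "shifts f y" using eng.IH(1) by blast
      obtain y' where y': "y' \<in> nilradical" "shifts g y'" using eng.IH(2) by blast
      obtain z where z: "z \<in> nilradical" "\<And>w. f (act y' w) = act z (f w)" using eng.IH(1) y'(1) by blast
      have fl: "V.lin f" by (rule unipotent_lin) (use eng.IH(1) in blast)
      have "shifts (\<lambda>w. f (g w)) (y + z)"
        unfolding shifts_def by (simp add: shiftsD[OF y'(2)] V.lin_add[OF fl] shiftsD[OF y(2)] z(2))
      then show "\<exists>y\<in>nilradical. shifts (\<lambda>w. f (g w)) y" using span_add[OF y(1) z(1)] by blast
      fix z assume "z \<in> nilradical"
      then obtain z' where z': "z' \<in> nilradical" "\<And>w. g (act z w) = act z' (g w)" using eng.IH(2) by blast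
      obtain z'' where z'': "z'' \<in> nilradical" "\<And>w. f (act z' w) = act z'' (f w)" using eng.IH(1) z'(1) by blast
      have "\<forall>w. f (g (act z w)) = act z'' (f (g w))" by (simp add: z'(2) z''(2))
      then show "\<exists>z'\<in>nilradical. \<forall>w. f (g (act z w)) = act z' (f (g w))" using z''(1) by blast
    qed
  qed
qed

text \<open>On a vector w of weight \<mu>, g w - w is an eigenvector of \<open>height_elt\<close>
  for the value of \<mu>, but its components all have strictly greater height.\<close>

lemma unipotent_commuting_id:
  assumes g: "unipotent g" "shifts g 0"
  shows "g = (\<lambda>w. w)"
proof
  fix w
  have lid: "V.lin (\<lambda>w. w)" by (rule V.linI) simp_all
  show "g w = w"
  proof (rule lin_eq_on_weight_vectors[OF unipotent_lin[OF g(1)] lid])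
    fix \<mu> w assume \<mu>: "\<mu> \<in> W" "w \<in> wsp \<mu>"
    note md = weight_dual[OF \<mu>(1)]
    have up: "g w - w \<in> above (\<mu> height_elt)" by (rule unipotentD[OF g(1) md \<mu>(2)])
    have hw: "act height_elt w = vscale (\<mu> height_elt) w" by (rule wspD[OF \<mu>(2) height_elt_in_H])
    have "act height_elt (g w) = vscale (\<mu> height_elt) (g w)"
      using shiftsD[OF g(2), of w] hw by (simp add: V.lin_scale[OF unipotent_lin[OF g(1)]])
    then have ev: "act height_elt (g w - w) = vscale (\<mu> height_elt) (g w - w)"
      by (simp add: hw V.scale_right_diff_distrib)
    have "wcomp \<nu> (g w - w) = 0" if \<nu>: "\<nu> \<in> W" for \<nu>
    proof (rule ccontr)
      assume nz: "wcomp \<nu> (g w - w) \<noteq> 0"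
      note nd = weight_dual[OF \<nu>]
      obtain k :: nat where k: "k > 0" "\<nu> height_elt = \<mu> height_elt + of_nat k"
        using aboveD[OF up nd nz] by blast
      have "vscale (\<nu> height_elt) (wcomp \<nu> (g w - w)) = vscale (\<mu> height_elt) (wcomp \<nu> (g w - w))"
        using arg_cong[OF ev, of "wcomp \<nu>"]
        by (simp only: wcomp_act_H[OF height_elt_in_H nd] wcomp_simps(2)[OF nd])
      then have "\<nu> height_elt = \<mu> height_elt" using nz by simp
      then show False using k by simp
    qed
    then have "(\<Sum>\<nu>\<in>W. wcomp \<nu> (g w - w)) = 0" by (simp only: sum.neutral_const cong: sum.cong)
    then show "g w = w" by (simp add: wcomp_sum)
  qed
qed

text \<open>Compare components of weight \<open>\<mu> + \<beta>\<close> in \<open>g h\<^sub>0 = (h\<^sub>0 + c x\<^sub>\<beta> + y) g\<close>: the terms of \<open>y\<close> only see components of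
  \<open>g w\<close> whose weights are not above \<open>\<mu>\<close> and differ from \<open>\<mu>\<close>, and these vanish.\<close>

lemma shift_leading_component:
  assumes g: "unipotent g" "shifts g (scale c (x \<beta>) + y)" and \<beta>: "\<beta> \<in> \<Delta>p"
    and S: "S \<subseteq> \<Delta>p" "\<beta> \<notin> S" "\<And>\<gamma>. \<gamma> \<in> S \<Longrightarrow> ht \<beta> \<le> ht \<gamma>" and y: "y \<in> span (x ` S)"
    and \<mu>: "\<mu> \<in> functionals" "w \<in> wsp \<mu>"
  shows "wcomp (\<mu> + \<beta>) (g w) = - vscale (c / of_nat (ht \<beta>)) (act (x \<beta>) w)"
proof -
  have bd: "\<beta> \<in> functionals" by (rule root_dual[OF pos_root[OF \<beta>]])
  have mbd: "\<mu> + \<beta> \<in> functionals" by (rule dual_add[OF \<mu>(1) bd])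
  have up: "g w - w \<in> above (\<mu> height_elt)" by (rule unipotentD[OF g(1) \<mu>])
  \<comment> \<open>At the heights of \<mu> or below, unipotence leaves g w no component but w
    itself.\<close>
  have low: "wcomp \<nu> (g w) = (if \<nu> = \<mu> then w else 0)"
    if \<nu>: "\<nu> \<in> functionals" and k: "\<nu> height_elt + of_nat k = \<mu> height_elt" for \<nu> and k :: nat
  proof -
    have "wcomp \<nu> (g w - w) = 0"
    proof (rule ccontr)
      assume "wcomp \<nu> (g w - w) \<noteq> 0"
      then obtain j :: nat where j: "j > 0" "\<nu> height_elt = \<mu> height_elt + of_nat j"
        using aboveD[OF up \<nu>] by blast
      have "complex_of_nat (j + k) = 0" using k unfolding j(2) by simp
      then show False using j(1) by (simp only: of_nat_eq_0_iff)
    qed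
    then have "wcomp \<nu> (g w) = wcomp \<nu> w" using wcomp_simps(5)[OF \<nu>, of "g w" w] by simp
    then show ?thesis using wcomp_weight_vector[OF \<mu>(2,1) \<nu>] by simp
  qed
  define \<kappa> where "\<kappa> = \<mu> + \<beta>"
  have kd: "\<kappa> \<in> functionals" using mbd by (simp only: \<kappa>_def)
  have yz': "wcomp \<kappa> (act y (g w)) = 0"
    using y
  proof (induction rule: span_induct_alt)
    case base
    show ?case by (simp add: wcomp_simps(3)[OF kd])
  next
    case (step d b y)
    then obtain \<gamma> where \<gamma>: "\<gamma> \<in> S" "b = x \<gamma>" by blast
    have gp: "\<gamma> \<in> \<Delta>p" using S(1) \<gamma>(1) by blast
    have gd: "\<gamma> \<in> functionals" by (rule root_dual[OF pos_root[OF gp]])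
    have nd: "\<kappa> - \<gamma> \<in> functionals" by (rule dual_diff[OF kd gd])
    obtain k where k: "ht \<gamma> = ht \<beta> + k" using S(3)[OF \<gamma>(1)] le_Suc_ex by blast
    have "wcomp (\<kappa> - \<gamma>) (g w) = (if \<kappa> - \<gamma> = \<mu> then w else 0)"
    proof (rule low[OF nd])
      show "(\<kappa> - \<gamma>) height_elt + of_nat k = \<mu> height_elt"
        using pos_root_height(1)[OF gp] pos_root_height(1)[OF \<beta>] k by (simp add: \<kappa>_def)
    qed
    moreover have "\<kappa> - \<gamma> \<noteq> \<mu>"
    proof
      assume a: "\<kappa> - \<gamma> = \<mu>"
      have "\<beta> = \<gamma>"
      proof
        show "\<beta> z = \<gamma> z" for z using fun_cong[OF a, of z] by (simp add: \<kappa>_def)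
      qed
      then show False using \<gamma>(1) S(2) by simp
    qed
    ultimately have "wcomp (\<kappa> - \<gamma>) (g w) = 0" by simp
    moreover have "wcomp ((\<kappa> - \<gamma>) + \<gamma>) (act (x \<gamma>) (g w)) = act (x \<gamma>) (wcomp (\<kappa> - \<gamma>) (g w))"
      by (rule wcomp_act[OF x_in[OF pos_root[OF gp]] gd nd])
    ultimately have "wcomp (\<kappa>) (act (x \<gamma>) (g w)) = 0" by simp
    then show ?case using step.IH \<gamma>(2) by (simp add: wcomp_simps(1,2)[OF kd])
  qed
  have yz: "wcomp (\<mu> + \<beta>) (act y (g w)) = 0" using yz' by (simp only: \<kappa>_def)
  have "g (act height_elt w) = vscale (\<mu> height_elt) (g w)"
    using wspD[OF \<mu>(2) height_elt_in_H] by (simp add: V.lin_scale[OF unipotent_lin[OF g(1)]])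
  then have eq: "vscale (\<mu> height_elt) (g w) = act height_elt (g w) + (vscale c (act (x \<beta>) (g w)) + act y (g w))"
    using shiftsD[OF g(2), of w] by simp
  have "wcomp \<mu> (g w) = w" using low[OF \<mu>(1), of 0] by simp
  then have xb: "wcomp (\<mu> + \<beta>) (act (x \<beta>) (g w)) = act (x \<beta>) w"
    using wcomp_act[OF x_in[OF pos_root[OF \<beta>]] bd \<mu>(1), of "g w"] by simp
  let ?A = "wcomp (\<mu> + \<beta>) (g w)"
  \<comment> \<open>The values of \<open>height_elt\<close> at \<mu> and \<mu> + \<beta> differ by
    \<open>ht \<beta>\<close>, which yields the sign and the denominator.\<close>
  have "vscale (\<mu> height_elt) ?A = vscale ((\<mu> + \<beta>) height_elt) ?A + vscale c (act (x \<beta>) w)"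
    using arg_cong[OF eq, of "wcomp (\<mu> + \<beta>)"]
    by (simp only: wcomp_simps(1,2)[OF mbd] wcomp_act_H[OF height_elt_in_H mbd] yz xb add_0_right)
  then have "vscale (of_nat (ht \<beta>)) ?A = - vscale c (act (x \<beta>) w)"
    using pos_root_height(1)[OF \<beta>] by (simp add: V.scale_left_distrib eq_neg_iff_add_eq_0)
  then have "vscale (1 / of_nat (ht \<beta>)) (vscale (of_nat (ht \<beta>)) ?A) = vscale (1 / of_nat (ht \<beta>)) (- vscale c (act (x \<beta>) w))"
    by simp
  then show ?thesis using pos_root_height(2)[OF \<beta>] by simp
qed

text \<open>\<open>S\<close> holds the roots at which the shift may still have a term. Being closed
  towards greater height, it can lose a root \<beta> of least height and still be stable under
  adding \<beta>, so multiplying by an element for \<beta> brings back no term removed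
  before.\<close>

lemma unipotent_stabilizer_in_G_Z:
  assumes "S \<subseteq> \<Delta>p" "\<And>\<gamma> \<delta>. \<gamma> \<in> S \<Longrightarrow> \<delta> \<in> \<Delta>p \<Longrightarrow> ht \<gamma> < ht \<delta> \<Longrightarrow> \<delta> \<in> S"
    and "unipotent g" "y \<in> span (x ` S)" "shifts g y" "\<And>w. w \<in> lattice \<Longrightarrow> g w \<in> lattice"
  shows "g \<in> G_Z"
  using assms
proof (induction "card S" arbitrary: S g y)
  case 0
  have "\<Delta>p \<subseteq> \<Delta>" using pos_root by blast
  then have "S = {}" using 0 finite_subset[OF _ finite_roots, of S] by simp
  then have "y = 0" using "0.prems"(4) by simp
  then have "g = (\<lambda>w. w)" using unipotent_commuting_id "0.prems"(3,5) by blast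
  then show ?case
    unfolding chevalley_Z_def using generate.one[of "BijGroup UNIV"] by (simp only: BijGroup_UNIV_simps)
next
  case (Suc n)
  have finS: "finite S"
    using finite_subset[OF Suc.prems(1) finite_subset[OF _ finite_roots]] pos_root by blast
  have "S \<noteq> {}" using Suc.hyps(2) by auto
  then have "\<exists>\<beta>. is_arg_min ht (\<lambda>\<beta>. \<beta> \<in> S) \<beta>" using ex_is_arg_min_if_finite[OF finS] by blast
  then obtain \<beta> where \<beta>: "\<beta> \<in> S" "\<And>\<gamma>. \<gamma> \<in> S \<Longrightarrow> ht \<beta> \<le> ht \<gamma>"
    unfolding is_arg_min_def by (meson not_less)
  have bp: "\<beta> \<in> \<Delta>p" using \<beta>(1) Suc.prems(1) by blast
  have bR: "\<beta> \<in> \<Delta>" by (rule pos_root[OF bp])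
  let ?T = "S - {\<beta>}"
  have Tp: "?T \<subseteq> \<Delta>p" using Suc.prems(1) by blast
  have "x ` S = insert (x \<beta>) (x ` ?T)" using \<beta>(1) by blast
  then have "y \<in> span (insert (x \<beta>) (x ` ?T))" using Suc.prems(4) by simp
  then obtain c where y1: "y - scale c (x \<beta>) \<in> span (x ` ?T)" using span_breakdown_eq by blast
  define y1 where "y1 = y - scale c (x \<beta>)"
  have y: "y = scale c (x \<beta>) + y1" by (simp add: y1_def)
  have y1s: "y1 \<in> span (x ` ?T)" using y1 by (simp add: y1_def)
  have sh: "shifts g (scale c (x \<beta>) + y1)" using Suc.prems(5) y by simp
  have ht0: "complex_of_nat (ht \<beta>) \<noteq> 0" using pos_root_height(2)[OF bp] by simp
  have "c / of_nat (ht \<beta>) \<in> \<int>"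
  proof (rule root_vector_multiple_integral[OF bR])
    fix w assume w: "w \<in> lattice"
    have "vscale (c / of_nat (ht \<beta>)) (act (x \<beta>) (wcomp \<mu> w)) \<in> lattice" if \<mu>: "\<mu> \<in> W" for \<mu>
    proof -
      note md = weight_dual[OF \<mu>]
      have "wcomp (\<mu> + \<beta>) (g (wcomp \<mu> w)) = - vscale (c / of_nat (ht \<beta>)) (act (x \<beta>) (wcomp \<mu> w))"
        by (rule shift_leading_component[OF Suc.prems(3) sh bp Tp _ _ y1s md wcomp_in]) (use \<beta>(2) in auto)
      moreover have "wcomp (\<mu> + \<beta>) (g (wcomp \<mu> w)) \<in> lattice"
        by (rule wcomp_lattice[OF Suc.prems(6)[OF wcomp_lattice[OF w md]] dual_add[OF md root_dual[OF bR]]])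
      ultimately show ?thesis using lattice_minus[of "- vscale (c / of_nat (ht \<beta>)) (act (x \<beta>) (wcomp \<mu> w))"] by simp
    qed
    then have "(\<Sum>\<mu>\<in>W. vscale (c / of_nat (ht \<beta>)) (act (x \<beta>) (wcomp \<mu> w))) \<in> lattice" by (rule lattice_sum)
    then show "vscale (c / of_nat (ht \<beta>)) (act (x \<beta>) w) \<in> lattice"
      by (simp only: V.scale_sum_right[symmetric] act_sum_right[symmetric] wcomp_sum)
  qed
  then obtain m where m: "c / of_nat (ht \<beta>) = of_int m" by (rule Ints_cases)
  then have c: "c = of_int m * of_nat (ht \<beta>)" using ht0 by (simp add: field_simps)
  let ?g = "\<lambda>w. texp \<beta> (of_int m) (g w)"
  have Tclosed: "\<gamma> + \<beta> \<in> ?T" if "\<gamma> \<in> ?T" "\<gamma> + \<beta> \<in> \<Delta>" for \<gamma>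
  proof -
    have gp: "\<gamma> \<in> \<Delta>p" using that(1) Tp by blast
    have hs: "ht (\<gamma> + \<beta>) = ht \<gamma> + ht \<beta>" "\<gamma> + \<beta> \<in> \<Delta>p" using pos_root_sum[OF gp bp that(2)] by auto
    have "ht \<gamma> < ht (\<gamma> + \<beta>)" using hs(1) pos_root_height(2)[OF bp] by simp
    then have "\<gamma> + \<beta> \<in> S" using Suc.prems(2)[of \<gamma> "\<gamma> + \<beta>"] that(1) hs(2) by blast
    moreover have "\<gamma> + \<beta> \<noteq> \<beta>"
    proof
      assume "\<gamma> + \<beta> = \<beta>"
      then have "ht \<gamma> + ht \<beta> = ht \<beta>" using hs(1) by metis
      then show False using pos_root_height(2)[OF gp] by simp
    qed
    ultimately show ?thesis by blast
  qed
  have gZ: "?g \<in> G_Z"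
  proof (rule Suc.hyps(1)[of ?T ?g "adj.texp \<beta> (of_int m) y1"])
    show "n = card ?T" using Suc.hyps(2) \<beta>(1) finS by simp
    show "?T \<subseteq> \<Delta>p" by (rule Tp)
    show "\<delta> \<in> ?T" if "\<gamma> \<in> ?T" "\<delta> \<in> \<Delta>p" "ht \<gamma> < ht \<delta>" for \<gamma> \<delta>
    proof -
      have "\<delta> \<in> S" using Suc.prems(2)[of \<gamma> \<delta>] that by blast
      moreover have "\<delta> \<noteq> \<beta>" using \<beta>(2)[of \<gamma>] that(1,3) by auto
      ultimately show ?thesis by blast
    qed
    show "unipotent ?g" by (rule unipotent_comp[OF unipotent_texp[OF bp] Suc.prems(3)])
    show "adj.texp \<beta> (of_int m) y1 \<in> span (x ` ?T)"
      by (rule texp_positive_span[OF bp Tp Tclosed y1s])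
    \<comment> \<open>Since c = m \<open>ht \<beta>\<close> and \<open>x \<beta>\<close> is fixed by
      its own exponential, the correction from \<open>texp_shift\<close> cancels exactly the leading
      term.\<close>
    have "adj.texp \<beta> (of_int m) y - scale (of_int m * of_nat (ht \<beta>)) (x \<beta>) = adj.texp \<beta> (of_int m) y1"
      by (simp add: y c ad.V.lin_simps(1,2)[OF adj.lin_texp[OF bR]] exp_x_x[OF bR])
    then show "shifts ?g (adj.texp \<beta> (of_int m) y1)"
      using texp_shift[OF bp Suc.prems(5), of "of_int m"] by simp
    show "?g w \<in> lattice" if "w \<in> lattice" for w
      by (rule texp_lattice_int[OF bR _ Suc.prems(6)[OF that]]) simp
  qed
  have "(\<lambda>w. texp \<beta> (- of_int m) (?g w)) \<in> G_Z"
    by (rule G_Z_mult[OF texp_in_G_Z[OF bR] gZ]) simp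
  then show ?case by (simp add: texp_add[OF bR] texp_0[OF bR])
qed

theorem unipotent_Q_stabilizer:
  assumes g: "g \<in> U_Q" and st: "g ` lattice = lattice"
  shows "g \<in> G_Z"
proof -
  obtain y where y: "y \<in> nilradical" "shifts g y" and u: "unipotent g"
    using U_Q_properties[OF g] by blast
  show ?thesis
    by (rule unipotent_stabilizer_in_G_Z[OF order_refl _ u y]) (use st in auto)
qed

end

theorem theorem9p1:
  fixes scale :: "complex \<Rightarrow> 'g::ab_group_add \<Rightarrow> 'g"
    and bracket :: "'g \<Rightarrow> 'g \<Rightarrow> 'g"
    and H :: "'g set"
    and I :: "'i set"
    and \<alpha> :: "'i \<Rightarrow> 'g \<Rightarrow> complex"
    and coroot :: "('g \<Rightarrow> complex) \<Rightarrow> 'g"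
    and x :: "('g \<Rightarrow> complex) \<Rightarrow> 'g"
    and vscale :: "complex \<Rightarrow> 'v::ab_group_add \<Rightarrow> 'v"
    and act :: "'g \<Rightarrow> 'v \<Rightarrow> 'v"
    and \<Lambda> :: "'g \<Rightarrow> complex"
    and v :: 'v
  defines "h \<equiv> \<lambda>i. coroot (\<alpha> i)"
  defines "V_Z \<equiv> lattice_Z scale bracket H I h x vscale act v"
    and "G_Q \<equiv> chevalley_Q scale bracket H I h x vscale act"
    and "G_Z \<equiv> chevalley_Z scale bracket H I h x vscale act"
    and "U_Q \<equiv> unipotent_Q scale bracket H I \<alpha> x vscale act"
  defines "\<Gamma>_Z \<equiv> {g \<in> G_Q. g ` V_Z = V_Z}"
  assumes "simple_lie_algebra scale bracket" and "finite_dim scale"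
    and "cartan_subalgebra scale bracket H"
    and "simple_roots scale bracket H I \<alpha>"
    and "\<forall>\<beta>\<in>roots scale bracket H. is_coroot scale bracket H \<beta> (coroot \<beta>)"
    and "chevalley_basis scale bracket H I \<alpha> coroot x"
    and "lie_module scale bracket vscale act" and "finite_dim vscale"
    and "irreducible_action vscale act" and "faithful_action act"
    and "highest_weight_vector scale bracket H I \<alpha> vscale act \<Lambda> v"
    and "group_closure (weights scale vscale act H) = weight_lattice scale H I h"
  shows "G_Z \<inter> U_Q = \<Gamma>_Z \<inter> U_Q \<and> (\<forall>g\<in>U_Q. g ` V_Z = V_Z \<longrightarrow> g \<in> G_Z)"
proof -
  have lie: "lie_algebra scale bracket"
    using \<open>simple_lie_algebra scale bracket\<close> unfolding simple_lie_algebra_def by blast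
  interpret C: chevalley scale bracket H I \<alpha> coroot x
    by (intro chevalley.intro chevalley_axioms.intro lie) fact+
  have hw: "\<Lambda> \<in> dual scale H" "v \<noteq> 0" "v \<in> weight_space vscale act H \<Lambda>"
    using \<open>highest_weight_vector scale bracket H I \<alpha> vscale act \<Lambda> v\<close>
    unfolding highest_weight_vector_def by blast+
  have span: "module.span vscale (\<Union>\<mu>\<in>dual scale H. weight_space vscale act H \<mu>) = UNIV"
    by (rule C.weight_spaces_span_irreducible[OF _ _ hw(1,3,2)]) fact+
  interpret M: weight_module scale bracket H I \<alpha> coroot x vscale act
    by (intro weight_module.intro weight_module_axioms.intro C.chevalley_axioms span) fact+
  \<comment> \<open>Each weight lies in the group that the weights generate, which is the weight
    lattice by hypothesis.\<close>
  have integral: "\<mu> (coroot (\<alpha> i)) \<in> \<int>" if "\<mu> \<in> weights scale vscale act H" "i \<in> I" for \<mu> i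
  proof -
    have "\<mu> \<in> weight_lattice scale H I h"
      using group_closure.base[of \<mu> "weights scale vscale act H"] that(1)
        \<open>group_closure (weights scale vscale act H) = weight_lattice scale H I h\<close> by blast
    then show ?thesis using that(2) by (simp add: weight_lattice_def h_def)
  qed
  interpret highest_weight_module scale bracket H I \<alpha> coroot x vscale act \<Lambda> v
    by (intro highest_weight_module.intro highest_weight_module_axioms.intro M.weight_module_axioms integral) fact+
  have V: "V_Z = lattice"
    unfolding V_Z_def h_def by (rule lattice_Z_eq_lattice)
  have "G_Z \<subseteq> G_Q"
    unfolding G_Z_def G_Q_def h_def by (rule G_Z_subset_G_Q)
  moreover have "g ` V_Z = V_Z" if "g \<in> G_Z" for g
    using G_Z_stabilizes that unfolding V G_Z_def h_def by blast
  moreover have "g \<in> G_Z" if "g \<in> U_Q" "g ` V_Z = V_Z" for g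
    using unipotent_Q_stabilizer that unfolding V G_Z_def U_Q_def h_def by blast
  ultimately show ?thesis
    unfolding \<Gamma>_Z_def by blast
qed

end
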